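(* Let $G$ be a real Lie group. There is a one-to-one correspondence between left invariant generalized complex structures on $G$ and left invariant hermitian structures $(J,g)$ on the cotangent Lie group $T^*G$, where $g$ is the standard neutral metric on $T^*G$.
   Context: Let $\mathfrak g$ be the Lie algebra of $G$. The cotangent bundle $T^*G$ is regarded as the Lie group $G\ltimes\mathfrak g^*$ (coadjoint action, $\mathfrak g^*$ an abelian normal subgroup); its Lie algebra is $T^*\mathfrak g=\mathfrak g\oplus\mathfrak g^*$ with bracket $[(x,\alpha),(y,\beta)]=([x,y],-\beta\circ\mathrm{ad}(x)+\alpha\circ\mathrm{ad}(y))$. The standard neutral metric $g$ on $T^*G$ is the bi-invariant pseudo-Riemannian metric induced by the ad-invariant form $\langle (x,\alpha),(y,\beta)\rangle=\frac12(\beta(x)+\alpha(y))$ on $\mathfrak g\oplus\mathfrak g^*$. A left invariant hermitian structure on a Lie group $H$ with Lie algebra $\mathfrak h$ is a pair $(J,g)$ of a left invariant complex structure $J$ and a left invariant pseudo-Riemannian metric $g$ (not necessarily definite) with $J$ orthogonal for $g$; a left invariant complex structure is given by an endomorphism $J$ of $\mathfrak h$ with $J^2=-\mathrm{Id}$ and $N_J\equiv0$, where $N_J(u,v)=[u,v]+J[Ju,v]+J[u,Jv]-[Ju,Jv]$. A generalized complex structure on a manifold $M$ is an endomorphism $\mathcal J$ of $TM\oplus T^*M$ with $\mathcal J^2=-\mathrm{Id}$, orthogonal with respect to $\langle (X,\xi),(Y,\eta)\rangle=\frac12(\eta(X)+\xi(Y))$, whose $i$-eigenbundle in $(TM\oplus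 T^*M)\otimes\mathbb C$ is involutive with respect to the Courant bracket $[(X,\xi),(Y,\eta)]=([X,Y],\mathcal L_X\eta-\mathcal L_Y\xi-\frac12 d(i_X\eta-i_Y\xi))$. A generalized complex structure $\mathcal J$ on $G$ is left invariant if it is equivariant for the $G$-action on $TG\oplus T^*G$ given, for $a\in G$, by $\lambda_a(x,\alpha)=((dL_a)x,(L_{a^{-1}})^*\alpha)$. The correspondence associates to $\mathcal J$ its value $\mathcal J_e$ on the fibre $\mathfrak g\oplus\mathfrak g^*$ at the identity $e$. *)

theory Defs
  imports "HOL-Analysis.Analysis" "HOL-Algebra.Group" "HOL-Library.Function_Algebras"
begin

section \<open>Linear algebra on subspaces\<close>

instantiation "fun" :: (type, real_vector) real_vector
begin

definition scaleR_fun :: "real \<Rightarrow> ('a \<Rightarrow> 'b) \<Rightarrow> 'a \<Rightarrow> 'b"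
  where "c *\<^sub>R f = (\<lambda>x. c *\<^sub>R f x)"

instance
  by standard (simp_all add: scaleR_fun_def fun_eq_iff scaleR_add_right scaleR_add_left)

end

text \<open>Vector spaces such as tangent spaces are subspaces of a type of functions. A map defined on
  such a subspace is represented by the total function that extends it by zero, so that equality of
  maps is equality in HOL.\<close>

definition linear_on :: "'a::real_vector set \<Rightarrow> ('a \<Rightarrow> 'b::real_vector) \<Rightarrow> bool" where
  "linear_on V f \<longleftrightarrow>
     (\<forall>u\<in>V. \<forall>v\<in>V. f (u + v) = f u + f v) \<and> (\<forall>c. \<forall>v\<in>V. f (c *\<^sub>R v) = c *\<^sub>R f v)"

definition dual :: "'a::real_vector set \<Rightarrow> ('a \<Rightarrow> real) set" where
  "dual V = {\<alpha>. linear_on V \<alpha> \<and> (\<forall>v. v \<notin> V \<longrightarrow> \<alpha> v = 0)}"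

definition endos :: "'a::real_vector set \<Rightarrow> ('a \<Rightarrow> 'a) set" where
  "endos V = {J. linear_on V J \<and> J ` V \<subseteq> V \<and> (\<forall>v. v \<notin> V \<longrightarrow> J v = 0)}"


section \<open>Smooth manifolds\<close>

text \<open>Every type of class \<open>euclidean_space\<close> has positive dimension. So that 0-dimensional manifolds
  are included, the model space is an arbitrary linear subspace \<open>E\<close> of such a type, and \<open>W\<close> below
  is open relative to \<open>E\<close>; then the derivative within \<open>W\<close> is uniquely determined on \<open>E\<close>.\<close>

primrec Ck_on :: "'e::euclidean_space set \<Rightarrow> 'e set \<Rightarrow> nat \<Rightarrow> ('e \<Rightarrow> 'b::real_normed_vector) \<Rightarrow> bool"
where
  "Ck_on E W 0 = (\<lambda>f. continuous_on W f)"
| "Ck_on E W (Suc k) = (\<lambda>f. (\<forall>x\<in>W. f differentiable (at x within W)) \<and>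
     (\<forall>v\<in>E. Ck_on E W k (\<lambda>x. frechet_derivative f (at x within W) v)))"

definition smooth_on :: "'e::euclidean_space set \<Rightarrow> 'e set \<Rightarrow> ('e \<Rightarrow> 'b::real_normed_vector) \<Rightarrow> bool"
  where "smooth_on E W f \<longleftrightarrow> (\<forall>k. Ck_on E W k f)"

record ('m, 'e) manifold =
  model :: "'e set"
  charts :: "('m set \<times> ('m \<Rightarrow> 'e)) set"

definition smooth_map ::
  "('m::topological_space, 'e::euclidean_space) manifold \<Rightarrow>
   ('n::topological_space, 'd::euclidean_space) manifold \<Rightarrow> ('m \<Rightarrow> 'n) \<Rightarrow> bool" where
  "smooth_map M N F \<longleftrightarrow> continuous_on UNIV F \<and>
     (\<forall>(U, \<phi>) \<in> charts M. \<forall>(V, \<psi>) \<in> charts N.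
        smooth_on (model M) (\<phi> ` (U \<inter> F -` V)) (\<psi> \<circ> F \<circ> inv_into U \<phi>))"

definition prod_manifold ::
  "('m, 'e) manifold \<Rightarrow> ('n, 'd) manifold \<Rightarrow> ('m \<times> 'n, 'e \<times> 'd) manifold" where
  "prod_manifold M N =
     \<lparr>model = model M \<times> model N,
      charts = {(U \<times> V, map_prod \<phi> \<psi>) |U \<phi> V \<psi>. (U, \<phi>) \<in> charts M \<and> (V, \<psi>) \<in> charts N}\<rparr>"

locale smooth_manifold =
  fixes M :: "('m::{t2_space, second_countable_topology}, 'e::euclidean_space) manifold"
  assumes subspace_model: "subspace (model M)"
    and chart_domain_open: "(U, \<phi>) \<in> charts M \<Longrightarrow> open U"
    and chart_image_open: "(U, \<phi>) \<in> charts M \<Longrightarrow> openin (top_of_set (model M)) (\<phi> ` U)"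
    and chart_homeomorphism: "(U, \<phi>) \<in> charts M \<Longrightarrow> homeomorphism U (\<phi> ` U) \<phi> (inv_into U \<phi>)"
    and charts_cover: "(\<Union>(U, \<phi>) \<in> charts M. U) = UNIV"
    and charts_compatible: "(U, \<phi>) \<in> charts M \<Longrightarrow> (V, \<psi>) \<in> charts M \<Longrightarrow>
          smooth_on (model M) (\<phi> ` (U \<inter> V)) (\<psi> \<circ> inv_into U \<phi>)"

locale lie_group = group G + smooth_manifold M
  for G :: "('g::{t2_space, second_countable_topology}, 'b) monoid_scheme" (structure)
    and M :: "('g, 'e::euclidean_space) manifold" +
  assumes carrier_UNIV: "carrier G = UNIV"
    and smooth_mult: "smooth_map (prod_manifold M M) M (\<lambda>(a, b). a \<otimes> b)"
    and smooth_inv: "smooth_map M M (\<lambda>a. inv a)"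


section \<open>Vector fields and differential forms\<close>

type_synonym 'm tvec = "('m \<Rightarrow> real) \<Rightarrow> real"
type_synonym 'm covec = "'m tvec \<Rightarrow> real"
type_synonym 'm gvec = "'m tvec \<times> 'm covec"

definition smooth_functions :: "('m, 'e::euclidean_space) manifold \<Rightarrow> ('m \<Rightarrow> real) set" where
  "smooth_functions M =
     {f. \<forall>(U, \<phi>) \<in> charts M. smooth_on (model M) (\<phi> ` U) (f \<circ> inv_into U \<phi>)}"

text \<open>Tangent vectors at \<open>p\<close> are the derivations at \<open>p\<close> of the algebra of smooth functions.\<close>

definition tangent_space :: "('m, 'e::euclidean_space) manifold \<Rightarrow> 'm \<Rightarrow> 'm tvec set" where
  "tangent_space M p =
     {v \<in> dual (smooth_functions M).
        \<forall>f \<in> smooth_functions M. \<forall>h \<in> smooth_functions M. v (f * h) = f p * v h + h p * v f}"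

definition cotangent_space :: "('m, 'e::euclidean_space) manifold \<Rightarrow> 'm \<Rightarrow> 'm covec set" where
  "cotangent_space M p = dual (tangent_space M p)"

definition vector_fields :: "('m, 'e::euclidean_space) manifold \<Rightarrow> ('m \<Rightarrow> 'm tvec) set" where
  "vector_fields M =
     {X. (\<forall>p. X p \<in> tangent_space M p) \<and>
         (\<forall>f \<in> smooth_functions M. (\<lambda>p. X p f) \<in> smooth_functions M)}"

definition one_forms :: "('m, 'e::euclidean_space) manifold \<Rightarrow> ('m \<Rightarrow> 'm covec) set" where
  "one_forms M =
     {\<xi>. (\<forall>p. \<xi> p \<in> cotangent_space M p) \<and>
         (\<forall>X \<in> vector_fields M. (\<lambda>p. \<xi> p (X p)) \<in> smooth_functions M)}"

definition field_bracket ::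
  "('m, 'e::euclidean_space) manifold \<Rightarrow> ('m \<Rightarrow> 'm tvec) \<Rightarrow> ('m \<Rightarrow> 'm tvec) \<Rightarrow> 'm \<Rightarrow> 'm tvec" where
  "field_bracket M X Y p =
     (\<lambda>f. if f \<in> smooth_functions M then X p (\<lambda>q. Y q f) - Y p (\<lambda>q. X q f) else 0)"

definition exterior_deriv ::
  "('m, 'e::euclidean_space) manifold \<Rightarrow> ('m \<Rightarrow> real) \<Rightarrow> 'm \<Rightarrow> 'm covec" where
  "exterior_deriv M f p = (\<lambda>v. if v \<in> tangent_space M p then v f else 0)"

definition contract :: "('m \<Rightarrow> 'm tvec) \<Rightarrow> ('m \<Rightarrow> 'm covec) \<Rightarrow> 'm \<Rightarrow> real" where
  "contract X \<xi> = (\<lambda>p. \<xi> p (X p))"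

text \<open>The Lie derivative of a 1-form is the 1-form determined by
  \<open>(L\<^sub>X \<eta>)(Z) = X(\<eta>(Z)) - \<eta>([X, Z])\<close> for all vector fields \<open>Z\<close>.\<close>

definition lie_deriv ::
  "('m, 'e::euclidean_space) manifold \<Rightarrow> ('m \<Rightarrow> 'm tvec) \<Rightarrow> ('m \<Rightarrow> 'm covec) \<Rightarrow> 'm \<Rightarrow> 'm covec" where
  "lie_deriv M X \<eta> =
     (THE \<zeta>. \<zeta> \<in> one_forms M \<and>
        (\<forall>Z \<in> vector_fields M. \<forall>p.
           \<zeta> p (Z p) = X p (contract Z \<eta>) - \<eta> p (field_bracket M X Z p)))"


section \<open>Generalized complex structures\<close>

definition gen_space :: "('m, 'e::euclidean_space) manifold \<Rightarrow> 'm \<Rightarrow> 'm gvec set" where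
  "gen_space M p = tangent_space M p \<times> cotangent_space M p"

definition gen_sections :: "('m, 'e::euclidean_space) manifold \<Rightarrow> ('m \<Rightarrow> 'm gvec) set" where
  "gen_sections M = {A. fst \<circ> A \<in> vector_fields M \<and> snd \<circ> A \<in> one_forms M}"

definition neutral_pairing :: "'a \<times> ('a \<Rightarrow> real) \<Rightarrow> 'a \<times> ('a \<Rightarrow> real) \<Rightarrow> real" where
  "neutral_pairing = (\<lambda>(x, \<alpha>) (y, \<beta>). (1/2) * (\<beta> x + \<alpha> y))"

definition courant ::
  "('m, 'e::euclidean_space) manifold \<Rightarrow> ('m \<Rightarrow> 'm gvec) \<Rightarrow> ('m \<Rightarrow> 'm gvec) \<Rightarrow> 'm \<Rightarrow> 'm gvec" where
  "courant M A B =
     (let X = fst \<circ> A; \<xi> = snd \<circ> A; Y = fst \<circ> B; \<eta> = snd \<circ> B in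
      (\<lambda>p. (field_bracket M X Y p,
            lie_deriv M X \<eta> p - lie_deriv M Y \<xi> p
              - (1/2) *\<^sub>R exterior_deriv M (contract X \<eta> - contract Y \<xi>) p)))"

text \<open>The complexification of a real vector space \<open>V\<close> is \<open>V \<times> V\<close>, where \<open>(u, v)\<close> stands for
  \<open>u + i v\<close>. The Courant bracket is extended complex bilinearly.\<close>

definition cpx_i :: "'a::real_vector \<times> 'a \<Rightarrow> 'a \<times> 'a" where
  "cpx_i = (\<lambda>(u, v). (- v, u))"

definition cpx_sections ::
  "('m, 'e::euclidean_space) manifold \<Rightarrow> ('m \<Rightarrow> 'm gvec \<times> 'm gvec) set" where
  "cpx_sections M = {S. fst \<circ> S \<in> gen_sections M \<and> snd \<circ> S \<in> gen_sections M}"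

definition cpx_courant ::
  "('m, 'e::euclidean_space) manifold \<Rightarrow> ('m \<Rightarrow> 'm gvec \<times> 'm gvec) \<Rightarrow> ('m \<Rightarrow> 'm gvec \<times> 'm gvec) \<Rightarrow>
     'm \<Rightarrow> 'm gvec \<times> 'm gvec" where
  "cpx_courant M S T =
     (let A = fst \<circ> S; B = snd \<circ> S; C = fst \<circ> T; D = snd \<circ> T in
      (\<lambda>p. (courant M A C p - courant M B D p, courant M A D p + courant M B C p)))"

definition i_eigenspace :: "'a::real_vector set \<Rightarrow> ('a \<Rightarrow> 'a) \<Rightarrow> ('a \<times> 'a) set" where
  "i_eigenspace V J = {w \<in> V \<times> V. map_prod J J w = cpx_i w}"

definition generalized_complex ::
  "('m, 'e::euclidean_space) manifold \<Rightarrow> ('m \<Rightarrow> 'm gvec \<Rightarrow> 'm gvec) \<Rightarrow> bool" where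
  "generalized_complex M \<J> \<longleftrightarrow>
     (\<forall>p. \<J> p \<in> endos (gen_space M p)) \<and>
     (\<forall>A \<in> gen_sections M. (\<lambda>p. \<J> p (A p)) \<in> gen_sections M) \<and>
     (\<forall>p. \<forall>u \<in> gen_space M p. \<J> p (\<J> p u) = - u) \<and>
     (\<forall>p. \<forall>u \<in> gen_space M p. \<forall>v \<in> gen_space M p.
        neutral_pairing (\<J> p u) (\<J> p v) = neutral_pairing u v) \<and>
     (\<forall>S \<in> cpx_sections M. \<forall>T \<in> cpx_sections M.
        (\<forall>p. S p \<in> i_eigenspace (gen_space M p) (\<J> p)) \<longrightarrow>
        (\<forall>p. T p \<in> i_eigenspace (gen_space M p) (\<J> p)) \<longrightarrow>
        (\<forall>p. cpx_courant M S T p \<in> i_eigenspace (gen_space M p) (\<J> p)))"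


section \<open>Left invariance\<close>

definition pushforward :: "('m, 'e::euclidean_space) manifold \<Rightarrow> ('m \<Rightarrow> 'm) \<Rightarrow> 'm tvec \<Rightarrow> 'm tvec" where
  "pushforward M F v = (\<lambda>f. if f \<in> smooth_functions M then v (f \<circ> F) else 0)"

text \<open>\<open>pullback M F p\<close> maps covectors at \<open>F p\<close> to covectors at \<open>p\<close>.\<close>

definition pullback ::
  "('m, 'e::euclidean_space) manifold \<Rightarrow> ('m \<Rightarrow> 'm) \<Rightarrow> 'm \<Rightarrow> 'm covec \<Rightarrow> 'm covec" where
  "pullback M F p \<alpha> = (\<lambda>v. if v \<in> tangent_space M p then \<alpha> (pushforward M F v) else 0)"

definition left_translation :: "('g, 'b) monoid_scheme \<Rightarrow> 'g \<Rightarrow> 'g \<Rightarrow> 'g" where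
  "left_translation G a = (\<lambda>b. a \<otimes>\<^bsub>G\<^esub> b)"

text \<open>The action of \<open>a\<close>, as a map from the fibre at \<open>b\<close> to the fibre at \<open>a b\<close>.\<close>

definition left_action ::
  "('g, 'b) monoid_scheme \<Rightarrow> ('g, 'e::euclidean_space) manifold \<Rightarrow> 'g \<Rightarrow> 'g \<Rightarrow> 'g gvec \<Rightarrow> 'g gvec" where
  "left_action G M a b =
     (\<lambda>(x, \<alpha>). (pushforward M (left_translation G a) x,
                pullback M (left_translation G (inv\<^bsub>G\<^esub> a)) (a \<otimes>\<^bsub>G\<^esub> b) \<alpha>))"

definition left_invariant ::
  "('g, 'b) monoid_scheme \<Rightarrow> ('g, 'e::euclidean_space) manifold \<Rightarrow> ('g \<Rightarrow> 'g gvec \<Rightarrow> 'g gvec) \<Rightarrow> bool"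
where
  "left_invariant G M \<J> \<longleftrightarrow>
     (\<forall>a b. \<forall>u \<in> gen_space M b.
        \<J> (a \<otimes>\<^bsub>G\<^esub> b) (left_action G M a b u) = left_action G M a b (\<J> b u))"

definition lie_algebra ::
  "('g, 'b) monoid_scheme \<Rightarrow> ('g, 'e::euclidean_space) manifold \<Rightarrow> 'g tvec set" where
  "lie_algebra G M = tangent_space M \<one>\<^bsub>G\<^esub>"

definition left_field ::
  "('g, 'b) monoid_scheme \<Rightarrow> ('g, 'e::euclidean_space) manifold \<Rightarrow> 'g tvec \<Rightarrow> 'g \<Rightarrow> 'g tvec" where
  "left_field G M x = (\<lambda>a. pushforward M (left_translation G a) x)"

definition lie_bracket ::
  "('g, 'b) monoid_scheme \<Rightarrow> ('g, 'e::euclidean_space) manifold \<Rightarrow> 'g tvec \<Rightarrow> 'g tvec \<Rightarrow> 'g tvec" where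
  "lie_bracket G M x y = field_bracket M (left_field G M x) (left_field G M y) \<one>\<^bsub>G\<^esub>"


section \<open>Hermitian structures on the cotangent Lie group\<close>

text \<open>For a Lie algebra \<open>L\<close> with bracket \<open>br\<close>, the underlying space and the bracket of
  \<open>T\<^sup>*L = L \<oplus> L\<^sup>*\<close>. If \<open>L\<close> is the Lie algebra of \<open>G\<close>, this is the Lie algebra of the cotangent
  Lie group of \<open>G\<close>, the semidirect product of \<open>G\<close> and \<open>L\<^sup>*\<close> for the coadjoint action.\<close>

definition cotangent_algebra :: "'a::real_vector set \<Rightarrow> ('a \<times> ('a \<Rightarrow> real)) set" where
  "cotangent_algebra L = L \<times> dual L"

definition cotangent_bracket ::
  "'a::real_vector set \<Rightarrow> ('a \<Rightarrow> 'a \<Rightarrow> 'a) \<Rightarrow>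
     'a \<times> ('a \<Rightarrow> real) \<Rightarrow> 'a \<times> ('a \<Rightarrow> real) \<Rightarrow> 'a \<times> ('a \<Rightarrow> real)" where
  "cotangent_bracket L br =
     (\<lambda>(x, \<alpha>) (y, \<beta>). (br x y, \<lambda>z. if z \<in> L then - \<beta> (br x z) + \<alpha> (br y z) else 0))"

text \<open>Left invariant tensors on a Lie group are given by tensors on its Lie algebra, here a
  space \<open>H\<close> with bracket \<open>br\<close>.\<close>

definition left_inv_complex ::
  "'a::real_vector set \<Rightarrow> ('a \<Rightarrow> 'a \<Rightarrow> 'a) \<Rightarrow> ('a \<Rightarrow> 'a) \<Rightarrow> bool" where
  "left_inv_complex H br J \<longleftrightarrow>
     J \<in> endos H \<and>
     (\<forall>u\<in>H. J (J u) = - u) \<and>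
     (\<forall>u\<in>H. \<forall>v\<in>H. br u v + J (br (J u) v) + J (br u (J v)) - br (J u) (J v) = 0)"

definition left_inv_metric :: "'a::real_vector set \<Rightarrow> ('a \<Rightarrow> 'a \<Rightarrow> real) \<Rightarrow> bool" where
  "left_inv_metric H g \<longleftrightarrow>
     (\<forall>u\<in>H. linear_on H (g u)) \<and>
     (\<forall>u\<in>H. \<forall>v\<in>H. g u v = g v u) \<and>
     (\<forall>u\<in>H. (\<forall>v\<in>H. g u v = 0) \<longrightarrow> u = 0)"

definition left_inv_hermitian ::
  "'a::real_vector set \<Rightarrow> ('a \<Rightarrow> 'a \<Rightarrow> 'a) \<Rightarrow> ('a \<Rightarrow> 'a) \<Rightarrow> ('a \<Rightarrow> 'a \<Rightarrow> real) \<Rightarrow> bool" where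
  "left_inv_hermitian H br J g \<longleftrightarrow>
     left_inv_complex H br J \<and> left_inv_metric H g \<and>
     (\<forall>u\<in>H. \<forall>v\<in>H. g (J u) (J v) = g u v)"

end

theory Submission
  imports Defs
begin

text \<open>A left invariant \<open>\<J>\<close> is determined by its value at the identity, and a value \<open>J\<close> there
  extends to a left invariant \<open>\<J>\<close>. The Courant bracket of left invariant sections is the left
  invariant section of the bracket of \<open>T\<^sup>*\<g>\<close>: the pairings of left invariant fields with left
  invariant forms are constant, so only the \<open>- \<eta>([X, Z])\<close> part of \<open>(L\<^sub>X \<eta>)(Z)\<close> survives.
  Integrability of \<open>\<J>\<close> says that its Nijenhuis expression for the Courant bracket vanishes. Since
  \<open>\<J>\<close> is orthogonal, this expression is linear over the smooth functions, so it suffices to test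
  it on left invariant sections, where it is the Nijenhuis tensor of \<open>J\<close>.

  That left invariant sections generate all sections over the smooth functions, and that they are
  smooth at all, rests on the description of derivations in a chart (Hadamard's lemma, cut off by
  a bump function).\<close>

section \<open>Calculus on relatively open subsets of a subspace\<close>

text \<open>Two obstacles shape the analytic half. The model space is a subspace \<open>E\<close>,
  possibly zero, so \<open>frechet_derivative\<close> is determined only in directions of
  \<open>E\<close>; every statement of calculus is made for those directions, and linear maps are
  expanded in an orthonormal basis of \<open>E\<close>. And tangent vectors act on global smooth
  functions only, while charts supply local ones, so coordinates have to be cut off before a vector
  can be applied to them. Smoothness of the left invariant field of x means that x, applied to f(ab)
  in the variable b, depends smoothly on a. An abstract derivation does not visibly commute with a
  parameter; written as a combination of partial derivatives it does. The same argument with f(a^-1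
  b) makes the coefficients of an arbitrary field in a left invariant frame smooth. Generation is
  expressed by induction rules, which reduce each tensorial identity to its left invariant case.
  Extending tangent vectors to left invariant fields also settles existence and uniqueness of the
  Lie derivative.\<close>

definition onb :: "'e::euclidean_space set \<Rightarrow> 'e set" where
  "onb E = (SOME B. finite B \<and> B \<subseteq> E \<and> (\<forall>v\<in>E. (\<Sum>b\<in>B. (v \<bullet> b) *\<^sub>R b) = v))"

text \<open>For the zero subspace the family is empty and the sum is 0, so zero-dimensional models
  fall under the same formulas as all others.\<close>

lemma onb_exists:
  fixes E :: "'e::euclidean_space set"
  assumes "subspace E"
  shows "\<exists>B. finite B \<and> B \<subseteq> E \<and> (\<forall>v\<in>E. (\<Sum>b\<in>B. (v \<bullet> b) *\<^sub>R b) = v)"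
proof -
  obtain B where B: "B \<subseteq> E" "pairwise orthogonal B" "\<And>x. x \<in> B \<Longrightarrow> norm x = 1"
    "independent B" "card B = dim E" "span B = E"
    using orthonormal_basis_subspace[OF assms] by blast
  have fin: "finite B" using B(4) by (simp add: independent_imp_finite)
  have "(\<Sum>b\<in>B. (v \<bullet> b) *\<^sub>R b) = v" if "v \<in> E" for v
  proof -
    have "v \<in> span B" using that B(6) by simp
    from orthonormal_basis_expand[OF B(2,3) this fin] show ?thesis .
  qed
  then show ?thesis using fin B(1) by blast
qed

lemma
  fixes E :: "'e::euclidean_space set"
  assumes "subspace E"
  shows finite_onb: "finite (onb E)"
    and onb_subset: "onb E \<subseteq> E"
    and onb_expand: "v \<in> E \<Longrightarrow> (\<Sum>b\<in>onb E. (v \<bullet> b) *\<^sub>R b) = v"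
  using someI_ex[OF onb_exists[OF assms]] unfolding onb_def[symmetric] by auto

text \<open>The two halves work together: differences of points of \<open>W\<close> lie in
  \<open>E\<close>, and small steps in directions of \<open>E\<close> stay in \<open>W\<close>. This
  is what pins derivatives down on \<open>E\<close>.\<close>

definition relopen :: "'e::euclidean_space set \<Rightarrow> 'e set \<Rightarrow> bool" where
  "relopen E W \<longleftrightarrow> subspace E \<and> openin (top_of_set E) W"

lemma relopen_UNIV: "open W \<Longrightarrow> relopen UNIV W"
  by (simp add: relopen_def)

lemma relopen_subspace: "relopen E W \<Longrightarrow> subspace E"
  by (simp add: relopen_def)

lemma relopen_subset: "relopen E W \<Longrightarrow> W \<subseteq> E"
  by (auto simp: relopen_def dest: openin_imp_subset)

lemma relopen_ball:
  assumes "relopen E W" "x \<in> W"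
  obtains e where "e > 0" "ball x e \<inter> E \<subseteq> W"
  using assms unfolding relopen_def by (auto simp: openin_contains_ball)

lemma relopen_openI:
  assumes "subspace E" "open T" "W = E \<inter> T"
  shows "relopen E W"
  using assms by (auto simp: relopen_def openin_open)

lemma relopen_Times:
  assumes "relopen E W" "relopen D V"
  shows "relopen (E \<times> D) (W \<times> V)"
  using assms unfolding relopen_def
  by (auto simp: subspace_Times openin_Times_eq)

text \<open>Near \<open>x\<close> the sets \<open>W\<close> and \<open>E\<close> coincide.
  Derivatives within two relatively open sets can thus be exchanged, so differentiability is local
  although \<open>Ck_on\<close> mentions a domain.\<close>

lemma at_within_relopen:
  assumes "relopen E W" "x \<in> W"
  shows "at x within W = at x within E"
proof -
  obtain T where T: "open T" "W = E \<inter> T" using assms(1) by (auto simp: relopen_def openin_open)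
  show ?thesis
    by (rule at_within_nhd[of _ T]) (use T assms(2) in auto)
qed

text \<open>For \<open>v\<close> in \<open>E\<close> the line x + t v stays in \<open>W\<close> for
  small t. Along it the derivative becomes that of a function of one real variable on an open set,
  where it is unique.\<close>

lemma has_derivative_unique_relopen:
  fixes f :: "'e::euclidean_space \<Rightarrow> 'b::real_normed_vector"
  assumes W: "relopen E W" "x \<in> W" and v: "v \<in> E"
    and D: "(f has_derivative D) (at x within W)" "(f has_derivative D') (at x within W)"
  shows "D v = D' v"
proof -
  obtain e where e: "e > 0" "ball x e \<inter> E \<subseteq> W" using relopen_ball[OF W] .
  have xE: "x \<in> E" using W relopen_subset by blast
  define p where "p = (\<lambda>t::real. x + t *\<^sub>R v)"
  define T where "T = p -` ball x e"
  have contp: "continuous_on UNIV p" unfolding p_def by (intro continuous_intros)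
  have T: "open T" "0 \<in> T"
    using contp e by (auto simp: T_def p_def open_vimage)
  have pW: "p ` T \<subseteq> W"
    using e(2) xE v relopen_subspace[OF W(1)]
    by (auto simp: T_def p_def subspace_add subspace_scale)
  have dp: "(p has_derivative (\<lambda>t. t *\<^sub>R v)) (at 0 within T)"
    unfolding p_def by (auto intro!: derivative_eq_intros)
  have "((\<lambda>t. f (p t)) has_vector_derivative D'' v) (at 0)"
    if "(f has_derivative D'') (at x within W)" for D''
  proof -
    have "((\<lambda>t. f (p t)) has_derivative (\<lambda>t. D'' (t *\<^sub>R v))) (at 0 within T)"
      by (rule has_derivative_in_compose[OF dp])
        (use has_derivative_subset[OF that pW] in \<open>simp add: p_def\<close>)
    moreover have "(\<lambda>t. D'' (t *\<^sub>R v)) = (\<lambda>t. t *\<^sub>R D'' v)"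
      using linear_scale[OF has_derivative_linear[OF that]] by (rule ext)
    ultimately show ?thesis
      unfolding has_vector_derivative_def at_within_open[OF T(2,1)] by simp
  qed
  from this[OF D(1)] this[OF D(2)] show ?thesis by (rule vector_derivative_unique_at)
qed

lemma frechet_derivative_relopen:
  fixes f :: "'e::euclidean_space \<Rightarrow> 'b::real_normed_vector"
  assumes "relopen E W" "x \<in> W" "v \<in> E" "(f has_derivative D) (at x within W)"
  shows "frechet_derivative f (at x within W) v = D v"
  by (rule has_derivative_unique_relopen[OF assms(1-3) _ assms(4)])
    (use assms(4) in \<open>auto simp: frechet_derivative_works[symmetric] differentiable_def\<close>)

lemma frechet_derivative_cong:
  assumes "\<And>x. x \<in> W \<Longrightarrow> f x = g x" "x \<in> W"
  shows "frechet_derivative f (at x within W) = frechet_derivative g (at x within W)"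
proof -
  have "(f has_derivative D) (at x within W) = (g has_derivative D) (at x within W)" for D
    using assms by (metis has_derivative_transform)
  then show ?thesis by (simp add: frechet_derivative_def)
qed

lemma frechet_derivative_relopen_subset:
  assumes "relopen E W" "relopen E W'" "x \<in> W" "x \<in> W'"
  shows "frechet_derivative f (at x within W) = frechet_derivative f (at x within W')"
  using at_within_relopen[OF assms(1,3)] at_within_relopen[OF assms(2,4)] by simp

section \<open>Closure properties of finitely often differentiable functions\<close>

lemma Ck_on_cong:
  assumes "\<And>x. x \<in> W \<Longrightarrow> f x = g x"
  shows "Ck_on E W k f \<longleftrightarrow> Ck_on E W k g"
  using assms
proof (induction k arbitrary: f g)
  case 0
  then show ?case using continuous_on_cong[OF refl, of W f g] by simp
next
  case (Suc k)
  have "f differentiable (at x within W) \<longleftrightarrow> g differentiable (at x within W)" if "x \<in> W" for x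
    using Suc.prems that unfolding differentiable_def by (metis has_derivative_transform)
  moreover have "Ck_on E W k (\<lambda>x. frechet_derivative f (at x within W) v) \<longleftrightarrow>
      Ck_on E W k (\<lambda>x. frechet_derivative g (at x within W) v)" for v
    by (rule Suc.IH) (simp add: frechet_derivative_cong[OF Suc.prems])
  ultimately show ?case by simp
qed

text \<open>\<open>Ck_on\<close> refers to the derivative chosen by
  \<open>frechet_derivative\<close>. Since all derivatives agree on \<open>E\<close>, any explicit
  one may be supplied; later inductions on the order go through this rule.\<close>

lemma Ck_on_SucI:
  fixes f :: "'e::euclidean_space \<Rightarrow> 'b::real_normed_vector"
  assumes "relopen E W" "\<And>x. x \<in> W \<Longrightarrow> (f has_derivative D x) (at x within W)"
    and "\<And>v. v \<in> E \<Longrightarrow> Ck_on E W k (\<lambda>x. D x v)"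
  shows "Ck_on E W (Suc k) f"
proof -
  have "Ck_on E W k (\<lambda>x. frechet_derivative f (at x within W) v)" if "v \<in> E" for v
    using assms(3)[OF that] frechet_derivative_relopen[OF assms(1) _ that assms(2)]
    by (subst Ck_on_cong[where g = "\<lambda>x. D x v"]) auto
  then show ?thesis using assms(2) by (auto simp: differentiable_def)
qed

lemma Ck_on_SucD:
  fixes f :: "'e::euclidean_space \<Rightarrow> 'b::real_normed_vector"
  assumes "Ck_on E W (Suc k) f"
  shows "x \<in> W \<Longrightarrow> (f has_derivative frechet_derivative f (at x within W)) (at x within W)"
    and "v \<in> E \<Longrightarrow> Ck_on E W k (\<lambda>x. frechet_derivative f (at x within W) v)"
  using assms by (auto simp: frechet_derivative_works[symmetric])

declare Ck_on.simps(2) [simp del]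

lemma Ck_on_Suc_imp:
  "Ck_on E W (Suc k) f \<Longrightarrow> Ck_on E W k f"
proof (induction k arbitrary: f)
  case 0
  then have "continuous_on W f"
    by (intro differentiable_imp_continuous_on) (auto simp: differentiable_on_def Ck_on.simps)
  then show ?case by simp
next
  case (Suc k)
  show ?case
    unfolding Ck_on.simps(2)[of E W k]
  proof (intro conjI ballI)
    show "f differentiable (at x within W)" if "x \<in> W" for x
      using Suc.prems that by (simp add: Ck_on.simps(2)[of E W "Suc k"])
    show "Ck_on E W k (\<lambda>x. frechet_derivative f (at x within W) v)" if "v \<in> E" for v
      using Suc.prems that by (intro Suc.IH) (simp add: Ck_on.simps(2)[of E W "Suc k"])
  qed
qed

lemma Ck_on_imp_continuous_on: "Ck_on E W k f \<Longrightarrow> continuous_on W f"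
  by (induction k) (auto dest: Ck_on_Suc_imp)

lemma Ck_on_subset:
  assumes "relopen E W" "relopen E W'" "W' \<subseteq> W" "Ck_on E W k f"
  shows "Ck_on E W' k f"
  using assms(4)
proof (induction k arbitrary: f)
  case 0
  then show ?case using assms(3) by (auto intro: continuous_on_subset)
next
  case (Suc k)
  have "Ck_on E W' k (\<lambda>x. frechet_derivative f (at x within W) v)" if "v \<in> E" for v
    by (intro Suc.IH Ck_on_SucD(2)[OF Suc.prems] that)
  moreover have "(f has_derivative frechet_derivative f (at x within W)) (at x within W')"
    if "x \<in> W'" for x
    using that assms(3) by (auto intro: has_derivative_subset Ck_on_SucD(1)[OF Suc.prems])
  ultimately show ?case by (intro Ck_on_SucI[OF assms(2)])
qed

text \<open>The limits at a point depend only on the filter at that point within \<open>E\<close>,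
  which every neighbourhood shares. The induction generalizes over \<open>f\<close> because the
  hypothesis is applied to directional derivatives.\<close>

lemma Ck_on_local:
  assumes W: "relopen E W"
    and loc: "\<And>x. x \<in> W \<Longrightarrow> \<exists>V. x \<in> V \<and> relopen E V \<and> V \<subseteq> W \<and> Ck_on E V k f"
  shows "Ck_on E W k f"
  using loc
proof (induction k arbitrary: f)
  case 0
  have "continuous (at x within W) f" if x: "x \<in> W" for x
  proof -
    from 0[OF x] obtain V where V: "x \<in> V" "relopen E V" "continuous_on V f" by auto
    then have "continuous (at x within V) f" by (simp add: continuous_on_eq_continuous_within)
    then show ?thesis using at_within_relopen[OF W x] at_within_relopen[OF V(2,1)] by simp
  qed
  then show ?case by (simp add: continuous_on_eq_continuous_within)
next
  case (Suc k)
  have "(f has_derivative frechet_derivative f (at x within W)) (at x within W)" if x: "x \<in> W" for x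
  proof -
    from Suc.prems[OF x] obtain V where V: "x \<in> V" "relopen E V" "Ck_on E V (Suc k) f" by auto
    then show ?thesis
      using at_within_relopen[OF W x] at_within_relopen[OF V(2,1)] Ck_on_SucD(1)[OF V(3,1)] by simp
  qed
  moreover have "Ck_on E W k (\<lambda>x. frechet_derivative f (at x within W) v)" if v: "v \<in> E" for v
  proof (rule Suc.IH)
    fix x assume x: "x \<in> W"
    from Suc.prems[OF x] obtain V where V: "x \<in> V" "relopen E V" "V \<subseteq> W" "Ck_on E V (Suc k) f"
      by auto
    have "Ck_on E V k (\<lambda>x. frechet_derivative f (at x within W) v)"
      using Ck_on_SucD(2)[OF V(4) v] frechet_derivative_relopen_subset[OF W V(2), of _ f] V(3)
      by (subst Ck_on_cong[where g = "\<lambda>x. frechet_derivative f (at x within V) v"]) (auto simp: subset_iff)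
    then show "\<exists>V. x \<in> V \<and> relopen E V \<and> V \<subseteq> W \<and>
        Ck_on E V k (\<lambda>x. frechet_derivative f (at x within W) v)"
      using V by blast
  qed
  ultimately show ?case by (intro Ck_on_SucI[OF W])
qed

lemma Ck_on_const: "relopen E W \<Longrightarrow> Ck_on E W k (\<lambda>_. c)"
proof (induction k arbitrary: c)
  case (Suc k)
  then show ?case by (intro Ck_on_SucI[where D = "\<lambda>_ _. 0"]) auto
qed simp

lemma Ck_on_bounded_linear:
  assumes "relopen E W" "bounded_linear f"
  shows "Ck_on E W k f"
proof (cases k)
  case 0
  then show ?thesis using assms by (auto intro: linear_continuous_on)
next
  case (Suc l)
  then show ?thesis
    by (simp only: Suc, intro Ck_on_SucI[where D = "\<lambda>_. f"])
      (use assms in \<open>auto intro: bounded_linear_imp_has_derivative Ck_on_const\<close>)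
qed

lemma Ck_on_bounded_linear_comp:
  assumes "relopen E W" "bounded_linear h" "Ck_on E W k f"
  shows "Ck_on E W k (\<lambda>x. h (f x))"
  using assms(3)
proof (induction k arbitrary: f)
  case 0
  then show ?case by (auto intro: bounded_linear.continuous_on[OF assms(2)])
next
  case (Suc k)
  show ?case
    by (intro Ck_on_SucI[OF assms(1), where D = "\<lambda>x v. h (frechet_derivative f (at x within W) v)"]
        bounded_linear.has_derivative[OF assms(2)]
        Ck_on_SucD(1)[OF Suc.prems] Suc.IH Ck_on_SucD(2)[OF Suc.prems])
qed

lemma Ck_on_add:
  assumes "relopen E W" "Ck_on E W k f" "Ck_on E W k g"
  shows "Ck_on E W k (\<lambda>x. f x + g x)"
  using assms(2,3)
proof (induction k arbitrary: f g)
  case 0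
  then show ?case by (auto intro: continuous_intros)
next
  case (Suc k)
  show ?case
    by (intro Ck_on_SucI[OF assms(1), where D = "\<lambda>x v.
          frechet_derivative f (at x within W) v + frechet_derivative g (at x within W) v"] has_derivative_add
        Ck_on_SucD(1)[OF Suc.prems(1)]
        Ck_on_SucD(1)[OF Suc.prems(2)] Suc.IH Ck_on_SucD(2)[OF Suc.prems(1)]
        Ck_on_SucD(2)[OF Suc.prems(2)])
qed

text \<open>Treats products, scalar multiples and inner products at once. By the product rule the
  derivative is a sum of terms of the same bilinear shape, so the induction hypothesis applies to
  each, with the undifferentiated factor lowered by one order.\<close>

lemma Ck_on_bounded_bilinear:
  assumes "relopen E W" "bounded_bilinear h" "Ck_on E W k f" "Ck_on E W k g"
  shows "Ck_on E W k (\<lambda>x. h (f x) (g x))"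
  using assms(3,4)
proof (induction k arbitrary: f g)
  case 0
  then show ?case by (auto intro: bounded_bilinear.continuous_on[OF assms(2)])
next
  case (Suc k)
  show ?case
    by (intro Ck_on_SucI[OF assms(1), where D = "\<lambda>x v.
          h (f x) (frechet_derivative g (at x within W) v) + h (frechet_derivative f (at x within W) v) (g x)"]
        bounded_bilinear.FDERIV[OF assms(2)]
        Ck_on_SucD(1)[OF Suc.prems(1)] Ck_on_SucD(1)[OF Suc.prems(2)] Suc.IH
        Ck_on_SucD(2)[OF Suc.prems(1)] Ck_on_SucD(2)[OF Suc.prems(2)] Ck_on_add[OF assms(1)]
        Ck_on_Suc_imp[OF Suc.prems(1)] Ck_on_Suc_imp[OF Suc.prems(2)])
qed

lemma Ck_on_sum:
  assumes "relopen E W" "\<And>i. i \<in> I \<Longrightarrow> Ck_on E W k (f i)"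
  shows "Ck_on E W k (\<lambda>x. \<Sum>i\<in>I. f i x)"
  using assms by (induction I rule: infinite_finite_induct) (auto intro: Ck_on_const Ck_on_add)

text \<open>Projecting to \<open>D\<close> leaves \<open>f\<close> unchanged on \<open>W\<close>, so
  \<open>F\<close> followed by the projection is a derivative of \<open>f\<close> as well, and
  uniqueness identifies the two on \<open>E\<close>. The chain rule needs this: an outer derivative
  is determined on \<open>D\<close> only.\<close>

lemma has_derivative_in_subspace:
  fixes f :: "'e::euclidean_space \<Rightarrow> 'd::euclidean_space"
  assumes "relopen E W" "subspace D" "f ` W \<subseteq> D" "x \<in> W" "v \<in> E"
    and "(f has_derivative F) (at x within W)"
  shows "(\<Sum>b\<in>onb D. (F v \<bullet> b) *\<^sub>R b) = F v"
proof (rule has_derivative_unique_relopen[OF assms(1,4,5) _ assms(6)])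
  have "((\<lambda>x. \<Sum>b\<in>onb D. (f x \<bullet> b) *\<^sub>R b) has_derivative (\<lambda>v. \<Sum>b\<in>onb D. (F v \<bullet> b) *\<^sub>R b))
      (at x within W)"
    by (auto intro!: derivative_eq_intros assms(6))
  then show "(f has_derivative (\<lambda>v. \<Sum>b\<in>onb D. (F v \<bullet> b) *\<^sub>R b)) (at x within W)"
    by (rule has_derivative_transform[rotated 2])
      (use assms(3,4) onb_expand[OF assms(2)] in force)+
qed

text \<open>In the chain rule the outer derivative depends on \<open>x\<close> through its base
  point and through its argument. Expanding the argument in \<open>onb D\<close> separates the two:
  what remains are partial derivatives of \<open>g\<close> in fixed directions, composed with
  \<open>f\<close>, and these are covered by the induction hypothesis.\<close>

lemma Ck_on_compose:
  fixes f :: "'e::euclidean_space \<Rightarrow> 'd::euclidean_space" and g :: "'d \<Rightarrow> 'b::real_normed_vector"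
  assumes W: "relopen E W" and V: "relopen D V" and fW: "f ` W \<subseteq> V"
    and "Ck_on D V k g" "Ck_on E W k f"
  shows "Ck_on E W k (\<lambda>x. g (f x))"
  using assms(4,5)
proof (induction k arbitrary: g)
  case 0
  then show ?case using fW by (auto intro: continuous_on_compose2)
next
  case (Suc k)
  let ?F = "\<lambda>x. frechet_derivative f (at x within W)"
  let ?G = "\<lambda>y. frechet_derivative g (at y within V)"
  have dF: "(f has_derivative ?F x) (at x within W)" if "x \<in> W" for x
    using Ck_on_SucD(1)[OF Suc.prems(2) that] .
  have dG: "(g has_derivative ?G y) (at y within V)" if "y \<in> V" for y
    using Ck_on_SucD(1)[OF Suc.prems(1) that] .
  have sub: "subspace D" "f ` W \<subseteq> D" 
    using fW relopen_subset[OF V] relopen_subspace[OF V] by auto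
  show ?case
  proof (rule Ck_on_SucI[OF W])
    show "((\<lambda>x. g (f x)) has_derivative (\<lambda>v. ?G (f x) (?F x v))) (at x within W)" if "x \<in> W" for x
      by (rule has_derivative_in_compose2[OF dG fW that dF[OF that]])
    fix v assume v: "v \<in> E"
    have "?G (f x) (?F x v) = (\<Sum>b\<in>onb D. (?F x v \<bullet> b) *\<^sub>R ?G (f x) b)" if x: "x \<in> W" for x
    proof -
      have lin: "linear (?G (f x))" 
        using fW x by (intro has_derivative_linear[OF dG]) auto
      have "?G (f x) (?F x v) = ?G (f x) (\<Sum>b\<in>onb D. (?F x v \<bullet> b) *\<^sub>R b)"
        using has_derivative_in_subspace[OF W sub x v dF[OF x]] by simp
      then show ?thesis by (simp only: linear_sum[OF lin] linear_scale[OF lin])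
    qed
    moreover have "Ck_on E W k (\<lambda>x. \<Sum>b\<in>onb D. (?F x v \<bullet> b) *\<^sub>R ?G (f x) b)"
      by (intro Ck_on_sum[OF W] Ck_on_bounded_bilinear[OF W bounded_bilinear_scaleR]
          Ck_on_bounded_linear_comp[OF W bounded_linear_inner_left] Ck_on_SucD(2)[OF Suc.prems(2) v]
          Suc.IH Ck_on_Suc_imp[OF Suc.prems(2)] Ck_on_SucD(2)[OF Suc.prems(1)])
        (use onb_subset[OF sub(1)] in auto)
    ultimately show "Ck_on E W k (\<lambda>x. ?G (f x) (?F x v))"
      by (subst Ck_on_cong) auto
  qed
qed

lemma Ck_on_inverse:
  fixes f :: "'e::euclidean_space \<Rightarrow> real"
  assumes "relopen E W" "\<And>x. x \<in> W \<Longrightarrow> f x \<noteq> 0" "Ck_on E W k f"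
  shows "Ck_on E W k (\<lambda>x. inverse (f x))"
  using assms(3)
proof (induction k)
  case 0
  then show ?case using assms(2) by (auto intro: continuous_intros)
next
  case (Suc k)
  have neg: "Ck_on E W k (\<lambda>x. - g x)" if "Ck_on E W k g" for g :: "'e \<Rightarrow> real"
    using Ck_on_bounded_linear_comp[OF assms(1) bounded_linear_minus[OF bounded_linear_ident] that] .
  let ?F = "\<lambda>x. frechet_derivative f (at x within W)"
  show ?case
  proof (rule Ck_on_SucI[OF assms(1)])
    show "((\<lambda>x. inverse (f x)) has_derivative (\<lambda>v. - (inverse (f x) * ?F x v * inverse (f x))))
        (at x within W)" if "x \<in> W" for x
      by (intro Deriv.has_derivative_inverse assms(2) Ck_on_SucD(1)[OF Suc.prems] that)
    show "Ck_on E W k (\<lambda>x. - (inverse (f x) * ?F x v * inverse (f x)))" if "v \<in> E" for v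
      by (intro neg Ck_on_bounded_bilinear[OF assms(1) bounded_bilinear_mult] Suc.IH
          Ck_on_Suc_imp[OF Suc.prems] Ck_on_SucD(2)[OF Suc.prems] that)
  qed
qed

section \<open>The same rules for infinitely differentiable functions\<close>

lemma smooth_on_cong:
  "(\<And>x. x \<in> W \<Longrightarrow> f x = g x) \<Longrightarrow> smooth_on E W f \<longleftrightarrow> smooth_on E W g"
  unfolding smooth_on_def using Ck_on_cong by blast

lemma smooth_on_subset:
  "relopen E W \<Longrightarrow> relopen E W' \<Longrightarrow> W' \<subseteq> W \<Longrightarrow> smooth_on E W f \<Longrightarrow> smooth_on E W' f"
  unfolding smooth_on_def using Ck_on_subset by blast

lemma smooth_on_local:
  assumes "relopen E W"
    and "\<And>x. x \<in> W \<Longrightarrow> \<exists>V. x \<in> V \<and> relopen E V \<and> V \<subseteq> W \<and> smooth_on E V f"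
  shows "smooth_on E W f"
  unfolding smooth_on_def
proof
  fix k
  show "Ck_on E W k f"
    using assms(2) by (intro Ck_on_local[OF assms(1)]) (unfold smooth_on_def, blast)
qed

lemma smooth_on_const: "relopen E W \<Longrightarrow> smooth_on E W (\<lambda>_. c)"
  unfolding smooth_on_def using Ck_on_const by blast

lemma smooth_on_bounded_linear:
  "relopen E W \<Longrightarrow> bounded_linear f \<Longrightarrow> smooth_on E W f"
  unfolding smooth_on_def using Ck_on_bounded_linear by blast

lemma smooth_on_bounded_linear_comp:
  "relopen E W \<Longrightarrow> bounded_linear h \<Longrightarrow> smooth_on E W f \<Longrightarrow> smooth_on E W (\<lambda>x. h (f x))"
  unfolding smooth_on_def using Ck_on_bounded_linear_comp by blast

lemma smooth_on_add:
  "relopen E W \<Longrightarrow> smooth_on E W f \<Longrightarrow> smooth_on E W g \<Longrightarrow> smooth_on E W (\<lambda>x. f x + g x)"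
  unfolding smooth_on_def using Ck_on_add by blast

lemma smooth_on_uminus:
  "relopen E W \<Longrightarrow> smooth_on E W f \<Longrightarrow> smooth_on E W (\<lambda>x. - f x)"
  by (rule smooth_on_bounded_linear_comp[OF _ bounded_linear_minus[OF bounded_linear_ident]])

lemma smooth_on_diff:
  "relopen E W \<Longrightarrow> smooth_on E W f \<Longrightarrow> smooth_on E W g \<Longrightarrow> smooth_on E W (\<lambda>x. f x - g x)"
  using smooth_on_add[OF _ _ smooth_on_uminus, of E W f g] by simp

lemma smooth_on_bounded_bilinear:
  "relopen E W \<Longrightarrow> bounded_bilinear h \<Longrightarrow> smooth_on E W f \<Longrightarrow> smooth_on E W g \<Longrightarrow>
    smooth_on E W (\<lambda>x. h (f x) (g x))"
  unfolding smooth_on_def using Ck_on_bounded_bilinear by blast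

lemmas smooth_on_mult = smooth_on_bounded_bilinear[OF _ bounded_bilinear_mult]
lemmas smooth_on_inner = smooth_on_bounded_bilinear[OF _ bounded_bilinear_inner]

lemma smooth_on_sum:
  "relopen E W \<Longrightarrow> (\<And>i. i \<in> I \<Longrightarrow> smooth_on E W (f i)) \<Longrightarrow> smooth_on E W (\<lambda>x. \<Sum>i\<in>I. f i x)"
  unfolding smooth_on_def by (simp add: Ck_on_sum)

lemma smooth_on_compose:
  "relopen E W \<Longrightarrow> relopen D V \<Longrightarrow> f ` W \<subseteq> V \<Longrightarrow> smooth_on D V g \<Longrightarrow> smooth_on E W f \<Longrightarrow>
    smooth_on E W (\<lambda>x. g (f x))"
  unfolding smooth_on_def using Ck_on_compose[of E W D V f _ g] by simp

lemma smooth_on_inverse: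
  fixes f :: "'e::euclidean_space \<Rightarrow> real"
  shows "relopen E W \<Longrightarrow> (\<And>x. x \<in> W \<Longrightarrow> f x \<noteq> 0) \<Longrightarrow> smooth_on E W f \<Longrightarrow>
    smooth_on E W (\<lambda>x. inverse (f x))"
  unfolding smooth_on_def using Ck_on_inverse[of E W f] by simp

lemma smooth_on_Pair:
  assumes "relopen E W" "smooth_on E W f" "smooth_on E W g"
  shows "smooth_on E W (\<lambda>x. (f x, g x))"
proof -
  have "smooth_on E W (\<lambda>x. (f x, 0) + (0, g x))"
    by (intro smooth_on_add[OF assms(1)] smooth_on_bounded_linear_comp[OF assms(1) _ assms(2)]
        smooth_on_bounded_linear_comp[OF assms(1) _ assms(3)] bounded_linear_Pair
        bounded_linear_ident bounded_linear_zero)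
  then show ?thesis by simp
qed

lemma smooth_on_imp_continuous_on: "smooth_on E W f \<Longrightarrow> continuous_on W f"
  unfolding smooth_on_def using Ck_on_imp_continuous_on by blast

lemma smooth_on_has_derivative:
  "smooth_on E W f \<Longrightarrow> x \<in> W \<Longrightarrow>
    (f has_derivative frechet_derivative f (at x within W)) (at x within W)"
  unfolding smooth_on_def using Ck_on_SucD(1) by blast

lemma smooth_on_frechet_derivative:
  "smooth_on E W f \<Longrightarrow> v \<in> E \<Longrightarrow> smooth_on E W (\<lambda>x. frechet_derivative f (at x within W) v)"
  unfolding smooth_on_def using Ck_on_SucD(2) by blast

text \<open>\<open>flat 0\<close> is the classical function exp(-1/t), continued by 0. The powers of
  1/t are included to make the family stable under differentiation up to linear combinations, so
  that smoothness follows by induction on the order.\<close>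

definition flat :: "nat \<Rightarrow> real \<Rightarrow> real" where
  "flat n t = (if t > 0 then inverse t ^ n * exp (- inverse t) else 0)"

lemma flat_pos: "t > 0 \<Longrightarrow> flat n t > 0"
  by (simp add: flat_def)

lemma flat_eq_0: "t \<le> 0 \<Longrightarrow> flat n t = 0"
  by (simp add: flat_def)

lemma flat_tendsto_0: "(flat n \<longlongrightarrow> 0) (at 0)"
proof (rule filterlim_split_at)
  show "(flat n \<longlongrightarrow> 0) (at_left 0)"
    by (rule tendsto_eventually) (auto simp: eventually_at_filter flat_eq_0)
  have "((\<lambda>t. inverse t ^ n / exp (inverse t)) \<longlongrightarrow> 0) (at_right (0::real))"
    by (rule filterlim_compose[OF tendsto_power_div_exp_0 filterlim_inverse_at_top_right])
  then show "(flat n \<longlongrightarrow> 0) (at_right 0)"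
    by (rule Lim_transform_eventually)
      (auto simp: eventually_at_filter flat_def exp_minus divide_inverse)
qed

text \<open>At 0 the difference quotient of \<open>flat n\<close> is exactly
  \<open>flat (Suc n)\<close>, so the derivative there is the limit of the next member of the
  family.\<close>

lemma flat_deriv: "(flat n has_real_derivative flat (Suc (Suc n)) t - n * flat (Suc n) t) (at t)"
proof (cases t "0::real" rule: linorder_cases)
  case less
  have "((\<lambda>_. 0) has_real_derivative 0) (at t)" by simp
  then have "(flat n has_real_derivative 0) (at t)"
    by (rule has_field_derivative_transform_within_open[where S = "{..<0}"])
      (use less in \<open>auto simp: flat_eq_0\<close>)
  then show ?thesis using less by (simp add: flat_eq_0)
next
  case equal
  have "((\<lambda>h. flat (Suc n) h) \<longlongrightarrow> 0) (at 0)" by (rule flat_tendsto_0)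
  moreover have "flat (Suc n) h = (flat n (0 + h) - flat n 0) / h" for h
    by (simp add: flat_def field_simps)
  ultimately show ?thesis using equal by (simp add: DERIV_def flat_eq_0)
next
  case greater
  have "((\<lambda>t. inverse t ^ n * exp (- inverse t)) has_real_derivative
      (of_nat n * (inverse t ^ (n - 1) * (- (inverse t ^ 2)))) * exp (- inverse t) +
      inverse t ^ n * (exp (- inverse t) * inverse t ^ 2)) (at t)"
    using greater by (auto intro!: derivative_eq_intros simp: power2_eq_square)
  moreover have "of_nat n * (inverse t ^ (n - 1) * (- (inverse t ^ 2))) * exp (- inverse t) +
      inverse t ^ n * (exp (- inverse t) * inverse t ^ 2) = flat (Suc (Suc n)) t - n * flat (Suc n) t"
    \<comment> \<open>The exponent n - 1 is truncated at n = 0, where the factor n removes the term;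
      hence the case distinction.\<close>
    using greater by (cases n) (auto simp: flat_def power2_eq_square algebra_simps)
  ultimately have "((\<lambda>t. inverse t ^ n * exp (- inverse t)) has_real_derivative
      flat (Suc (Suc n)) t - n * flat (Suc n) t) (at t)"
    by simp
  then show ?thesis
    by (rule has_field_derivative_transform_within_open[where S = "{0<..}"])
      (use greater in \<open>auto simp: flat_def\<close>)
qed

lemma Ck_on_flat: "Ck_on UNIV UNIV k (flat n)"
proof (induction k arbitrary: n)
  case 0
  show ?case using DERIV_isCont[OF flat_deriv] by (auto simp: continuous_on_eq_continuous_at)
next
  case (Suc k)
  have U: "relopen UNIV (UNIV :: real set)" by (simp add: relopen_UNIV)
  show ?case
  proof (rule Ck_on_SucI[OF U])
    show "(flat n has_derivative (*) (flat (Suc (Suc n)) t + (- n) * flat (Suc n) t)) (at t)" for t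
      using flat_deriv[of n t] by (simp add: has_field_derivative_def)
    show "Ck_on UNIV UNIV k (\<lambda>t. (flat (Suc (Suc n)) t + (- n) * flat (Suc n) t) * v)" for v
      by (intro Ck_on_bounded_bilinear[OF U bounded_bilinear_mult] Ck_on_add[OF U] Suc.IH
          Ck_on_const[OF U])
  qed
qed

lemma smooth_on_flat: "smooth_on UNIV UNIV (flat n)"
  by (simp add: smooth_on_def Ck_on_flat)

section \<open>Hadamard's lemma on convex relatively open sets\<close>

lemma linear_onb_expand:
  assumes "subspace E" "v \<in> E" "linear D"
  shows "D v = (\<Sum>b\<in>onb E. (v \<bullet> b) *\<^sub>R D b)"
proof -
  have "D v = D (\<Sum>b\<in>onb E. (v \<bullet> b) *\<^sub>R b)" using onb_expand[OF assms(1,2)] by simp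
  then show ?thesis by (simp only: linear_sum[OF assms(3)] linear_scale[OF assms(3)])
qed

text \<open>The difference quotients within \<open>W\<close> evaluate the linear map at y - x only,
  which lies in \<open>E\<close>. A derivative may thus be replaced by one whose values off
  \<open>E\<close> are more convenient.\<close>

lemma has_derivative_subspace_cong:
  assumes "subspace E" "W \<subseteq> E" "x \<in> W" "(f has_derivative D) (at x within W)"
    and "bounded_linear D'" "\<And>v. v \<in> E \<Longrightarrow> D v = D' v"
  shows "(f has_derivative D') (at x within W)"
proof -
  have "((\<lambda>y. (1 / norm (y - x)) *\<^sub>R (f y - (f x + D (y - x)))) \<longlongrightarrow> 0) (at x within W)"
    using assms(4) by (simp add: has_derivative_within)
  then have "((\<lambda>y. (1 / norm (y - x)) *\<^sub>R (f y - (f x + D' (y - x)))) \<longlongrightarrow> 0) (at x within W)"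
  proof (rule Lim_transform_eventually)
    have "D (y - x) = D' (y - x)" if "y \<in> W" for y
      using assms(1-3) that by (intro assms(6) subspace_diff) auto
    then show "\<forall>\<^sub>F y in at x within W. (1 / norm (y - x)) *\<^sub>R (f y - (f x + D (y - x))) =
        (1 / norm (y - x)) *\<^sub>R (f y - (f x + D' (y - x)))"
      by (simp add: eventually_at_filter)
  qed
  then show ?thesis using assms(5) by (simp add: has_derivative_within)
qed

lemma convex_segment_mem:
  assumes "convex B" "q \<in> B" "s \<in> B" "t \<in> {0..1::real}"
  shows "q + t *\<^sub>R (s - q) \<in> B"
  using convexD_alt[OF assms(1-3), of t] assms(4) by (simp add: algebra_simps)

lemma continuous_on_segment_param:
  fixes F :: "'e::euclidean_space \<Rightarrow> real"
  assumes "convex B" "q \<in> B" "continuous_on B F"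
  shows "continuous_on (B \<times> cbox 0 1) (\<lambda>(s, t). t ^ m * F (q + t *\<^sub>R (s - q)))"
proof -
  have "continuous_on (B \<times> cbox 0 1) (\<lambda>z. F (q + snd z *\<^sub>R (fst z - q)))"
    by (rule continuous_on_compose2[OF assms(3)])
      (use convex_segment_mem[OF assms(1,2)] in \<open>auto intro!: continuous_intros\<close>)
  then show ?thesis by (auto simp: case_prod_unfold intro!: continuous_intros)
qed

lemma continuous_on_Pair_const: "continuous_on S (Pair x)"
  by (rule continuous_on_Pair[OF continuous_on_const continuous_on_id])

text \<open>Repeated differentiation under the integral sign. Each derivative in \<open>s\<close>
  produces one more factor t by the chain rule; the weight \<open>t ^ m\<close> is in the statement
  so that the induction closes.\<close>

lemma Ck_on_segment_integral:
  fixes F :: "'e::euclidean_space \<Rightarrow> real"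
  assumes B: "relopen E B" "convex B" "q \<in> B" and F: "Ck_on E B k F"
  shows "Ck_on E B k (\<lambda>s. integral (cbox 0 1) (\<lambda>t. t ^ m * F (q + t *\<^sub>R (s - q))))"
  using F
proof (induction k arbitrary: F m)
  case 0
  then show ?case
    using integral_continuous_on_param[OF continuous_on_segment_param[OF B(2,3)]] by simp
next
  case (Suc k)
  let ?D = "\<lambda>x. frechet_derivative F (at x within B)"
  let ?p = "\<lambda>s t. q + t *\<^sub>R (s - q)"
  note sub = relopen_subspace[OF B(1)]
  note BE = relopen_subset[OF B(1)]
  \<comment> \<open>The Leibniz rule for integrals asks for a derivative that is continuous in (s,
    t) as a bounded linear map. Only the partial derivatives in fixed directions of \<open>E\<close>
    are known to be continuous, so the map is assembled from the basis directions; by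
    \<open>FxE\<close> it is the true derivative on \<open>E\<close>.\<close>
  define Fx where "Fx = (\<lambda>s t. \<Sum>b\<in>onb E. (t ^ Suc m * ?D (?p s t) b) *\<^sub>R blinfun_inner_left b)"
  have contD: "continuous_on B (\<lambda>x. ?D x v)" if "v \<in> E" for v
    using Ck_on_imp_continuous_on[OF Ck_on_SucD(2)[OF Suc.prems that]] .
  have contb: "continuous_on (B \<times> cbox 0 1) (\<lambda>(s, t). t ^ j * ?D (?p s t) b)"
    if "b \<in> onb E" for b and j :: nat
    using continuous_on_segment_param[OF B(2,3) contD] onb_subset[OF sub] that by blast
  have contFx: "continuous_on (B \<times> cbox 0 1) (\<lambda>(s, t). Fx s t)"
    unfolding Fx_def case_prod_unfold
    by (intro continuous_intros contb[of _ "Suc m", unfolded case_prod_unfold])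
  have FxE: "Fx s t v = t ^ Suc m * ?D (?p s t) v" if s: "s \<in> B" and t: "t \<in> cbox 0 1" and v: "v \<in> E"
    for s t v
  proof -
    have "?p s t \<in> B" using convex_segment_mem[OF B(2,3) s] t by simp
    from has_derivative_linear[OF Ck_on_SucD(1)[OF Suc.prems this]]
    have "?D (?p s t) v = (\<Sum>b\<in>onb E. (v \<bullet> b) *\<^sub>R ?D (?p s t) b)"
      by (rule linear_onb_expand[OF sub v])
    then show ?thesis
      by (simp add: Fx_def blinfun.sum_left blinfun.scaleR_left sum_distrib_left mult_ac)
  qed
  have der: "((\<lambda>s. t ^ m * F (?p s t)) has_derivative blinfun_apply (Fx s t)) (at s within B)"
    if s: "s \<in> B" and t: "t \<in> cbox 0 1" for s t
  proof (rule has_derivative_subspace_cong[OF sub BE s])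
    have p: "?p x t \<in> B" if "x \<in> B" for x using convex_segment_mem[OF B(2,3) that] t by simp
    have "((\<lambda>s. F (?p s t)) has_derivative (\<lambda>v. ?D (?p s t) (t *\<^sub>R v))) (at s within B)"
      by (rule has_derivative_in_compose2[OF Ck_on_SucD(1)[OF Suc.prems]])
        (use p s in \<open>auto intro!: derivative_eq_intros\<close>)
    then show "((\<lambda>s. t ^ m * F (?p s t)) has_derivative (\<lambda>v. t ^ m * ?D (?p s t) (t *\<^sub>R v)))
        (at s within B)"
      by (rule has_derivative_mult_right)
    show "t ^ m * ?D (?p s t) (t *\<^sub>R v) = Fx s t v" if "v \<in> E" for v
      using FxE[OF s t that] has_derivative_linear[OF Ck_on_SucD(1)[OF Suc.prems p[OF s]]]
      by (simp add: linear_scale)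
  qed (rule blinfun.bounded_linear_right)
  show ?case
  proof (rule Ck_on_SucI[OF B(1)])
    fix s assume s: "s \<in> B"
    show "((\<lambda>s. integral (cbox 0 1) (\<lambda>t. t ^ m * F (?p s t))) has_derivative
        blinfun_apply (integral (cbox 0 1) (Fx s))) (at s within B)"
    proof (rule leibniz_rule[OF der _ contFx s B(2)])
      fix x assume x: "x \<in> B"
      have "continuous_on B F" using Ck_on_imp_continuous_on[OF Suc.prems] .
      note c = continuous_on_segment_param[OF B(2,3) this, of m]
      have "continuous_on (cbox 0 1) (\<lambda>t. t ^ m * F (?p x t))"
        using continuous_on_compose2[OF c, of "cbox 0 1" "\<lambda>t. (x, t)"] x
        by (simp add: continuous_on_Pair_const image_subset_iff)
      then show "(\<lambda>t. t ^ m * F (?p x t)) integrable_on cbox 0 1" by (rule integrable_continuous)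
    qed
  next
    fix v assume v: "v \<in> E"
    have "blinfun_apply (integral (cbox 0 1) (Fx s)) v =
        integral (cbox 0 1) (\<lambda>t. t ^ Suc m * ?D (?p s t) v)" if s: "s \<in> B" for s
    proof -
      have "continuous_on (cbox 0 1) (Fx s)"
        using continuous_on_compose2[OF contFx, of "cbox 0 1" "\<lambda>t. (s, t)"] s
        by (simp add: continuous_on_Pair_const image_subset_iff)
      then have "blinfun_apply (integral (cbox 0 1) (Fx s)) v = integral (cbox 0 1) (\<lambda>t. Fx s t v)"
        by (intro blinfun_apply_integral integrable_continuous)
      also have "\<dots> = integral (cbox 0 1) (\<lambda>t. t ^ Suc m * ?D (?p s t) v)"
        by (rule integral_cong) (rule FxE[OF s _ v])
      finally show ?thesis .
    qed
    then show "Ck_on E B k (\<lambda>s. blinfun_apply (integral (cbox 0 1) (Fx s)) v)"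
      using Suc.IH[OF Ck_on_SucD(2)[OF Suc.prems v], of "Suc m"]
      by (subst Ck_on_cong) auto
  qed
qed

text \<open>f s - f q is the integral of the derivative along the segment from q to s. Expanding s -
  q in the basis leaves as coefficients the partial derivatives averaged over the segment; at s = q
  the average is over a constant.\<close>

lemma hadamard:
  fixes f :: "'e::euclidean_space \<Rightarrow> real"
  assumes B: "relopen E B" "convex B" "q \<in> B" and f: "smooth_on E B f"
  obtains g where "\<And>b. b \<in> onb E \<Longrightarrow> smooth_on E B (g b)"
    "\<And>b. g b q = frechet_derivative f (at q within B) b"
    "\<And>s. s \<in> B \<Longrightarrow> f s = f q + (\<Sum>b\<in>onb E. ((s - q) \<bullet> b) * g b s)"
proof
  let ?D = "\<lambda>x. frechet_derivative f (at x within B)"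
  let ?p = "\<lambda>s t. q + t *\<^sub>R (s - q)"
  \<comment> \<open>The factor \<open>t ^ 0\<close> gives the integrand the form of
    \<open>Ck_on_segment_integral\<close> with m = 0.\<close>
  define g where "g = (\<lambda>b s. integral (cbox 0 1) (\<lambda>t. t ^ 0 * ?D (?p s t) b))"
  note sub = relopen_subspace[OF B(1)]
  note BE = relopen_subset[OF B(1)]
  have smD: "smooth_on E B (\<lambda>x. ?D x b)" if "b \<in> onb E" for b
    using smooth_on_frechet_derivative[OF f] onb_subset[OF sub] that by blast
  show "smooth_on E B (g b)" if "b \<in> onb E" for b
    using smD[OF that] Ck_on_segment_integral[OF B] unfolding smooth_on_def g_def by blast
  show "g b q = ?D q b" for b
    by (simp add: g_def)
  fix s assume s: "s \<in> B"
  have sq: "s - q \<in> E" using s B(3) BE sub by (auto intro: subspace_diff)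
  have p: "?p s t \<in> B" if "t \<in> {0..1}" for t using convex_segment_mem[OF B(2,3) s that] .
  have "((\<lambda>t. ?D (?p s t) (s - q)) has_integral (f (?p s 1) - f (?p s 0))) {0..1}"
  proof (rule fundamental_theorem_of_calculus)
    fix t :: real assume t: "t \<in> {0..1}"
    have "((\<lambda>t. f (?p s t)) has_derivative (\<lambda>h. ?D (?p s t) (h *\<^sub>R (s - q)))) (at t within {0..1})"
      by (rule has_derivative_in_compose2[OF smooth_on_has_derivative[OF f]])
        (use p t in \<open>auto intro!: derivative_eq_intros\<close>)
    moreover have "(\<lambda>h. ?D (?p s t) (h *\<^sub>R (s - q))) = (\<lambda>h. h *\<^sub>R ?D (?p s t) (s - q))"
      using linear_scale[OF has_derivative_linear[OF smooth_on_has_derivative[OF f p[OF t]]]]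
      by (rule ext)
    ultimately show "((\<lambda>t. f (?p s t)) has_vector_derivative ?D (?p s t) (s - q)) (at t within {0..1})"
      by (simp add: has_vector_derivative_def)
  qed simp
  then have "f s - f q = integral {0..1} (\<lambda>t. ?D (?p s t) (s - q))"
    by (simp add: integral_unique)
  also have "\<dots> = integral {0..1} (\<lambda>t. \<Sum>b\<in>onb E. ((s - q) \<bullet> b) * ?D (?p s t) b)"
  proof (rule integral_cong)
    fix t :: real assume t: "t \<in> {0..1}"
    show "?D (?p s t) (s - q) = (\<Sum>b\<in>onb E. ((s - q) \<bullet> b) * ?D (?p s t) b)"
      using linear_onb_expand[OF sub sq has_derivative_linear[OF smooth_on_has_derivative[OF f p[OF t]]]]
      by simp
  qed
  also have "\<dots> = (\<Sum>b\<in>onb E. integral {0..1} (\<lambda>t. ((s - q) \<bullet> b) * ?D (?p s t) b))"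
  proof (rule integral_sum[OF finite_onb[OF sub]])
    fix b assume b: "b \<in> onb E"
    have "continuous_on {0..1} (\<lambda>t. ?D (?p s t) b)"
      by (rule continuous_on_compose2[OF smooth_on_imp_continuous_on[OF smD[OF b]]])
        (use p in \<open>auto intro!: continuous_intros\<close>)
    then show "(\<lambda>t. ((s - q) \<bullet> b) * ?D (?p s t) b) integrable_on {0..1}"
      by (intro integrable_continuous_interval continuous_intros)
  qed
  also have "\<dots> = (\<Sum>b\<in>onb E. ((s - q) \<bullet> b) * g b s)"
    by (simp add: g_def)
  finally show "f s = f q + (\<Sum>b\<in>onb E. ((s - q) \<bullet> b) * g b s)" by simp
qed

lemma relopen_ball_subspace: "subspace E \<Longrightarrow> relopen E (ball x r \<inter> E)"
  by (rule relopen_openI[of _ "ball x r"]) auto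

text \<open>Here \<open>r\<close> plays the role of a squared radius: the squared distance is smooth
  everywhere, including at \<open>p\<close>, where the norm is not.\<close>

lemma smooth_on_bump:
  assumes "relopen E W"
  shows "smooth_on E W (\<lambda>s. flat 0 (r - (s - p) \<bullet> (s - p)))"
  by (intro smooth_on_compose[OF assms _ _ smooth_on_flat] relopen_UNIV smooth_on_diff[OF assms]
      smooth_on_inner[OF assms] smooth_on_const[OF assms] smooth_on_bounded_linear[OF assms]
      bounded_linear_ident) auto

section \<open>Smooth functions and tangent vectors\<close>

lemma smooth_functionsD:
  "f \<in> smooth_functions M \<Longrightarrow> (U, \<phi>) \<in> charts M \<Longrightarrow> smooth_on (model M) (\<phi> ` U) (f \<circ> inv_into U \<phi>)"
  by (auto simp: smooth_functions_def)

context smooth_manifold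
begin

lemma chart_relopen: "(U, \<phi>) \<in> charts M \<Longrightarrow> relopen (model M) (\<phi> ` U)"
  using subspace_model chart_image_open by (auto simp: relopen_def)

lemma chart_inj: "(U, \<phi>) \<in> charts M \<Longrightarrow> inj_on \<phi> U"
  using chart_homeomorphism[of U \<phi>] unfolding homeomorphism_def by (metis inj_onI)

lemma chart_inv: "(U, \<phi>) \<in> charts M \<Longrightarrow> q \<in> U \<Longrightarrow> inv_into U \<phi> (\<phi> q) = q"
  using chart_inj by (simp add: inv_into_f_f)

lemma chart_continuous: "(U, \<phi>) \<in> charts M \<Longrightarrow> continuous_on U \<phi>"
  using chart_homeomorphism[of U \<phi>] unfolding homeomorphism_def by simp

lemma chart_Int_relopen:
  assumes "(U, \<phi>) \<in> charts M" "open T"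
  shows "relopen (model M) (\<phi> ` (U \<inter> T))"
proof -
  have "openin (top_of_set (\<phi> ` U)) (\<phi> ` (U \<inter> T))"
    using assms by (intro homeomorphism_imp_open_map[OF chart_homeomorphism]) (auto simp: openin_open)
  then show ?thesis
    using chart_image_open[OF assms(1)] subspace_model by (auto simp: relopen_def intro: openin_trans)
qed

lemma chart_at:
  obtains U \<phi> where "(U, \<phi>) \<in> charts M" "p \<in> U"
proof -
  have "p \<in> (\<Union>(U, \<phi>) \<in> charts M. U)" by (simp add: charts_cover)
  then show ?thesis using that by auto
qed

text \<open>Membership in \<open>smooth_functions\<close> speaks of all charts. Smooth transition
  maps carry smoothness from one chart to another, so at each point a single chart and a small
  neighbourhood suffice.\<close>

lemma smooth_functions_localI:
  assumes "\<And>p. \<exists>U \<phi> T. (U, \<phi>) \<in> charts M \<and> open T \<and> p \<in> U \<and> p \<in> T \<and>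
    smooth_on (model M) (\<phi> ` (U \<inter> T)) (f \<circ> inv_into U \<phi>)"
  shows "f \<in> smooth_functions M"
proof -
  have "smooth_on (model M) (\<psi> ` V) (f \<circ> inv_into V \<psi>)" if V: "(V, \<psi>) \<in> charts M" for V \<psi>
  proof (rule smooth_on_local[OF chart_relopen[OF V]])
    fix x assume "x \<in> \<psi> ` V"
    then obtain q where q: "q \<in> V" "x = \<psi> q" by auto
    obtain U \<phi> T where U: "(U, \<phi>) \<in> charts M" "open T" "q \<in> U" "q \<in> T"
      and sm: "smooth_on (model M) (\<phi> ` (U \<inter> T)) (f \<circ> inv_into U \<phi>)"
      using assms by blast
    have T: "open (U \<inter> T)" using U chart_domain_open by auto
    note W = chart_Int_relopen[OF V T]
    have "smooth_on (model M) (\<psi> ` (V \<inter> (U \<inter> T))) (\<lambda>y. (f \<circ> inv_into U \<phi>) ((\<phi> \<circ> inv_into V \<psi>) y))"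
    proof (rule smooth_on_compose[OF W chart_Int_relopen[OF U(1,2)] _ sm])
      show "(\<phi> \<circ> inv_into V \<psi>) ` \<psi> ` (V \<inter> (U \<inter> T)) \<subseteq> \<phi> ` (U \<inter> T)"
        using chart_inv[OF V] by force
      show "smooth_on (model M) (\<psi> ` (V \<inter> (U \<inter> T))) (\<phi> \<circ> inv_into V \<psi>)"
        by (rule smooth_on_subset[OF chart_Int_relopen[OF V chart_domain_open[OF U(1)]] W _
              charts_compatible[OF V U(1)]]) auto
    qed
    then have "smooth_on (model M) (\<psi> ` (V \<inter> (U \<inter> T))) (f \<circ> inv_into V \<psi>)"
      by (rule smooth_on_cong[THEN iffD1, rotated]) (use chart_inv[OF V] chart_inv[OF U(1)] in auto)
    then show "\<exists>W. x \<in> W \<and> relopen (model M) W \<and> W \<subseteq> \<psi> ` V \<and>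
        smooth_on (model M) W (f \<circ> inv_into V \<psi>)"
      using W q U(3,4) by (intro exI[of _ "\<psi> ` (V \<inter> (U \<inter> T))"]) auto
  qed
  then show ?thesis by (auto simp: smooth_functions_def)
qed

section \<open>The algebra of smooth functions and the rules for derivations\<close>

lemma smooth_functions_const: "(\<lambda>_. c) \<in> smooth_functions M"
  by (auto simp: smooth_functions_def o_def intro: smooth_on_const chart_relopen)

lemma smooth_functions_add:
  assumes "f \<in> smooth_functions M" "g \<in> smooth_functions M"
  shows "(\<lambda>p. f p + g p) \<in> smooth_functions M"
  using smooth_functionsD[OF assms(1)] smooth_functionsD[OF assms(2)]
  by (auto simp: smooth_functions_def o_def intro: smooth_on_add chart_relopen)

lemma smooth_functions_mult:
  assumes "f \<in> smooth_functions M" "g \<in> smooth_functions M"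
  shows "(\<lambda>p. f p * g p) \<in> smooth_functions M"
  using smooth_functionsD[OF assms(1)] smooth_functionsD[OF assms(2)]
  by (auto simp: smooth_functions_def o_def intro: smooth_on_mult chart_relopen)

lemma smooth_functions_cmult:
  "f \<in> smooth_functions M \<Longrightarrow> (\<lambda>p. c * f p) \<in> smooth_functions M"
  by (intro smooth_functions_mult smooth_functions_const)

lemma smooth_functions_uminus:
  "f \<in> smooth_functions M \<Longrightarrow> (\<lambda>p. - f p) \<in> smooth_functions M"
  using smooth_functions_cmult[of f "-1"] by simp

lemma smooth_functions_diff:
  "f \<in> smooth_functions M \<Longrightarrow> g \<in> smooth_functions M \<Longrightarrow> (\<lambda>p. f p - g p) \<in> smooth_functions M"
  using smooth_functions_add[OF _ smooth_functions_uminus, of f g] by simp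

lemma smooth_functions_sum:
  "(\<And>i. i \<in> I \<Longrightarrow> f i \<in> smooth_functions M) \<Longrightarrow> (\<lambda>p. \<Sum>i\<in>I. f i p) \<in> smooth_functions M"
  by (induction I rule: infinite_finite_induct)
    (auto intro: smooth_functions_const smooth_functions_add)

lemma tangent_add:
  "v \<in> tangent_space M p \<Longrightarrow> f \<in> smooth_functions M \<Longrightarrow> g \<in> smooth_functions M \<Longrightarrow>
    v (\<lambda>q. f q + g q) = v f + v g"
  by (auto simp: tangent_space_def dual_def linear_on_def plus_fun_def)

lemma tangent_cmult:
  "v \<in> tangent_space M p \<Longrightarrow> f \<in> smooth_functions M \<Longrightarrow> v (\<lambda>q. c * f q) = c * v f"
  by (auto simp: tangent_space_def dual_def linear_on_def scaleR_fun_def)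

lemma tangent_mult:
  "v \<in> tangent_space M p \<Longrightarrow> f \<in> smooth_functions M \<Longrightarrow> g \<in> smooth_functions M \<Longrightarrow>
    v (\<lambda>q. f q * g q) = f p * v g + g p * v f"
  by (auto simp: tangent_space_def times_fun_def)

lemma tangent_off: "v \<in> tangent_space M p \<Longrightarrow> f \<notin> smooth_functions M \<Longrightarrow> v f = 0"
  by (auto simp: tangent_space_def dual_def)

lemma tangent_const:
  assumes "v \<in> tangent_space M p"
  shows "v (\<lambda>_. c) = 0"
proof -
  \<comment> \<open>From 1 = 1 * 1 the product rule gives v(1) = 2 v(1).\<close>
  have "v (\<lambda>_. 1) = 0"
    using tangent_mult[OF assms smooth_functions_const smooth_functions_const, of 1 1] by simp
  then show ?thesis using tangent_cmult[OF assms smooth_functions_const, of c 1] by simp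
qed

lemma tangent_uminus:
  "v \<in> tangent_space M p \<Longrightarrow> f \<in> smooth_functions M \<Longrightarrow> v (\<lambda>q. - f q) = - v f"
  using tangent_cmult[of v p f "-1"] by simp

lemma tangent_diff:
  "v \<in> tangent_space M p \<Longrightarrow> f \<in> smooth_functions M \<Longrightarrow> g \<in> smooth_functions M \<Longrightarrow>
    v (\<lambda>q. f q - g q) = v f - v g"
  using tangent_add[OF _ _ smooth_functions_uminus, of v p f g] tangent_uminus[of v p g] by simp

lemma tangent_sum:
  "v \<in> tangent_space M p \<Longrightarrow> (\<And>i. i \<in> I \<Longrightarrow> f i \<in> smooth_functions M) \<Longrightarrow>
    v (\<lambda>q. \<Sum>i\<in>I. f i q) = (\<Sum>i\<in>I. v (f i))"
proof (induction I rule: infinite_finite_induct)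
  case (insert i F)
  then show ?case by (simp add: tangent_add[OF insert(4) _ smooth_functions_sum])
qed (auto simp: tangent_const)

lemma tangent_spaceI:
  assumes "\<And>f. f \<notin> smooth_functions M \<Longrightarrow> v f = 0"
    and "\<And>f g. f \<in> smooth_functions M \<Longrightarrow> g \<in> smooth_functions M \<Longrightarrow> v (\<lambda>q. f q + g q) = v f + v g"
    and "\<And>f c. f \<in> smooth_functions M \<Longrightarrow> v (\<lambda>q. c * f q) = c * v f"
    and "\<And>f g. f \<in> smooth_functions M \<Longrightarrow> g \<in> smooth_functions M \<Longrightarrow>
      v (\<lambda>q. f q * g q) = f p * v g + g p * v f"
  shows "v \<in> tangent_space M p"
  using assms by (auto simp: tangent_space_def dual_def linear_on_def plus_fun_def scaleR_fun_def times_fun_def)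

text \<open>The way from local to global functions. The bump is positive exactly within distance r/2
  of \<open>\<phi> p\<close>, while \<open>k\<close> is smooth up to distance r, which leaves room
  to continue the product by zero.\<close>

lemma bump_extension:
  assumes U: "(U, \<phi>) \<in> charts M" and p: "p \<in> U"
  obtains r where "r > 0" "ball (\<phi> p) r \<inter> model M \<subseteq> \<phi> ` U"
    "\<And>k. smooth_on (model M) (ball (\<phi> p) r \<inter> model M) k \<Longrightarrow>
      (\<lambda>q. if q \<in> U \<and> \<phi> q \<in> ball (\<phi> p) r
        then flat 0 ((r/2)\<^sup>2 - (\<phi> q - \<phi> p) \<bullet> (\<phi> q - \<phi> p)) * k (\<phi> q) else 0) \<in> smooth_functions M"
proof -
  let ?E = "model M"
  obtain r where r: "r > 0" "ball (\<phi> p) r \<inter> ?E \<subseteq> \<phi> ` U"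
    using relopen_ball[OF chart_relopen[OF U]] p by blast
  have "(\<lambda>q. if q \<in> U \<and> \<phi> q \<in> ball (\<phi> p) r
        then flat 0 ((r/2)\<^sup>2 - (\<phi> q - \<phi> p) \<bullet> (\<phi> q - \<phi> p)) * k (\<phi> q) else 0) \<in> smooth_functions M"
    (is "?h \<in> _") if k: "smooth_on ?E (ball (\<phi> p) r \<inter> ?E) k" for k
  proof (rule smooth_functions_localI)
    fix q
    \<comment> \<open>\<open>K\<close> contains the support. It is compact as the image of a compact
      set under the inverse chart, hence closed because \<open>M\<close> is Hausdorff. So each point
      outside the chart ball has a neighbourhood on which the extension vanishes; closedness
      relative to \<open>U\<close> alone would not give this.\<close>
    define K where "K = inv_into U \<phi> ` (cball (\<phi> p) (r/2) \<inter> ?E)"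
    have sub: "cball (\<phi> p) (r/2) \<inter> ?E \<subseteq> \<phi> ` U" using r by fastforce
    have "compact (cball (\<phi> p) (r/2) \<inter> ?E)"
      using closed_subspace[OF subspace_model] by (simp add: compact_Int_closed)
    then have "compact K"
      unfolding K_def using chart_homeomorphism[OF U] sub
      by (intro compact_continuous_image) (auto simp: homeomorphism_def intro: continuous_on_subset)
    then have K: "closed K" by (rule compact_imp_closed)
    show "\<exists>V \<psi> T. (V, \<psi>) \<in> charts M \<and> open T \<and> q \<in> V \<and> q \<in> T \<and>
        smooth_on ?E (\<psi> ` (V \<inter> T)) (?h \<circ> inv_into V \<psi>)"
    proof (cases "q \<in> U \<and> \<phi> q \<in> ball (\<phi> p) r")
      case True
      define T where "T = U \<inter> \<phi> -` ball (\<phi> p) r"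
      have T: "open T"
        unfolding T_def using chart_continuous[OF U] chart_domain_open[OF U]
        by (intro continuous_open_preimage) auto
      have W: "relopen ?E (\<phi> ` (U \<inter> T))" by (rule chart_Int_relopen[OF U T])
      have "smooth_on ?E (\<phi> ` (U \<inter> T)) (\<lambda>s. flat 0 ((r/2)\<^sup>2 - (s - \<phi> p) \<bullet> (s - \<phi> p)) * k s)"
        by (intro smooth_on_mult[OF W] smooth_on_bump[OF W]
            smooth_on_subset[OF relopen_ball_subspace[OF subspace_model] W _ k])
          (use relopen_subset[OF W] in \<open>auto simp: T_def\<close>)
      then have "smooth_on ?E (\<phi> ` (U \<inter> T)) (?h \<circ> inv_into U \<phi>)"
        by (rule smooth_on_cong[THEN iffD1, rotated]) (auto simp: chart_inv[OF U] T_def)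
      then show ?thesis using U T True by (intro exI[of _ U] exI[of _ \<phi>] exI[of _ T]) (auto simp: T_def)
    next
      case False
      obtain V \<psi> where V: "(V, \<psi>) \<in> charts M" "q \<in> V" by (rule chart_at)
      have "x \<in> U \<and> \<phi> x \<in> ball (\<phi> p) r" if "x \<in> K" for x
      proof -
        obtain s where s: "s \<in> cball (\<phi> p) (r/2) \<inter> ?E" "x = inv_into U \<phi> s"
          using \<open>x \<in> K\<close> by (auto simp: K_def)
        then have "x \<in> U" "\<phi> x = s" using sub by (auto simp: inv_into_into f_inv_into_f subset_iff)
        then show ?thesis using s r(1) by auto
      qed
      then have q: "q \<notin> K" using False by blast
      have zero: "?h x = 0" if "x \<notin> K" for x
      proof (cases "x \<in> U \<and> \<phi> x \<in> ball (\<phi> p) r")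
        case True
        have "\<phi> x \<notin> cball (\<phi> p) (r/2)"
          using that True relopen_subset[OF chart_relopen[OF U]] chart_inv[OF U, of x]
          by (force simp: K_def image_iff)
        then have "(r/2)\<^sup>2 \<le> (norm (\<phi> x - \<phi> p))\<^sup>2"
          using r(1) by (intro power_mono) (auto simp: dist_norm norm_minus_commute)
        then show ?thesis by (simp add: flat_eq_0 power2_norm_eq_inner)
      qed auto
      have W: "relopen ?E (\<psi> ` (V \<inter> - K))" using K by (intro chart_Int_relopen[OF V(1)]) auto
      have "smooth_on ?E (\<psi> ` (V \<inter> - K)) (?h \<circ> inv_into V \<psi>)"
        using smooth_on_const[OF W, of 0]
        by (rule smooth_on_cong[THEN iffD1, rotated])
          (unfold o_def, rule zero[symmetric], use chart_inv[OF V(1)] in auto)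
      then show ?thesis using V K q by (intro exI[of _ V] exI[of _ \<psi>] exI[of _ "- K"]) auto
    qed
  qed
  then show ?thesis using that r by blast
qed

definition chart_deriv :: "'m set \<Rightarrow> ('m \<Rightarrow> 'e) \<Rightarrow> ('m \<Rightarrow> real) \<Rightarrow> 'm \<Rightarrow> 'e \<Rightarrow> real" where
  "chart_deriv U \<phi> f q b = frechet_derivative (f \<circ> inv_into U \<phi>) (at (\<phi> q) within \<phi> ` U) b"

lemma chart_deriv_tangent:
  assumes U: "(U, \<phi>) \<in> charts M" and q: "q \<in> U" and b: "b \<in> model M"
  shows "(\<lambda>f. if f \<in> smooth_functions M then chart_deriv U \<phi> f q b else 0) \<in> tangent_space M q"
proof -
  have der: "(f \<circ> inv_into U \<phi> has_derivative chart_deriv U \<phi> f q) (at (\<phi> q) within \<phi> ` U)"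
    if "f \<in> smooth_functions M" for f
    unfolding chart_deriv_def
    using smooth_on_has_derivative[OF smooth_functionsD[OF that U]] q by simp
  have eqI: "chart_deriv U \<phi> f q b = D b"
    if "(f \<circ> inv_into U \<phi> has_derivative D) (at (\<phi> q) within \<phi> ` U)" for f D
    unfolding chart_deriv_def
    using frechet_derivative_relopen[OF chart_relopen[OF U] _ b that] q by simp
  show ?thesis
  proof (rule tangent_spaceI, goal_cases)
    case (2 f g)
    have "(f \<circ> inv_into U \<phi> has_derivative chart_deriv U \<phi> f q) (at (\<phi> q) within \<phi> ` U)"
      "(g \<circ> inv_into U \<phi> has_derivative chart_deriv U \<phi> g q) (at (\<phi> q) within \<phi> ` U)"
      using der 2 by auto
    from has_derivative_add[OF this]
    have "chart_deriv U \<phi> (\<lambda>q. f q + g q) q b = chart_deriv U \<phi> f q b + chart_deriv U \<phi> g q b"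
      by (intro eqI) (simp add: o_def)
    then show ?case using 2 by (simp add: smooth_functions_add)
  next
    case (3 f c)
    have "chart_deriv U \<phi> (\<lambda>q. c * f q) q b = c * chart_deriv U \<phi> f q b"
      using has_derivative_mult_right[OF der[OF 3], of c] by (intro eqI) (simp add: o_def)
    then show ?case using 3 by (simp add: smooth_functions_cmult)
  next
    case (4 f g)
    have "(f \<circ> inv_into U \<phi> has_derivative chart_deriv U \<phi> f q) (at (\<phi> q) within \<phi> ` U)"
      "(g \<circ> inv_into U \<phi> has_derivative chart_deriv U \<phi> g q) (at (\<phi> q) within \<phi> ` U)"
      using der 4 by auto
    from has_derivative_mult[OF this]
    have "((\<lambda>q. f q * g q) \<circ> inv_into U \<phi> has_derivative
        (\<lambda>h. f q * chart_deriv U \<phi> g q h + chart_deriv U \<phi> f q h * g q)) (at (\<phi> q) within \<phi> ` U)"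
      using chart_inv[OF U q] by (simp add: o_def)
    from eqI[OF this] show ?case using 4 by (simp add: smooth_functions_mult mult.commute)
  qed simp
qed

text \<open>Multiplying Hadamard's expansion of \<open>f\<close> at \<open>q\<close> by \<open>\<rho>\<^sup>2\<close>, for a bump function \<open>\<rho>\<close>, makes all its
  terms global smooth functions, to which \<open>v\<close> can be applied; no locality of \<open>v\<close> is needed.\<close>

lemma local_frame:
  assumes U: "(U, \<phi>) \<in> charts M" and p: "p \<in> U"
  obtains N \<rho> y where "open N" "p \<in> N" "N \<subseteq> U" "\<rho> \<in> smooth_functions M"
    "\<forall>b. y b \<in> smooth_functions M" "\<forall>q\<in>N. \<rho> q > 0"
    "\<forall>q\<in>N. \<forall>v\<in>tangent_space M q. \<forall>f\<in>smooth_functions M.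
      \<rho> q * v f = (\<Sum>b\<in>onb (model M). (v (y b) - (\<phi> q \<bullet> b) * v \<rho>) * chart_deriv U \<phi> f q b)"
proof -
  let ?E = "model M"
  obtain r where r: "r > 0" and sub: "ball (\<phi> p) r \<inter> ?E \<subseteq> \<phi> ` U"
    and ext0: "\<And>k. smooth_on ?E (ball (\<phi> p) r \<inter> ?E) k \<Longrightarrow>
      (\<lambda>q. if q \<in> U \<and> \<phi> q \<in> ball (\<phi> p) r
        then flat 0 ((r/2)\<^sup>2 - (\<phi> q - \<phi> p) \<bullet> (\<phi> q - \<phi> p)) * k (\<phi> q) else 0) \<in> smooth_functions M"
    by (rule bump_extension[OF U p]) (rule that, blast+)
  let ?B = "ball (\<phi> p) r \<inter> ?E"
  define ext where "ext = (\<lambda>k q. if q \<in> U \<and> \<phi> q \<in> ball (\<phi> p) r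
        then flat 0 ((r/2)\<^sup>2 - (\<phi> q - \<phi> p) \<bullet> (\<phi> q - \<phi> p)) * k (\<phi> q) else 0)"
  have ext: "ext k \<in> smooth_functions M" if "smooth_on ?E ?B k" for k
    unfolding ext_def by (rule ext0[OF that])
  have B: "relopen ?E ?B" by (rule relopen_ball_subspace[OF subspace_model])
  have Bconv: "convex ?B"
    by (intro convex_Int convex_ball subspace_imp_convex subspace_model)
  define \<rho> where "\<rho> = ext (\<lambda>_. 1)"
  \<comment> \<open>The coordinate functions, cut off like the constant 1 in \<open>\<rho>\<close>.
    By the product rule \<open>v (y b) - (\<phi> q \<bullet> b) * v \<rho>\<close> plays the role of
    \<open>\<rho> q\<close> times v of the b-th coordinate, which is only a local function.\<close>
  define y where "y = (\<lambda>b. ext (\<lambda>s. s \<bullet> b))"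
  define N where "N = U \<inter> \<phi> -` ball (\<phi> p) (r/2)"
  have \<rho>: "\<rho> \<in> smooth_functions M" unfolding \<rho>_def by (intro ext smooth_on_const B)
  have y: "y b \<in> smooth_functions M" for b
    unfolding y_def by (intro ext smooth_on_bounded_linear B bounded_linear_inner_left)
  have E: "\<phi> q \<in> ?E" if "q \<in> U" for q
    using relopen_subset[OF chart_relopen[OF U]] that by auto
  have NB: "q \<in> U" "\<phi> q \<in> ball (\<phi> p) r" if "q \<in> N" for q
    using that r unfolding N_def by auto
  have pos: "\<rho> q > 0" if "q \<in> N" for q
  proof -
    have "(norm (\<phi> q - \<phi> p))\<^sup>2 < (r/2)\<^sup>2"
      using that r by (intro power_strict_mono) (auto simp: N_def dist_norm norm_minus_commute)
    then show ?thesis using NB[OF that] by (simp add: \<rho>_def ext_def flat_pos power2_norm_eq_inner)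
  qed
  have "\<rho> q * v f = (\<Sum>b\<in>onb ?E. (v (y b) - (\<phi> q \<bullet> b) * v \<rho>) * chart_deriv U \<phi> f q b)"
    if q: "q \<in> N" and v: "v \<in> tangent_space M q" and f: "f \<in> smooth_functions M" for q v f
  proof -
    let ?f = "f \<circ> inv_into U \<phi>"
    have qB: "\<phi> q \<in> ?B" using NB[OF q] E by auto
    have "smooth_on ?E ?B ?f"
      by (rule smooth_on_subset[OF chart_relopen[OF U] B sub smooth_functionsD[OF f U]])
    \<comment> \<open>The expansion is centred at \<open>\<phi> q\<close>, whereas the cutoff stays
      centred at \<open>\<phi> p\<close>. Thus \<open>\<rho>\<close> and \<open>y\<close> serve all
      points q of \<open>N\<close> simultaneously, and only the auxiliary \<open>g\<close> depends
      on q and f.\<close>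
    then obtain g where g: "\<And>b. b \<in> onb ?E \<Longrightarrow> smooth_on ?E ?B (g b)"
      "\<And>b. g b (\<phi> q) = frechet_derivative ?f (at (\<phi> q) within ?B) b"
      "\<And>s. s \<in> ?B \<Longrightarrow> ?f s = ?f (\<phi> q) + (\<Sum>b\<in>onb ?E. ((s - \<phi> q) \<bullet> b) * g b s)"
      by (rule hadamard[OF B Bconv qB]) (rule that, blast+)
    have gq: "ext (g b) q = \<rho> q * chart_deriv U \<phi> f q b" for b
      using g(2)[of b] NB[OF q] frechet_derivative_relopen_subset[OF B chart_relopen[OF U], of "\<phi> q" ?f] qB
      by (simp add: ext_def \<rho>_def chart_deriv_def)
    \<comment> \<open>One factor \<open>\<rho>\<close> is absorbed by the coordinate differences,
      the other by the functions \<open>g b\<close>. Outside the chart ball every term is 0, so the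
      identity holds on all of \<open>M\<close>.\<close>
    have eq: "(\<lambda>x. \<rho> x * (\<rho> x * f x)) = (\<lambda>x. f q * (\<rho> x * \<rho> x) +
        (\<Sum>b\<in>onb ?E. (y b x - (\<phi> q \<bullet> b) * \<rho> x) * ext (g b) x))"
    proof
      fix x
      show "\<rho> x * (\<rho> x * f x) = f q * (\<rho> x * \<rho> x) +
        (\<Sum>b\<in>onb ?E. (y b x - (\<phi> q \<bullet> b) * \<rho> x) * ext (g b) x)"
      proof (cases "x \<in> U \<and> \<phi> x \<in> ball (\<phi> p) r")
        case True
        then have fx: "f x = f q + (\<Sum>b\<in>onb ?E. ((\<phi> x - \<phi> q) \<bullet> b) * g b (\<phi> x))"
          using g(3)[of "\<phi> x"] E chart_inv[OF U] NB(1)[OF q] by simp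
        have "y b x = \<rho> x * (\<phi> x \<bullet> b)" "ext (g b) x = \<rho> x * g b (\<phi> x)" for b
          using True by (auto simp: y_def \<rho>_def ext_def)
        then have "(\<Sum>b\<in>onb ?E. (y b x - (\<phi> q \<bullet> b) * \<rho> x) * ext (g b) x) =
            \<rho> x * \<rho> x * (\<Sum>b\<in>onb ?E. ((\<phi> x - \<phi> q) \<bullet> b) * g b (\<phi> x))"
          by (simp add: algebra_simps inner_diff_left sum_distrib_left)
        then show ?thesis by (simp add: fx algebra_simps)
      next
        case False
        then have "ext k x = 0" for k unfolding ext_def by (rule if_not_P)
        then show ?thesis by (simp add: \<rho>_def)
      qed
    qed
    have exg: "ext (g b) \<in> smooth_functions M" if "b \<in> onb ?E" for b using g(1)[OF that] by (rule ext)
    have w: "(\<lambda>x. y b x - (\<phi> q \<bullet> b) * \<rho> x) \<in> smooth_functions M" for b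
      by (intro smooth_functions_diff y smooth_functions_cmult \<rho>)
    have vw: "v (\<lambda>x. y b x - (\<phi> q \<bullet> b) * \<rho> x) = v (y b) - (\<phi> q \<bullet> b) * v \<rho>" for b
      by (simp add: tangent_diff[OF v y smooth_functions_cmult[OF \<rho>]] tangent_cmult[OF v \<rho>])
    \<comment> \<open>These factors vanish at q, so in each product only the term where v
      differentiates them survives. The terms with \<open>v \<rho>\<close> and \<open>f q\<close>
      occur equally on both sides.\<close>
    have wq: "y b q - (\<phi> q \<bullet> b) * \<rho> q = 0" for b
      using NB[OF q] by (simp add: y_def \<rho>_def ext_def)
    have \<rho>f: "(\<lambda>x. \<rho> x * f x) \<in> smooth_functions M" and \<rho>\<rho>: "(\<lambda>x. \<rho> x * \<rho> x) \<in> smooth_functions M"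
      by (intro smooth_functions_mult \<rho> f)+
    have "v (\<lambda>x. \<rho> x * (\<rho> x * f x)) = \<rho> q * (\<rho> q * v f + f q * v \<rho>) + \<rho> q * f q * v \<rho>"
      by (simp only: tangent_mult[OF v \<rho> \<rho>f] tangent_mult[OF v \<rho> f])
    moreover have "v (\<lambda>x. f q * (\<rho> x * \<rho> x) +
        (\<Sum>b\<in>onb ?E. (y b x - (\<phi> q \<bullet> b) * \<rho> x) * ext (g b) x)) =
      f q * (2 * \<rho> q * v \<rho>) + (\<Sum>b\<in>onb ?E. \<rho> q * ((v (y b) - (\<phi> q \<bullet> b) * v \<rho>) * chart_deriv U \<phi> f q b))"
    proof -
      have "v (\<lambda>x. f q * (\<rho> x * \<rho> x) +
          (\<Sum>b\<in>onb ?E. (y b x - (\<phi> q \<bullet> b) * \<rho> x) * ext (g b) x)) =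
        v (\<lambda>x. f q * (\<rho> x * \<rho> x)) +
          v (\<lambda>x. \<Sum>b\<in>onb ?E. (y b x - (\<phi> q \<bullet> b) * \<rho> x) * ext (g b) x)"
        by (intro tangent_add[OF v] smooth_functions_cmult \<rho>\<rho> smooth_functions_sum
            smooth_functions_mult w exg)
      also have "v (\<lambda>x. f q * (\<rho> x * \<rho> x)) = f q * (2 * \<rho> q * v \<rho>)"
        by (simp add: tangent_cmult[OF v \<rho>\<rho>] tangent_mult[OF v \<rho> \<rho>])
      also have "v (\<lambda>x. \<Sum>b\<in>onb ?E. (y b x - (\<phi> q \<bullet> b) * \<rho> x) * ext (g b) x) =
          (\<Sum>b\<in>onb ?E. v (\<lambda>x. (y b x - (\<phi> q \<bullet> b) * \<rho> x) * ext (g b) x))"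
        by (intro tangent_sum[OF v] smooth_functions_mult w exg)
      also have "\<dots> = (\<Sum>b\<in>onb ?E. \<rho> q * ((v (y b) - (\<phi> q \<bullet> b) * v \<rho>) * chart_deriv U \<phi> f q b))"
        by (rule sum.cong) (auto simp: tangent_mult[OF v w exg] wq gq vw)
      finally show ?thesis .
    qed
    ultimately have "\<rho> q * (\<rho> q * v f) =
        \<rho> q * (\<Sum>b\<in>onb ?E. (v (y b) - (\<phi> q \<bullet> b) * v \<rho>) * chart_deriv U \<phi> f q b)"
      using arg_cong[OF eq, of v] by (simp add: algebra_simps sum_distrib_left)
    then show ?thesis using pos[OF q] by simp
  qed
  moreover have "open N"
    unfolding N_def using chart_continuous[OF U] chart_domain_open[OF U]
    by (intro continuous_open_preimage) auto
  moreover have "p \<in> N" using p r by (simp add: N_def)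
  ultimately show ?thesis using that[of N \<rho> y] \<rho> y pos NB(1) by blast
qed

end

section \<open>Product manifolds and smooth maps\<close>

lemma inv_into_map_prod:
  assumes "inj_on f A" "inj_on g B" "a \<in> A" "b \<in> B"
  shows "inv_into (A \<times> B) (map_prod f g) (f a, g b) = (a, b)"
proof -
  have "inj_on (map_prod f g) (A \<times> B)" using map_prod_inj_on[OF assms(1,2)] .
  from inv_into_f_f[OF this, of "(a, b)"] show ?thesis using assms(3,4) by simp
qed

lemma image_map_prod_Times: "map_prod f g ` (A \<times> B) = f ` A \<times> g ` B"
  by (rule map_prod_surj_on) auto

lemma smooth_on_fst_comp:
  assumes "relopen E W" "relopen D V" "smooth_on E W f"
  shows "smooth_on (E \<times> D) (W \<times> V) (\<lambda>z. f (fst z))"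
  by (rule smooth_on_compose[OF relopen_Times[OF assms(1,2)] assms(1) _ assms(3)])
    (auto intro: smooth_on_bounded_linear relopen_Times assms bounded_linear_fst)

lemma smooth_on_snd_comp:
  assumes "relopen E W" "relopen D V" "smooth_on D V f"
  shows "smooth_on (E \<times> D) (W \<times> V) (\<lambda>z. f (snd z))"
  by (rule smooth_on_compose[OF relopen_Times[OF assms(1,2)] assms(2) _ assms(3)])
    (auto intro: smooth_on_bounded_linear relopen_Times assms bounded_linear_snd)

lemma smooth_on_map_prod:
  assumes "relopen E W" "relopen D V" "smooth_on E W f" "smooth_on D V g"
  shows "smooth_on (E \<times> D) (W \<times> V) (map_prod f g)"
  using smooth_on_Pair[OF relopen_Times[OF assms(1,2)] smooth_on_fst_comp[OF assms(1-3)]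
      smooth_on_snd_comp[OF assms(1,2,4)]]
  by (simp add: map_prod_def case_prod_unfold)

lemma continuous_on_map_prod:
  assumes "continuous_on A f" "continuous_on B g"
  shows "continuous_on (A \<times> B) (map_prod f g)"
proof -
  have "continuous_on (A \<times> B) (\<lambda>z. f (fst z))"
    by (rule continuous_on_compose2[OF assms(1) continuous_on_fst[OF continuous_on_id]]) auto
  moreover have "continuous_on (A \<times> B) (\<lambda>z. g (snd z))"
    by (rule continuous_on_compose2[OF assms(2) continuous_on_snd[OF continuous_on_id]]) auto
  ultimately have "continuous_on (A \<times> B) (\<lambda>z. (f (fst z), g (snd z)))"
    by (rule continuous_on_Pair)
  then show ?thesis by (simp add: map_prod_def case_prod_unfold)
qed

lemma charts_prod_manifoldE:
  assumes "(P, \<theta>) \<in> charts (prod_manifold M N)"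
  obtains U \<phi> V \<psi> where "P = U \<times> V" "\<theta> = map_prod \<phi> \<psi>" "(U, \<phi>) \<in> charts M" "(V, \<psi>) \<in> charts N"
  using assms by (auto simp: prod_manifold_def)

lemma charts_prod_manifoldI:
  "(U, \<phi>) \<in> charts M \<Longrightarrow> (V, \<psi>) \<in> charts N \<Longrightarrow> (U \<times> V, map_prod \<phi> \<psi>) \<in> charts (prod_manifold M N)"
  by (auto simp: prod_manifold_def)

lemma model_prod_manifold [simp]: "model (prod_manifold M N) = model M \<times> model N"
  by (simp add: prod_manifold_def)

lemma smooth_mapD:
  "smooth_map M N F \<Longrightarrow> (U, \<phi>) \<in> charts M \<Longrightarrow> (V, \<psi>) \<in> charts N \<Longrightarrow>
    smooth_on (model M) (\<phi> ` (U \<inter> F -` V)) (\<psi> \<circ> F \<circ> inv_into U \<phi>)"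
  unfolding smooth_map_def by blast

lemma smooth_map_open_vimage: "smooth_map M N F \<Longrightarrow> open T \<Longrightarrow> open (F -` T)"
  unfolding smooth_map_def by (blast intro: open_vimage)

lemma smooth_manifold_prod:
  assumes "smooth_manifold M" "smooth_manifold N"
  shows "smooth_manifold (prod_manifold M N)"
proof -
  interpret M: smooth_manifold M by fact
  interpret N: smooth_manifold N by fact
  show ?thesis
  proof
    show "subspace (model (prod_manifold M N))"
      by (simp add: subspace_Times M.subspace_model N.subspace_model)
  next
    fix P \<theta> assume "(P, \<theta>) \<in> charts (prod_manifold M N)"
    then obtain U \<phi> V \<psi> where P: "P = U \<times> V" "\<theta> = map_prod \<phi> \<psi>"
      and U: "(U, \<phi>) \<in> charts M" and V: "(V, \<psi>) \<in> charts N" by (rule charts_prod_manifoldE)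
    show "open P" using M.chart_domain_open[OF U] N.chart_domain_open[OF V] P by (simp add: open_Times)
    show "openin (top_of_set (model (prod_manifold M N))) (\<theta> ` P)"
      using relopen_Times[OF M.chart_relopen[OF U] N.chart_relopen[OF V]]
      by (simp add: P image_map_prod_Times relopen_def)
    have inv: "inv_into P \<theta> (\<phi> a, \<psi> b) = (a, b)" if "a \<in> U" "b \<in> V" for a b
      using inv_into_map_prod[OF M.chart_inj[OF U] N.chart_inj[OF V] that] P by simp
    show "homeomorphism P (\<theta> ` P) \<theta> (inv_into P \<theta>)"
      unfolding homeomorphism_def
    proof (intro conjI ballI)
      show "continuous_on P \<theta>"
        unfolding P by (intro continuous_on_map_prod M.chart_continuous N.chart_continuous U V)
      have "continuous_on (\<phi> ` U \<times> \<psi> ` V) (map_prod (inv_into U \<phi>) (inv_into V \<psi>))"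
        using M.chart_homeomorphism[OF U] N.chart_homeomorphism[OF V] unfolding homeomorphism_def
        by (intro continuous_on_map_prod) auto
      then show "continuous_on (\<theta> ` P) (inv_into P \<theta>)"
        unfolding P image_map_prod_Times
        by (rule continuous_on_cong[THEN iffD1, OF refl, rotated])
          (use inv M.chart_inv[OF U] N.chart_inv[OF V] P in auto)
    qed (use inv P in \<open>auto simp: image_map_prod_Times image_iff\<close>)
  next
    show "(\<Union>(P, \<theta>) \<in> charts (prod_manifold M N). P) = UNIV"
    proof (intro equalityI subsetI)
      fix z :: "'a \<times> 'c"
      obtain U \<phi> where U: "(U, \<phi>) \<in> charts M" "fst z \<in> U" by (rule M.chart_at)
      obtain V \<psi> where V: "(V, \<psi>) \<in> charts N" "snd z \<in> V" by (rule N.chart_at)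
      show "z \<in> (\<Union>(P, \<theta>) \<in> charts (prod_manifold M N). P)"
        by (rule UN_I[OF charts_prod_manifoldI[OF U(1) V(1)]]) (simp add: mem_Times_iff U(2) V(2))
    qed simp
  next
    fix P \<theta> P' \<theta>'
    assume "(P, \<theta>) \<in> charts (prod_manifold M N)"
    then obtain U \<phi> V \<psi> where P: "P = U \<times> V" "\<theta> = map_prod \<phi> \<psi>"
      and U: "(U, \<phi>) \<in> charts M" and V: "(V, \<psi>) \<in> charts N" by (rule charts_prod_manifoldE)
    assume "(P', \<theta>') \<in> charts (prod_manifold M N)"
    then obtain U' \<phi>' V' \<psi>' where P': "P' = U' \<times> V'" "\<theta>' = map_prod \<phi>' \<psi>'"
      and U': "(U', \<phi>') \<in> charts M" and V': "(V', \<psi>') \<in> charts N" by (rule charts_prod_manifoldE)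
    have "smooth_on (model M \<times> model N) (\<phi> ` (U \<inter> U') \<times> \<psi> ` (V \<inter> V'))
        (map_prod (\<phi>' \<circ> inv_into U \<phi>) (\<psi>' \<circ> inv_into V \<psi>))"
      by (intro smooth_on_map_prod M.chart_Int_relopen N.chart_Int_relopen M.charts_compatible
          N.charts_compatible M.chart_domain_open[OF U'] N.chart_domain_open[OF V'] U V U' V')
    then show "smooth_on (model (prod_manifold M N)) (\<theta> ` (P \<inter> P')) (\<theta>' \<circ> inv_into P \<theta>)"
      unfolding P P' Times_Int_Times image_map_prod_Times model_prod_manifold
      by (rule smooth_on_cong[THEN iffD1, rotated])
        (use M.chart_inv[OF U] N.chart_inv[OF V] in
          \<open>auto simp: inv_into_map_prod[OF M.chart_inj[OF U] N.chart_inj[OF V]]\<close>)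
  qed
qed

lemma smooth_functions_comp:
  assumes "smooth_manifold M" "smooth_manifold N" "smooth_map M N F" "f \<in> smooth_functions N"
  shows "(\<lambda>p. f (F p)) \<in> smooth_functions M"
proof -
  interpret M: smooth_manifold M by fact
  interpret N: smooth_manifold N by fact
  show ?thesis
  proof (rule M.smooth_functions_localI)
    fix p
    obtain U \<phi> where U: "(U, \<phi>) \<in> charts M" "p \<in> U" by (rule M.chart_at)
    obtain V \<psi> where V: "(V, \<psi>) \<in> charts N" "F p \<in> V" by (rule N.chart_at)
    have T: "open (F -` V)" by (rule smooth_map_open_vimage[OF assms(3) N.chart_domain_open[OF V(1)]])
    have "smooth_on (model M) (\<phi> ` (U \<inter> F -` V))
        (\<lambda>s. (f \<circ> inv_into V \<psi>) ((\<psi> \<circ> F \<circ> inv_into U \<phi>) s))"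
      by (rule smooth_on_compose[OF M.chart_Int_relopen[OF U(1) T] N.chart_relopen[OF V(1)] _
            smooth_functionsD[OF assms(4) V(1)] smooth_mapD[OF assms(3) U(1) V(1)]])
        (auto simp: M.chart_inv[OF U(1)])
    then have "smooth_on (model M) (\<phi> ` (U \<inter> F -` V)) ((\<lambda>p. f (F p)) \<circ> inv_into U \<phi>)"
      by (rule smooth_on_cong[THEN iffD1, rotated])
        (auto simp: M.chart_inv[OF U(1)] N.chart_inv[OF V(1)])
    then show "\<exists>U \<phi> T. (U, \<phi>) \<in> charts M \<and> open T \<and> p \<in> U \<and> p \<in> T \<and>
        smooth_on (model M) (\<phi> ` (U \<inter> T)) ((\<lambda>p. f (F p)) \<circ> inv_into U \<phi>)"
      using U V T by blast
  qed
qed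

section \<open>Identity, constant and product maps, and slices of functions on a product\<close>

lemma smooth_map_ident:
  assumes "smooth_manifold M"
  shows "smooth_map M M (\<lambda>p. p)"
proof -
  interpret smooth_manifold M by fact
  show ?thesis
    using charts_compatible by (auto simp: smooth_map_def o_def)
qed

lemma smooth_map_const:
  assumes "smooth_manifold M"
  shows "smooth_map M N (\<lambda>_. c)"
proof -
  interpret smooth_manifold M by fact
  have "relopen (model M) (\<phi> ` (U \<inter> (\<lambda>_. c) -` V))" if "(U, \<phi>) \<in> charts M" for U \<phi> V
    by (rule chart_Int_relopen[OF that]) (cases "c \<in> V"; simp)
  then show ?thesis
    by (auto simp: smooth_map_def o_def intro!: smooth_on_const)
qed

lemma smooth_map_map_prod:
  assumes "smooth_manifold M" "smooth_manifold M'" "smooth_manifold N" "smooth_manifold N'"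
    and F: "smooth_map M N F" and F': "smooth_map M' N' F'"
  shows "smooth_map (prod_manifold M M') (prod_manifold N N') (map_prod F F')"
proof -
  interpret M: smooth_manifold M by fact
  interpret M': smooth_manifold M' by fact
  interpret N: smooth_manifold N by fact
  interpret N': smooth_manifold N' by fact
  have cont: "continuous_on UNIV (map_prod F F')"
    using continuous_on_map_prod[of UNIV F UNIV F'] F F' by (simp add: smooth_map_def)
  have "smooth_on (model (prod_manifold M M')) (\<theta> ` (P \<inter> map_prod F F' -` Q))
      (\<eta> \<circ> map_prod F F' \<circ> inv_into P \<theta>)"
    if P\<theta>: "(P, \<theta>) \<in> charts (prod_manifold M M')" and Q\<eta>: "(Q, \<eta>) \<in> charts (prod_manifold N N')" for P \<theta> Q \<eta>
  proof -
    obtain U \<phi> U' \<phi>' where P: "P = U \<times> U'" "\<theta> = map_prod \<phi> \<phi>'"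
      and U: "(U, \<phi>) \<in> charts M" and U': "(U', \<phi>') \<in> charts M'"
      using P\<theta> by (rule charts_prod_manifoldE)
    obtain V \<psi> V' \<psi>' where Q: "Q = V \<times> V'" "\<eta> = map_prod \<psi> \<psi>'"
      and V: "(V, \<psi>) \<in> charts N" and V': "(V', \<psi>') \<in> charts N'"
      using Q\<eta> by (rule charts_prod_manifoldE)
    have eq: "P \<inter> map_prod F F' -` Q = (U \<inter> F -` V) \<times> (U' \<inter> F' -` V')" by (auto simp: P Q)
    have "smooth_on (model M \<times> model M') (\<phi> ` (U \<inter> F -` V) \<times> \<phi>' ` (U' \<inter> F' -` V'))
        (map_prod (\<psi> \<circ> F \<circ> inv_into U \<phi>) (\<psi>' \<circ> F' \<circ> inv_into U' \<phi>'))"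
      by (intro smooth_on_map_prod M.chart_Int_relopen M'.chart_Int_relopen smooth_mapD[OF F]
          smooth_mapD[OF F'] U U' V V' smooth_map_open_vimage[OF F] smooth_map_open_vimage[OF F']
          N.chart_domain_open[OF V] N'.chart_domain_open[OF V'])
    then show ?thesis
      unfolding eq unfolding P Q image_map_prod_Times model_prod_manifold
      by (rule smooth_on_cong[THEN iffD1, rotated])
        (use M.chart_inv[OF U] M'.chart_inv[OF U'] in
          \<open>auto simp: inv_into_map_prod[OF M.chart_inj[OF U] M'.chart_inj[OF U']]\<close>)
  qed
  then show ?thesis using cont unfolding smooth_map_def by blast
qed

text \<open>With a product chart whose first factor contains \<open>a\<close>, the slice is the
  local representative of \<open>F\<close> with first argument frozen at
  \<open>\<phi> a\<close>.\<close>

lemma smooth_functions_slice: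
  assumes "smooth_manifold M" "smooth_manifold N" "F \<in> smooth_functions (prod_manifold M N)"
  shows "(\<lambda>b. F (a, b)) \<in> smooth_functions N"
proof -
  interpret M: smooth_manifold M by fact
  interpret N: smooth_manifold N by fact
  obtain U \<phi> where U: "(U, \<phi>) \<in> charts M" "a \<in> U" by (rule M.chart_at)
  have "smooth_on (model N) (\<psi> ` V) ((\<lambda>b. F (a, b)) \<circ> inv_into V \<psi>)"
    if V: "(V, \<psi>) \<in> charts N" for V \<psi>
  proof -
    note W = N.chart_relopen[OF V] and W' = M.chart_relopen[OF U(1)]
    have sm: "smooth_on (model M \<times> model N) (\<phi> ` U \<times> \<psi> ` V) (F \<circ> inv_into (U \<times> V) (map_prod \<phi> \<psi>))"
      using smooth_functionsD[OF assms(3) charts_prod_manifoldI[OF U(1) V]]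
      by (simp add: image_map_prod_Times)
    have "smooth_on (model N) (\<psi> ` V) (\<lambda>t. (F \<circ> inv_into (U \<times> V) (map_prod \<phi> \<psi>)) (\<phi> a, t))"
      by (rule smooth_on_compose[OF W relopen_Times[OF W' W] _ sm smooth_on_Pair[OF W
            smooth_on_const[OF W] smooth_on_bounded_linear[OF W bounded_linear_ident]]])
        (use U in auto)
    then show ?thesis
      by (rule smooth_on_cong[THEN iffD1, rotated])
        (use U N.chart_inv[OF V] in \<open>auto simp: inv_into_map_prod[OF M.chart_inj[OF U(1)] N.chart_inj[OF V]]\<close>)
  qed
  then show ?thesis by (auto simp: smooth_functions_def)
qed

text \<open>By \<open>local_frame\<close>, \<open>v a\<close> is a combination of coordinate derivations whose coefficients are values
  of \<open>v a\<close> on fixed functions, hence smooth in \<open>a\<close>.\<close>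

lemma smooth_partial_derivation:
  fixes M :: "('m::{t2_space, second_countable_topology}, 'e::euclidean_space) manifold"
    and N :: "('n::{t2_space, second_countable_topology}, 'd::euclidean_space) manifold"
  assumes "smooth_manifold M" "smooth_manifold N" and F: "F \<in> smooth_functions (prod_manifold M N)"
    and \<sigma>: "smooth_map M N \<sigma>" and v: "\<And>a. v a \<in> tangent_space N (\<sigma> a)"
    and vs: "\<And>f. f \<in> smooth_functions N \<Longrightarrow> (\<lambda>a. v a f) \<in> smooth_functions M"
  shows "(\<lambda>a. v a (\<lambda>b. F (a, b))) \<in> smooth_functions M"
proof -
  interpret M: smooth_manifold M by fact
  interpret N: smooth_manifold N by fact
  show ?thesis
  proof (rule M.smooth_functions_localI)
    fix p
    obtain U \<phi> where U: "(U, \<phi>) \<in> charts M" "p \<in> U" by (rule M.chart_at)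
    obtain V \<psi> where V: "(V, \<psi>) \<in> charts N" "\<sigma> p \<in> V" by (rule N.chart_at)
    obtain T \<rho> y where T: "open T" "\<sigma> p \<in> T" "T \<subseteq> V" and \<rho>: "\<rho> \<in> smooth_functions N"
      and y: "\<forall>b. y b \<in> smooth_functions N" and pos: "\<forall>q\<in>T. \<rho> q > 0"
      and frame: "\<forall>q\<in>T. \<forall>v\<in>tangent_space N q. \<forall>f\<in>smooth_functions N.
        \<rho> q * v f = (\<Sum>b\<in>onb (model N). (v (y b) - (\<psi> q \<bullet> b) * v \<rho>) * N.chart_deriv V \<psi> f q b)"
      by (rule N.local_frame[OF V]) (rule that; assumption)
    let ?T = "\<sigma> -` T"
    let ?E = "model M" and ?D = "model N"
    let ?W = "\<phi> ` (U \<inter> ?T)"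
    let ?i = "inv_into U \<phi>"
    have oT: "open ?T" by (rule smooth_map_open_vimage[OF \<sigma> T(1)])
    have W: "relopen ?E ?W" by (rule M.chart_Int_relopen[OF U(1) oT])
    note U' = M.chart_relopen[OF U(1)] and V' = N.chart_relopen[OF V(1)]
    define Ft where "Ft = F \<circ> inv_into (U \<times> V) (map_prod \<phi> \<psi>)"
    have Ft: "smooth_on (?E \<times> ?D) (\<phi> ` U \<times> \<psi> ` V) Ft"
      using smooth_functionsD[OF F charts_prod_manifoldI[OF U(1) V(1)]]
      by (simp add: image_map_prod_Times Ft_def)
    \<comment> \<open>A partial derivative in the second factor is the full derivative of the local
      representative \<open>Ft\<close> in the direction (0, b). In this form it is smooth in both
      variables jointly, so that \<open>\<sigma> a\<close> may be inserted for q.\<close>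
    have deriv: "N.chart_deriv V \<psi> (\<lambda>b. F (a, b)) q b =
        frechet_derivative Ft (at (\<phi> a, \<psi> q) within \<phi> ` U \<times> \<psi> ` V) (0, b)"
      if a: "a \<in> U" and q: "q \<in> V" and b: "b \<in> ?D" for a q b
    proof -
      have "((\<lambda>t. Ft (\<phi> a, t)) has_derivative
          (\<lambda>h. frechet_derivative Ft (at (\<phi> a, \<psi> q) within \<phi> ` U \<times> \<psi> ` V) (0, h)))
          (at (\<psi> q) within \<psi> ` V)"
        by (rule has_derivative_in_compose2[OF smooth_on_has_derivative[OF Ft]])
          (use a q in \<open>auto intro!: derivative_eq_intros\<close>)
      then have "((\<lambda>b. F (a, b)) \<circ> inv_into V \<psi> has_derivative
          (\<lambda>h. frechet_derivative Ft (at (\<phi> a, \<psi> q) within \<phi> ` U \<times> \<psi> ` V) (0, h)))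
          (at (\<psi> q) within \<psi> ` V)"
        by (rule has_derivative_transform[rotated 2])
          (use a q N.chart_inv[OF V(1)] in
            \<open>auto simp: Ft_def inv_into_map_prod[OF M.chart_inj[OF U(1)] N.chart_inj[OF V(1)]]\<close>)
      then show ?thesis
        unfolding N.chart_deriv_def using q by (intro frechet_derivative_relopen[OF V' _ b]) (auto simp: o_def)
    qed
    have restrict: "smooth_on ?E ?W (\<lambda>s. h (?i s))" if "h \<in> smooth_functions M" for h
      using smooth_on_subset[OF U' W _ smooth_functionsD[OF that U(1)]] by (auto simp: o_def)
    have \<sigma>s: "smooth_on ?E ?W (\<lambda>s. \<psi> (\<sigma> (?i s)))"
      using smooth_on_subset[OF M.chart_Int_relopen[OF U(1)
            smooth_map_open_vimage[OF \<sigma> N.chart_domain_open[OF V(1)]]] W _ smooth_mapD[OF \<sigma> U(1) V(1)]] T(3)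
      by (auto simp: o_def)
    have D0: "(0, b) \<in> ?E \<times> ?D" if "b \<in> onb ?D" for b
      using that onb_subset[OF N.subspace_model] subspace_0[OF M.subspace_model] by auto
    \<comment> \<open>This is the expansion of \<open>local_frame\<close> solved for the value of v,
      transported to the chart of \<open>M\<close>. Every ingredient is a fixed smooth function of
      the point, and the divisor is positive by the choice of \<open>T\<close>.\<close>
    have "smooth_on ?E ?W (\<lambda>s. inverse (\<rho> (\<sigma> (?i s))) * (\<Sum>b\<in>onb ?D.
        (v (?i s) (y b) - (\<psi> (\<sigma> (?i s)) \<bullet> b) * v (?i s) \<rho>) *
        frechet_derivative Ft (at (s, \<psi> (\<sigma> (?i s))) within \<phi> ` U \<times> \<psi> ` V) (0, b)))"
    proof (intro smooth_on_mult[OF W] smooth_on_inverse[OF W] smooth_on_sum[OF W] smooth_on_diff[OF W]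
        restrict[OF vs] y[rule_format] \<rho> smooth_on_bounded_linear_comp[OF W bounded_linear_inner_left \<sigma>s]
        restrict[OF smooth_functions_comp[OF assms(1,2) \<sigma> \<rho>]])
      show "\<rho> (\<sigma> (?i s)) \<noteq> 0" if "s \<in> ?W" for s
      proof -
        have "\<rho> (\<sigma> (?i s)) > 0" using that M.chart_inv[OF U(1)] by (intro pos[rule_format]) auto
        then show ?thesis by simp
      qed
      fix b assume b: "b \<in> onb ?D"
      show "smooth_on ?E ?W (\<lambda>s. frechet_derivative Ft
          (at (s, \<psi> (\<sigma> (?i s))) within \<phi> ` U \<times> \<psi> ` V) (0, b))"
        by (rule smooth_on_compose[OF W relopen_Times[OF U' V'] _
              smooth_on_frechet_derivative[OF Ft D0[OF b]]
              smooth_on_Pair[OF W smooth_on_bounded_linear[OF W bounded_linear_ident] \<sigma>s]])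
          (use M.chart_inv[OF U(1)] T(3) in auto)
    qed
    then have "smooth_on ?E ?W ((\<lambda>a. v a (\<lambda>b. F (a, b))) \<circ> ?i)"
    proof (rule smooth_on_cong[THEN iffD1, rotated])
      fix s assume "s \<in> ?W"
      then obtain a where a: "a \<in> U" "\<sigma> a \<in> T" "s = \<phi> a" by auto
      have Fa: "(\<lambda>b. F (a, b)) \<in> smooth_functions N" by (rule smooth_functions_slice[OF assms(1,2) F])
      have "(\<Sum>b\<in>onb ?D. (v a (y b) - (\<psi> (\<sigma> a) \<bullet> b) * v a \<rho>) *
          frechet_derivative Ft (at (\<phi> a, \<psi> (\<sigma> a)) within \<phi> ` U \<times> \<psi> ` V) (0, b)) =
        \<rho> (\<sigma> a) * v a (\<lambda>b. F (a, b))"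
        unfolding frame[rule_format, OF a(2) v Fa]
        by (intro sum.cong refl arg_cong2[where f = "(*)"] deriv[symmetric])
          (use a T(3) onb_subset[OF N.subspace_model] in auto)
      then show "inverse (\<rho> (\<sigma> (?i s))) * (\<Sum>b\<in>onb ?D.
          (v (?i s) (y b) - (\<psi> (\<sigma> (?i s)) \<bullet> b) * v (?i s) \<rho>) *
          frechet_derivative Ft (at (s, \<psi> (\<sigma> (?i s))) within \<phi> ` U \<times> \<psi> ` V) (0, b)) =
        ((\<lambda>a. v a (\<lambda>b. F (a, b))) \<circ> ?i) s"
        using pos[rule_format, OF a(2)] a by (simp add: M.chart_inv[OF U(1)])
    qed
    then show "\<exists>U \<phi> T. (U, \<phi>) \<in> charts M \<and> open T \<and> p \<in> U \<and> p \<in> T \<and>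
        smooth_on (model M) (\<phi> ` (U \<inter> T)) ((\<lambda>a. v a (\<lambda>b. F (a, b))) \<circ> inv_into U \<phi>)"
      using U oT T(2) by blast
  qed
qed

section \<open>Left invariant fields and forms on a Lie group\<close>

lemma linear_on_sum:
  assumes "subspace V" "linear_on V f" "\<And>i. i \<in> I \<Longrightarrow> v i \<in> V"
  shows "f (\<Sum>i\<in>I. c i *\<^sub>R v i) = (\<Sum>i\<in>I. c i *\<^sub>R f (v i))"
proof -
  have "f 0 = f (0 *\<^sub>R 0)" by simp
  also have "\<dots> = 0" using assms(1,2) subspace_0 unfolding linear_on_def by (metis scaleR_zero_left)
  finally have 0: "f 0 = 0" .
  have "f (\<Sum>i\<in>I. c i *\<^sub>R v i) = (\<Sum>i\<in>I. c i *\<^sub>R f (v i)) \<and> (\<Sum>i\<in>I. c i *\<^sub>R v i) \<in> V"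
    using assms(3)
  proof (induction I rule: infinite_finite_induct)
    case (insert i I)
    then have "c i *\<^sub>R v i \<in> V" "(\<Sum>i\<in>I. c i *\<^sub>R v i) \<in> V" "v i \<in> V"
      using assms(1) by (auto simp: subspace_scale)
    then show ?case
      using insert assms(1,2) unfolding linear_on_def by (simp add: subspace_add)
  qed (use 0 assms(1) subspace_0 in auto)
  then show ?thesis by blast
qed

lemma sum_fun_apply: "(\<Sum>i\<in>I. f i) x = (\<Sum>i\<in>I. f i x)" for f :: "'i \<Rightarrow> 'a \<Rightarrow> 'b::comm_monoid_add"
  by (induction I rule: infinite_finite_induct) auto

lemma scaleR_fun_apply: "(c *\<^sub>R f) x = c *\<^sub>R f x"
  by (simp add: scaleR_fun_def)

lemma pushforward_add: "pushforward M F (v + w) = pushforward M F v + pushforward M F w"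
  by (auto simp: pushforward_def)

lemma pushforward_scaleR: "pushforward M F (c *\<^sub>R v) = c *\<^sub>R pushforward M F v"
  by (auto simp: pushforward_def scaleR_fun_def)

lemma pushforward_zero: "pushforward M F 0 = 0"
  by (auto simp: pushforward_def)

lemma pushforward_sum: "pushforward M F (\<Sum>i\<in>I. v i) = (\<Sum>i\<in>I. pushforward M F (v i))"
  by (rule ext) (simp add: pushforward_def sum_fun_apply)

lemma pullback_add: "pullback M F p (\<alpha> + \<beta>) = pullback M F p \<alpha> + pullback M F p \<beta>"
  by (auto simp: pullback_def)

lemma pullback_scaleR: "pullback M F p (c *\<^sub>R \<alpha>) = c *\<^sub>R pullback M F p \<alpha>"
  by (auto simp: pullback_def scaleR_fun_def)

lemma dual_add: "\<alpha> \<in> dual V \<Longrightarrow> u \<in> V \<Longrightarrow> v \<in> V \<Longrightarrow> \<alpha> (u + v) = \<alpha> u + \<alpha> v"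
  by (simp add: dual_def linear_on_def)

lemma dual_scaleR: "\<alpha> \<in> dual V \<Longrightarrow> v \<in> V \<Longrightarrow> \<alpha> (c *\<^sub>R v) = c * \<alpha> v"
  by (simp add: dual_def linear_on_def)

lemma dual_off: "\<alpha> \<in> dual V \<Longrightarrow> v \<notin> V \<Longrightarrow> \<alpha> v = 0"
  by (simp add: dual_def)

lemma dualI:
  "(\<And>u v. u \<in> V \<Longrightarrow> v \<in> V \<Longrightarrow> \<alpha> (u + v) = \<alpha> u + \<alpha> v) \<Longrightarrow>
    (\<And>c v. v \<in> V \<Longrightarrow> \<alpha> (c *\<^sub>R v) = c * \<alpha> v) \<Longrightarrow> (\<And>v. v \<notin> V \<Longrightarrow> \<alpha> v = 0) \<Longrightarrow> \<alpha> \<in> dual V"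
  by (simp add: dual_def linear_on_def)

lemma subspace_dual: "subspace (dual V)"
  by (rule subspaceI) (auto intro!: dualI simp: dual_add dual_scaleR dual_off scaleR_fun_def algebra_simps)

context smooth_manifold
begin

lemma subspace_tangent_space: "subspace (tangent_space M p)"
  by (rule subspaceI; rule tangent_spaceI)
    (auto simp: tangent_add tangent_cmult tangent_mult tangent_off scaleR_fun_def algebra_simps)

lemma subspace_cotangent_space: "subspace (cotangent_space M p)"
  unfolding cotangent_space_def by (rule subspace_dual)

lemma subspace_gen_space: "subspace (gen_space M p)"
  unfolding gen_space_def by (intro subspace_Times subspace_tangent_space subspace_cotangent_space)

section \<open>Vector fields, 1-forms and generalized sections as modules over the smooth
  functions\<close>

lemma vector_fields_tangent: "X \<in> vector_fields M \<Longrightarrow> X p \<in> tangent_space M p"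
  by (simp add: vector_fields_def)

lemma vector_fields_smooth:
  "X \<in> vector_fields M \<Longrightarrow> f \<in> smooth_functions M \<Longrightarrow> (\<lambda>p. X p f) \<in> smooth_functions M"
  by (simp add: vector_fields_def)

lemma vector_fields_add:
  "X \<in> vector_fields M \<Longrightarrow> Y \<in> vector_fields M \<Longrightarrow> (\<lambda>p. X p + Y p) \<in> vector_fields M"
  by (simp add: vector_fields_def subspace_add[OF subspace_tangent_space] smooth_functions_add)

lemma vector_fields_scaleR:
  "f \<in> smooth_functions M \<Longrightarrow> X \<in> vector_fields M \<Longrightarrow> (\<lambda>p. f p *\<^sub>R X p) \<in> vector_fields M"
  by (simp add: vector_fields_def subspace_scale[OF subspace_tangent_space] smooth_functions_mult
      scaleR_fun_apply)

lemma vector_fields_zero: "(\<lambda>p. 0) \<in> vector_fields M"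
  by (simp add: vector_fields_def subspace_0[OF subspace_tangent_space] smooth_functions_const)

lemma vector_fields_sum:
  "(\<And>i. i \<in> I \<Longrightarrow> X i \<in> vector_fields M) \<Longrightarrow> (\<lambda>p. \<Sum>i\<in>I. X i p) \<in> vector_fields M"
  by (induction I rule: infinite_finite_induct) (auto intro: vector_fields_zero vector_fields_add)

lemma one_forms_cotangent: "\<xi> \<in> one_forms M \<Longrightarrow> \<xi> p \<in> cotangent_space M p"
  by (simp add: one_forms_def)

lemma one_forms_dual: "\<xi> \<in> one_forms M \<Longrightarrow> \<xi> p \<in> dual (tangent_space M p)"
  by (simp add: one_forms_def cotangent_space_def)

lemma one_forms_smooth:
  "\<xi> \<in> one_forms M \<Longrightarrow> X \<in> vector_fields M \<Longrightarrow> (\<lambda>p. \<xi> p (X p)) \<in> smooth_functions M"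
  by (simp add: one_forms_def)

lemma one_forms_add:
  "\<xi> \<in> one_forms M \<Longrightarrow> \<eta> \<in> one_forms M \<Longrightarrow> (\<lambda>p. \<xi> p + \<eta> p) \<in> one_forms M"
  by (simp add: one_forms_def subspace_add[OF subspace_cotangent_space] smooth_functions_add)

lemma one_forms_scaleR:
  "f \<in> smooth_functions M \<Longrightarrow> \<xi> \<in> one_forms M \<Longrightarrow> (\<lambda>p. f p *\<^sub>R \<xi> p) \<in> one_forms M"
  by (simp add: one_forms_def subspace_scale[OF subspace_cotangent_space] smooth_functions_mult
      scaleR_fun_apply)

lemma one_forms_zero: "(\<lambda>p. 0) \<in> one_forms M"
  by (simp add: one_forms_def subspace_0[OF subspace_cotangent_space] smooth_functions_const)

lemma one_forms_sum:
  "(\<And>i. i \<in> I \<Longrightarrow> \<xi> i \<in> one_forms M) \<Longrightarrow> (\<lambda>p. \<Sum>i\<in>I. \<xi> i p) \<in> one_forms M"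
  by (induction I rule: infinite_finite_induct) (auto intro: one_forms_zero one_forms_add)

lemma gen_sectionsI:
  "X \<in> vector_fields M \<Longrightarrow> \<xi> \<in> one_forms M \<Longrightarrow> (\<lambda>p. (X p, \<xi> p)) \<in> gen_sections M"
  by (simp add: gen_sections_def o_def)

lemma gen_sections_fst: "A \<in> gen_sections M \<Longrightarrow> (\<lambda>p. fst (A p)) \<in> vector_fields M"
  and gen_sections_snd: "A \<in> gen_sections M \<Longrightarrow> (\<lambda>p. snd (A p)) \<in> one_forms M"
  by (simp_all add: gen_sections_def o_def)

lemma gen_sections_gen_space: "A \<in> gen_sections M \<Longrightarrow> A p \<in> gen_space M p"
  using vector_fields_tangent[OF gen_sections_fst, of A p]
    one_forms_cotangent[OF gen_sections_snd, of A p]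
  by (simp add: gen_space_def mem_Times_iff)

lemma gen_sections_add:
  "A \<in> gen_sections M \<Longrightarrow> B \<in> gen_sections M \<Longrightarrow> (\<lambda>p. A p + B p) \<in> gen_sections M"
  using vector_fields_add one_forms_add by (simp add: gen_sections_def o_def)

lemma gen_sections_scaleR:
  "f \<in> smooth_functions M \<Longrightarrow> A \<in> gen_sections M \<Longrightarrow> (\<lambda>p. f p *\<^sub>R A p) \<in> gen_sections M"
  using vector_fields_scaleR one_forms_scaleR by (simp add: gen_sections_def o_def)

lemma gen_sections_uminus:
  "A \<in> gen_sections M \<Longrightarrow> (\<lambda>p. - A p) \<in> gen_sections M"
  using gen_sections_scaleR[OF smooth_functions_const, of A "-1"] by simp

section \<open>The Lie bracket of vector fields\<close>

lemma field_bracket_apply: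
  "f \<in> smooth_functions M \<Longrightarrow>
    field_bracket M X Y p f = X p (\<lambda>q. Y q f) - Y p (\<lambda>q. X q f)"
  by (simp add: field_bracket_def)

lemma field_bracket_vector_field:
  assumes X: "X \<in> vector_fields M" and Y: "Y \<in> vector_fields M"
  shows "field_bracket M X Y \<in> vector_fields M"
proof -
  note T = vector_fields_tangent[OF X] vector_fields_tangent[OF Y]
  note S = vector_fields_smooth[OF X] vector_fields_smooth[OF Y]
  have "field_bracket M X Y p \<in> tangent_space M p" for p
  proof (rule tangent_spaceI)
    fix f g assume fg: "f \<in> smooth_functions M" "g \<in> smooth_functions M"
    show "field_bracket M X Y p (\<lambda>q. f q + g q) = field_bracket M X Y p f + field_bracket M X Y p g"
      using fg by (simp add: field_bracket_apply smooth_functions_add tangent_add[OF T(1)]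
          tangent_add[OF T(2)] S)
    show "field_bracket M X Y p (\<lambda>q. f q * g q) =
        f p * field_bracket M X Y p g + g p * field_bracket M X Y p f"
      using fg by (simp add: field_bracket_apply smooth_functions_mult smooth_functions_add
          tangent_add[OF T(1)] tangent_add[OF T(2)] tangent_mult[OF T(1)] tangent_mult[OF T(2)] S
          algebra_simps)
  next
    fix f c assume f: "f \<in> smooth_functions M"
    show "field_bracket M X Y p (\<lambda>q. c * f q) = c * field_bracket M X Y p f"
      using f by (simp add: field_bracket_apply smooth_functions_cmult tangent_cmult[OF T(1)]
          tangent_cmult[OF T(2)] S algebra_simps)
  qed (simp add: field_bracket_def)
  moreover have "(\<lambda>p. field_bracket M X Y p f) \<in> smooth_functions M" if "f \<in> smooth_functions M" for f
    unfolding field_bracket_apply[OF that] by (intro smooth_functions_diff S that)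
  ultimately show ?thesis by (simp add: vector_fields_def)
qed

lemma field_bracket_swap: "field_bracket M X Y p = - field_bracket M Y X p"
  by (auto simp: field_bracket_def)

lemma field_bracket_add_right:
  assumes X: "X \<in> vector_fields M" and Y: "Y \<in> vector_fields M" and Z: "Z \<in> vector_fields M"
  shows "field_bracket M X (\<lambda>p. Y p + Z p) p = field_bracket M X Y p + field_bracket M X Z p"
proof
  fix f
  show "field_bracket M X (\<lambda>p. Y p + Z p) p f = (field_bracket M X Y p + field_bracket M X Z p) f"
    using vector_fields_smooth[OF Y] vector_fields_smooth[OF Z]
    by (simp add: field_bracket_def tangent_add[OF vector_fields_tangent[OF X]])
qed

lemma field_bracket_scaleR_right:
  assumes X: "X \<in> vector_fields M" and Y: "Y \<in> vector_fields M" and h: "h \<in> smooth_functions M"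
  shows "field_bracket M X (\<lambda>p. h p *\<^sub>R Y p) p = h p *\<^sub>R field_bracket M X Y p + X p h *\<^sub>R Y p"
proof
  fix f
  show "field_bracket M X (\<lambda>p. h p *\<^sub>R Y p) p f = (h p *\<^sub>R field_bracket M X Y p + X p h *\<^sub>R Y p) f"
    using vector_fields_smooth[OF Y] tangent_off[OF vector_fields_tangent[OF Y]]
    \<comment> \<open>On functions that are not smooth, the bracket and all tangent vectors take the
      default value 0.\<close>
    by (cases "f \<in> smooth_functions M")
      (simp_all add: field_bracket_def scaleR_fun_def tangent_mult[OF vector_fields_tangent[OF X] h]
        algebra_simps)
qed

end

context lie_group
begin

section \<open>Translations of functions and tangent vectors\<close>

lemma manifold: "smooth_manifold M"
  by unfold_locales

lemma mult_assoc: "a \<otimes> b \<otimes> c = a \<otimes> (b \<otimes> c)"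
  by (simp add: m_assoc carrier_UNIV)

lemma one_mult [simp]: "\<one> \<otimes> a = a" and mult_one [simp]: "a \<otimes> \<one> = a"
  by (simp_all add: carrier_UNIV)

lemma inv_mult [simp]: "inv a \<otimes> a = \<one>" and mult_inv [simp]: "a \<otimes> inv a = \<one>"
  by (simp_all add: carrier_UNIV)

lemma inv_mult_cancel [simp]: "inv a \<otimes> (a \<otimes> b) = b" and mult_inv_cancel [simp]: "a \<otimes> (inv a \<otimes> b) = b"
  by (simp_all add: mult_assoc[symmetric])

lemma inv_mult_eq: "inv (a \<otimes> b) = inv b \<otimes> inv a"
  by (simp add: inv_mult_group carrier_UNIV)

lemma smooth_functions_mult_map:
  assumes "f \<in> smooth_functions M"
  shows "(\<lambda>(a, b). f (a \<otimes> b)) \<in> smooth_functions (prod_manifold M M)"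
  using smooth_functions_comp[OF smooth_manifold_prod[OF manifold manifold] manifold smooth_mult assms]
  by (simp add: case_prod_unfold)

lemma smooth_functions_left_div:
  assumes "f \<in> smooth_functions M"
  shows "(\<lambda>(a, b). f (inv a \<otimes> b)) \<in> smooth_functions (prod_manifold M M)"
  using smooth_functions_comp[OF smooth_manifold_prod[OF manifold manifold]
      smooth_manifold_prod[OF manifold manifold]
      smooth_map_map_prod[OF manifold manifold manifold manifold smooth_inv smooth_map_ident[OF manifold]]
      smooth_functions_mult_map[OF assms]]
  by (simp add: case_prod_unfold)

lemma smooth_functions_translate:
  assumes "f \<in> smooth_functions M"
  shows "(\<lambda>b. f (a \<otimes> b)) \<in> smooth_functions M"
  using smooth_functions_slice[OF manifold manifold smooth_functions_mult_map[OF assms], of a] by simp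

lemma pushforward_apply:
  "f \<in> smooth_functions M \<Longrightarrow> pushforward M (left_translation G a) v f = v (\<lambda>b. f (a \<otimes> b))"
  by (simp add: pushforward_def left_translation_def o_def)

lemma pushforward_tangent:
  assumes "v \<in> tangent_space M b"
  shows "pushforward M (left_translation G a) v \<in> tangent_space M (a \<otimes> b)"
proof (rule tangent_spaceI)
  fix f assume "f \<notin> smooth_functions M"
  then show "pushforward M (left_translation G a) v f = 0" by (simp add: pushforward_def)
qed (simp_all add: pushforward_apply smooth_functions_add smooth_functions_cmult smooth_functions_mult
    tangent_add[OF assms] tangent_cmult[OF assms] tangent_mult[OF assms] smooth_functions_translate)

lemma pushforward_pushforward:
  "pushforward M (left_translation G a) (pushforward M (left_translation G b) v) =
    pushforward M (left_translation G (a \<otimes> b)) v"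
proof
  fix f
  show "pushforward M (left_translation G a) (pushforward M (left_translation G b) v) f =
    pushforward M (left_translation G (a \<otimes> b)) v f"
  proof (cases "f \<in> smooth_functions M")
    case True
    then show ?thesis by (simp add: pushforward_apply smooth_functions_translate mult_assoc)
  qed (simp add: pushforward_def)
qed

lemma pushforward_one:
  assumes "v \<in> tangent_space M b"
  shows "pushforward M (left_translation G \<one>) v = v"
proof
  show "pushforward M (left_translation G \<one>) v f = v f" for f
    by (cases "f \<in> smooth_functions M")
      (auto simp: pushforward_def left_translation_def o_def tangent_off[OF assms])
qed

lemma left_field_add: "left_field G M (x + y) a = left_field G M x a + left_field G M y a"
  and left_field_scaleR: "left_field G M (c *\<^sub>R x) a = c *\<^sub>R left_field G M x a"
  by (simp_all add: left_field_def pushforward_add pushforward_scaleR)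

text \<open>Smoothness is the case of constant \<open>\<sigma>\<close> in
  \<open>smooth_partial_derivation\<close>: f(ab) is smooth on the product, and x always
  differentiates in b at the identity while a is the parameter.\<close>

lemma left_field_vector_field:
  assumes x: "x \<in> tangent_space M \<one>"
  shows "left_field G M x \<in> vector_fields M"
proof -
  have "left_field G M x a \<in> tangent_space M a" for a
    using pushforward_tangent[OF x, of a] by (simp add: left_field_def)
  moreover have "(\<lambda>a. left_field G M x a f) \<in> smooth_functions M" if f: "f \<in> smooth_functions M" for f
    using smooth_partial_derivation[OF manifold manifold smooth_functions_mult_map[OF f]
        smooth_map_const[OF manifold], of "\<lambda>_. x"] x smooth_functions_const
    by (simp add: left_field_def pushforward_apply[OF f])
  ultimately show ?thesis by (simp add: vector_fields_def)
qed

lemma pushforward_inv_tangent: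
  "v \<in> tangent_space M a \<Longrightarrow> pushforward M (left_translation G (inv a)) v \<in> tangent_space M \<one>"
  using pushforward_tangent[of v a "inv a"] by simp

lemma left_field_pushforward_inv:
  assumes "v \<in> tangent_space M a"
  shows "left_field G M (pushforward M (left_translation G (inv a)) v) a = v"
  using pushforward_one[OF assms] by (simp add: left_field_def pushforward_pushforward)

lemma pushforward_inv_left_field:
  assumes "x \<in> tangent_space M \<one>"
  shows "pushforward M (left_translation G (inv a)) (left_field G M x a) = x"
  using pushforward_one[OF assms] by (simp add: left_field_def pushforward_pushforward)

lemma left_field_one: "x \<in> tangent_space M \<one> \<Longrightarrow> left_field G M x \<one> = x"
  by (simp add: left_field_def pushforward_one)

text \<open>Translation extends a tangent vector globally with no cutoff. This is what allows
  pointwise identities of covectors to be tested on vector fields.\<close>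

lemma tangent_extension:
  assumes "v \<in> tangent_space M p"
  obtains Z where "Z \<in> vector_fields M" "Z p = v"
  using left_field_vector_field[OF pushforward_inv_tangent[OF assms]] left_field_pushforward_inv[OF assms]
  by blast

text \<open>\<open>local_frame\<close> at the identity, divided by \<open>\<rho> \<one>\<close>. The
  point of this form is that the coordinates of x are its values at fixed global functions, so the
  coordinates of a vector that varies smoothly are smooth.\<close>

lemma lie_algebra_frame:
  obtains u d where "\<And>b. b \<in> onb (model M) \<Longrightarrow> u b \<in> smooth_functions M"
    "\<And>b. b \<in> onb (model M) \<Longrightarrow> d b \<in> tangent_space M \<one>"
    "\<And>x. x \<in> tangent_space M \<one> \<Longrightarrow> x = (\<Sum>b\<in>onb (model M). x (u b) *\<^sub>R d b)"
proof -
  let ?I = "onb (model M)"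
  obtain U \<phi> where U: "(U, \<phi>) \<in> charts M" "\<one> \<in> U" by (rule chart_at)
  obtain N \<rho> y where N: "open N" "\<one> \<in> N" "N \<subseteq> U" and \<rho>: "\<rho> \<in> smooth_functions M"
    and y: "\<forall>b. y b \<in> smooth_functions M" and pos: "\<forall>q\<in>N. \<rho> q > 0"
    and frame: "\<forall>q\<in>N. \<forall>v\<in>tangent_space M q. \<forall>f\<in>smooth_functions M.
      \<rho> q * v f = (\<Sum>b\<in>?I. (v (y b) - (\<phi> q \<bullet> b) * v \<rho>) * chart_deriv U \<phi> f q b)"
    by (rule local_frame[OF U]) (rule that; assumption)
  define u where "u = (\<lambda>b q. inverse (\<rho> \<one>) * (y b q - (\<phi> \<one> \<bullet> b) * \<rho> q))"
  define d where "d = (\<lambda>b f. if f \<in> smooth_functions M then chart_deriv U \<phi> f \<one> b else 0)"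
  have w: "(\<lambda>q. y b q - (\<phi> \<one> \<bullet> b) * \<rho> q) \<in> smooth_functions M" for b
    by (intro smooth_functions_diff smooth_functions_cmult y[rule_format] \<rho>)
  have u: "u b \<in> smooth_functions M" for b
    unfolding u_def by (intro smooth_functions_mult w smooth_functions_const)
  have d: "d b \<in> tangent_space M \<one>" if "b \<in> ?I" for b
    unfolding d_def using that onb_subset[OF subspace_model] by (intro chart_deriv_tangent U) auto
  have xu: "x (u b) = inverse (\<rho> \<one>) * (x (y b) - (\<phi> \<one> \<bullet> b) * x \<rho>)"
    if x: "x \<in> tangent_space M \<one>" for x b
    unfolding u_def
    by (simp only: tangent_cmult[OF x w] tangent_diff[OF x y[rule_format] smooth_functions_cmult[OF \<rho>]]
        tangent_cmult[OF x \<rho>])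
  have "x = (\<Sum>b\<in>?I. x (u b) *\<^sub>R d b)" if x: "x \<in> tangent_space M \<one>" for x
  proof
    fix f
    show "x f = (\<Sum>b\<in>?I. x (u b) *\<^sub>R d b) f"
    proof (cases "f \<in> smooth_functions M")
      case True
      have "x f = inverse (\<rho> \<one>) * (\<rho> \<one> * x f)" using pos N(2) by force
      also have "\<dots> = inverse (\<rho> \<one>) *
          (\<Sum>b\<in>?I. (x (y b) - (\<phi> \<one> \<bullet> b) * x \<rho>) * chart_deriv U \<phi> f \<one> b)"
        by (simp only: frame[rule_format, OF N(2) x True])
      also have "\<dots> = (\<Sum>b\<in>?I. x (u b) * d b f)"
        using True by (simp add: xu[OF x] d_def sum_distrib_left mult.assoc)
      finally show ?thesis by (simp add: sum_fun_apply scaleR_fun_def)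
    next
      case False
      then show ?thesis by (simp add: tangent_off[OF x] d_def sum_fun_apply scaleR_fun_def)
    qed
  qed
  then show ?thesis using that[of u d] u d by blast
qed

text \<open>Translate \<open>Z a\<close> to the identity, expand it in the frame there, and
  translate back. This writes \<open>Z\<close> as a finite combination of left invariant fields with
  smooth coefficients.\<close>

lemma vector_fields_induct [consumes 1, case_names left add scaleR]:
  assumes Z: "Z \<in> vector_fields M"
    and left: "\<And>x. x \<in> tangent_space M \<one> \<Longrightarrow> P (left_field G M x)"
    and add: "\<And>X Y. X \<in> vector_fields M \<Longrightarrow> Y \<in> vector_fields M \<Longrightarrow> P X \<Longrightarrow> P Y \<Longrightarrow> P (\<lambda>p. X p + Y p)"
    and scaleR: "\<And>f X. f \<in> smooth_functions M \<Longrightarrow> X \<in> vector_fields M \<Longrightarrow> P X \<Longrightarrow> P (\<lambda>p. f p *\<^sub>R X p)"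
  shows "P Z"
proof -
  let ?I = "onb (model M)"
  obtain u d where u: "\<And>b. b \<in> ?I \<Longrightarrow> u b \<in> smooth_functions M"
    and d: "\<And>b. b \<in> ?I \<Longrightarrow> d b \<in> tangent_space M \<one>"
    and frame: "\<And>x. x \<in> tangent_space M \<one> \<Longrightarrow> x = (\<Sum>b\<in>?I. x (u b) *\<^sub>R d b)"
    using lie_algebra_frame by blast
  \<comment> \<open>The coordinates of the vector translated back to the identity.
    \<open>Z a\<close> differentiates in q with the a in \<open>inv a\<close> held fixed, so
    smoothness is the case of \<open>smooth_partial_derivation\<close> where \<open>\<sigma>\<close>
    is the identity.\<close>
  define c where "c = (\<lambda>b a. Z a (\<lambda>q. u b (inv a \<otimes> q)))"
  have c: "c b \<in> smooth_functions M" if "b \<in> ?I" for b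
    using smooth_partial_derivation[OF manifold manifold smooth_functions_left_div[OF u[OF that]]
        smooth_map_ident[OF manifold] vector_fields_tangent[OF Z] vector_fields_smooth[OF Z]]
    by (simp add: c_def)
  have "Z a = (\<Sum>b\<in>?I. c b a *\<^sub>R left_field G M (d b) a)" for a
  proof -
    let ?x = "pushforward M (left_translation G (inv a)) (Z a)"
    note T = vector_fields_tangent[OF Z, of a]
    have "Z a = left_field G M ?x a" using left_field_pushforward_inv[OF T] by simp
    also have "\<dots> = pushforward M (left_translation G a) (\<Sum>b\<in>?I. ?x (u b) *\<^sub>R d b)"
      using frame[OF pushforward_inv_tangent[OF T]] by (simp add: left_field_def)
    also have "\<dots> = (\<Sum>b\<in>?I. c b a *\<^sub>R left_field G M (d b) a)"
      using u by (simp add: pushforward_sum pushforward_scaleR left_field_def pushforward_apply c_def)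
    finally show ?thesis .
  qed
  then have Z_eq: "Z = (\<lambda>a. \<Sum>b\<in>?I. c b a *\<^sub>R left_field G M (d b) a)" by (rule ext)
  have zero: "P (\<lambda>p. 0)"
    using left[OF subspace_0[OF subspace_tangent_space]] by (simp only: left_field_def pushforward_zero)
  have "P (\<lambda>a. \<Sum>b\<in>J. c b a *\<^sub>R left_field G M (d b) a)" if "J \<subseteq> ?I" for J
    using finite_subset[OF that finite_onb[OF subspace_model]] that
  proof (induction J rule: finite_induct)
    case empty
    show ?case unfolding sum.empty by (rule zero)
  next
    case (insert b J)
    then have b: "b \<in> ?I" and J: "J \<subseteq> ?I" by auto
    have bv: "(\<lambda>a. c b a *\<^sub>R left_field G M (d b) a) \<in> vector_fields M" if "b \<in> ?I" for b
      by (intro vector_fields_scaleR c left_field_vector_field d that)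
    have "P (\<lambda>a. c b a *\<^sub>R left_field G M (d b) a + (\<Sum>b\<in>J. c b a *\<^sub>R left_field G M (d b) a))"
      using J by (intro add bv vector_fields_sum scaleR c left left_field_vector_field d b insert.IH) auto
    then show ?case unfolding sum.insert[OF insert.hyps] .
  qed
  then show ?thesis unfolding Z_eq by blast
qed

definition left_form :: "'g covec \<Rightarrow> 'g \<Rightarrow> 'g covec" where
  "left_form \<beta> a = pullback M (left_translation G (inv a)) a \<beta>"

lemma left_form_apply:
  "v \<in> tangent_space M a \<Longrightarrow> left_form \<beta> a v = \<beta> (pushforward M (left_translation G (inv a)) v)"
  by (simp add: left_form_def pullback_def)

lemma left_form_left_field:
  "x \<in> tangent_space M \<one> \<Longrightarrow> left_form \<beta> a (left_field G M x a) = \<beta> x"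
  using vector_fields_tangent[OF left_field_vector_field]
  by (simp add: left_form_apply pushforward_inv_left_field)

text \<open>Expanding the translated vector in the frame makes the pairing with a field a sum of
  smooth coordinate functions with the constant weights \<open>\<beta> (d b)\<close>.\<close>

lemma left_form_one_form:
  assumes \<beta>: "\<beta> \<in> dual (tangent_space M \<one>)"
  shows "left_form \<beta> \<in> one_forms M"
proof -
  let ?I = "onb (model M)"
  obtain u d where u: "\<And>b. b \<in> ?I \<Longrightarrow> u b \<in> smooth_functions M"
    and d: "\<And>b. b \<in> ?I \<Longrightarrow> d b \<in> tangent_space M \<one>"
    and frame: "\<And>x. x \<in> tangent_space M \<one> \<Longrightarrow> x = (\<Sum>b\<in>?I. x (u b) *\<^sub>R d b)"
    using lie_algebra_frame by blast
  have "left_form \<beta> a \<in> dual (tangent_space M a)" for a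
    using subspace_add[OF subspace_tangent_space] subspace_scale[OF subspace_tangent_space]
    by (intro dualI) (auto simp: left_form_def pullback_def pushforward_add pushforward_scaleR
        pushforward_inv_tangent dual_add[OF \<beta>] dual_scaleR[OF \<beta>])
  moreover have "(\<lambda>a. left_form \<beta> a (Z a)) \<in> smooth_functions M" if Z: "Z \<in> vector_fields M" for Z
  proof -
    have "left_form \<beta> a (Z a) = (\<Sum>b\<in>?I. Z a (\<lambda>q. u b (inv a \<otimes> q)) * \<beta> (d b))" for a
    proof -
      let ?x = "pushforward M (left_translation G (inv a)) (Z a)"
      note T = vector_fields_tangent[OF Z, of a]
      have "\<beta> ?x = \<beta> (\<Sum>b\<in>?I. ?x (u b) *\<^sub>R d b)"
        using frame[OF pushforward_inv_tangent[OF T]] by simp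
      also have "\<dots> = (\<Sum>b\<in>?I. ?x (u b) *\<^sub>R \<beta> (d b))"
        using \<beta> d by (intro linear_on_sum[OF subspace_tangent_space]) (auto simp: dual_def)
      finally show ?thesis using u by (simp add: left_form_apply[OF T] pushforward_apply)
    qed
    moreover have "(\<lambda>a. Z a (\<lambda>q. u b (inv a \<otimes> q))) \<in> smooth_functions M" if "b \<in> ?I" for b
      using smooth_partial_derivation[OF manifold manifold smooth_functions_left_div[OF u[OF that]]
          smooth_map_ident[OF manifold] vector_fields_tangent[OF Z] vector_fields_smooth[OF Z]]
      by simp
    ultimately show ?thesis
      by (simp add: smooth_functions_sum smooth_functions_mult smooth_functions_const)
  qed
  ultimately show ?thesis by (simp add: one_forms_def cotangent_space_def)
qed

text \<open>Dual to \<open>vector_fields_induct\<close>. The coefficients are now the values of the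
  form on the left invariant frame, which are smooth by the definition of a 1-form.\<close>

lemma one_forms_induct [consumes 1, case_names left add scaleR]:
  assumes \<xi>: "\<xi> \<in> one_forms M"
    and left: "\<And>\<beta>. \<beta> \<in> dual (tangent_space M \<one>) \<Longrightarrow> P (left_form \<beta>)"
    and add: "\<And>\<xi> \<eta>. \<xi> \<in> one_forms M \<Longrightarrow> \<eta> \<in> one_forms M \<Longrightarrow> P \<xi> \<Longrightarrow> P \<eta> \<Longrightarrow> P (\<lambda>p. \<xi> p + \<eta> p)"
    and scaleR: "\<And>f \<xi>. f \<in> smooth_functions M \<Longrightarrow> \<xi> \<in> one_forms M \<Longrightarrow> P \<xi> \<Longrightarrow> P (\<lambda>p. f p *\<^sub>R \<xi> p)"
  shows "P \<xi>"
proof -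
  let ?I = "onb (model M)"
  obtain u d where u: "\<And>b. b \<in> ?I \<Longrightarrow> u b \<in> smooth_functions M"
    and d: "\<And>b. b \<in> ?I \<Longrightarrow> d b \<in> tangent_space M \<one>"
    and frame: "\<And>x. x \<in> tangent_space M \<one> \<Longrightarrow> x = (\<Sum>b\<in>?I. x (u b) *\<^sub>R d b)"
    using lie_algebra_frame by blast
  define c where "c = (\<lambda>b a. \<xi> a (left_field G M (d b) a))"
  \<comment> \<open>The coordinate functionals of the frame, set to 0 off the Lie algebra so that
    they belong to \<open>dual\<close>.\<close>
  define \<epsilon> where "\<epsilon> = (\<lambda>b x. if x \<in> tangent_space M \<one> then x (u b) else 0)"
  have c: "c b \<in> smooth_functions M" if "b \<in> ?I" for b
    unfolding c_def by (rule one_forms_smooth[OF \<xi> left_field_vector_field[OF d[OF that]]])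
  have \<epsilon>: "\<epsilon> b \<in> dual (tangent_space M \<one>)" for b
    using subspace_add[OF subspace_tangent_space] subspace_scale[OF subspace_tangent_space]
    by (intro dualI) (auto simp: \<epsilon>_def scaleR_fun_apply)
  have eq: "\<xi> a = (\<Sum>b\<in>?I. c b a *\<^sub>R left_form (\<epsilon> b) a)" for a
  proof
    fix v
    show "\<xi> a v = (\<Sum>b\<in>?I. c b a *\<^sub>R left_form (\<epsilon> b) a) v"
    proof (cases "v \<in> tangent_space M a")
      case T: True
      let ?x = "pushforward M (left_translation G (inv a)) v"
      note x = pushforward_inv_tangent[OF T]
      have "v = left_field G M ?x a" using left_field_pushforward_inv[OF T] by simp
      also have "\<dots> = pushforward M (left_translation G a) (\<Sum>b\<in>?I. ?x (u b) *\<^sub>R d b)"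
        using frame[OF x] by (simp add: left_field_def)
      also have "\<dots> = (\<Sum>b\<in>?I. ?x (u b) *\<^sub>R left_field G M (d b) a)"
        by (simp add: pushforward_sum pushforward_scaleR left_field_def)
      finally have "\<xi> a v = \<xi> a (\<Sum>b\<in>?I. ?x (u b) *\<^sub>R left_field G M (d b) a)" by simp
      also have "\<dots> = (\<Sum>b\<in>?I. ?x (u b) *\<^sub>R c b a)"
        unfolding c_def using one_forms_dual[OF \<xi>] d
        by (intro linear_on_sum[OF subspace_tangent_space])
          (auto simp: dual_def vector_fields_tangent[OF left_field_vector_field])
      also have "\<dots> = (\<Sum>b\<in>?I. c b a *\<^sub>R left_form (\<epsilon> b) a) v"
        using x by (simp add: sum_fun_apply scaleR_fun_def left_form_apply[OF T] \<epsilon>_def mult.commute)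
      finally show ?thesis .
    next
      case False
      then show ?thesis
        by (simp add: sum_fun_apply scaleR_fun_def left_form_def pullback_def dual_off[OF one_forms_dual[OF \<xi>]])
    qed
  qed
  have zero: "P (\<lambda>p. 0)"
  proof -
    have "left_form 0 = (\<lambda>p. 0)" by (auto simp: left_form_def pullback_def fun_eq_iff)
    then show ?thesis using left[OF subspace_0[OF subspace_dual]] by simp
  qed
  have "P (\<lambda>a. \<Sum>b\<in>J. c b a *\<^sub>R left_form (\<epsilon> b) a)" if "J \<subseteq> ?I" for J
    using finite_subset[OF that finite_onb[OF subspace_model]] that
  proof (induction J rule: finite_induct)
    case empty
    show ?case unfolding sum.empty by (rule zero)
  next
    case (insert b J)
    then have b: "b \<in> ?I" and J: "J \<subseteq> ?I" by auto
    have bv: "(\<lambda>a. c b a *\<^sub>R left_form (\<epsilon> b) a) \<in> one_forms M" if "b \<in> ?I" for b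
      by (intro one_forms_scaleR c left_form_one_form \<epsilon> that)
    have "P (\<lambda>a. c b a *\<^sub>R left_form (\<epsilon> b) a + (\<Sum>b\<in>J. c b a *\<^sub>R left_form (\<epsilon> b) a))"
      using J by (intro add bv one_forms_sum scaleR c left left_form_one_form \<epsilon> b insert.IH) auto
    then show ?case unfolding sum.insert[OF insert.hyps] .
  qed
  moreover have "\<xi> = (\<lambda>a. \<Sum>b\<in>?I. c b a *\<^sub>R left_form (\<epsilon> b) a)" using eq by (rule ext)
  ultimately show ?thesis by simp
qed

end

section \<open>The Courant bracket\<close>

lemma endos_add: "J \<in> endos V \<Longrightarrow> u \<in> V \<Longrightarrow> v \<in> V \<Longrightarrow> J (u + v) = J u + J v"
  and endos_scaleR: "J \<in> endos V \<Longrightarrow> u \<in> V \<Longrightarrow> J (c *\<^sub>R u) = c *\<^sub>R J u"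
  and endos_mem: "J \<in> endos V \<Longrightarrow> u \<in> V \<Longrightarrow> J u \<in> V"
  and endos_off: "J \<in> endos V \<Longrightarrow> u \<notin> V \<Longrightarrow> J u = 0"
  by (auto simp: endos_def linear_on_def)

lemma endos_uminus: "J \<in> endos V \<Longrightarrow> u \<in> V \<Longrightarrow> J (- u) = - J u"
  using endos_scaleR[of J V u "-1"] by simp

lemma endos_diff:
  "J \<in> endos V \<Longrightarrow> subspace V \<Longrightarrow> u \<in> V \<Longrightarrow> v \<in> V \<Longrightarrow> J (u - v) = J u - J v"
  using endos_add[of J V u "- v"] endos_uminus[of J V v] subspace_neg by auto

lemma dual_uminus: "\<alpha> \<in> dual V \<Longrightarrow> v \<in> V \<Longrightarrow> \<alpha> (- v) = - \<alpha> v"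
  using dual_scaleR[of \<alpha> V v "-1"] by simp

context smooth_manifold
begin

lemma contract_smooth:
  "X \<in> vector_fields M \<Longrightarrow> \<xi> \<in> one_forms M \<Longrightarrow> contract X \<xi> \<in> smooth_functions M"
  using one_forms_smooth[of \<xi> X] by (simp add: contract_def)

lemma exterior_deriv_apply: "v \<in> tangent_space M p \<Longrightarrow> exterior_deriv M f p v = v f"
  by (simp add: exterior_deriv_def)

lemma exterior_deriv_one_form:
  assumes "f \<in> smooth_functions M"
  shows "exterior_deriv M f \<in> one_forms M"
proof -
  have "exterior_deriv M f p \<in> dual (tangent_space M p)" for p
    using subspace_add[OF subspace_tangent_space] subspace_scale[OF subspace_tangent_space]
    by (intro dualI) (auto simp: exterior_deriv_def scaleR_fun_apply)
  then show ?thesis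
    using assms by (simp add: one_forms_def cotangent_space_def exterior_deriv_apply
        vector_fields_tangent vector_fields_smooth)
qed

text \<open>The right-hand side of the formula that determines \<open>(L\<^sub>X \<eta>)(Z)\<close>. It is linear in \<open>Z\<close> over
  the smooth functions, which is why such a 1-form exists.\<close>

definition cartan :: "('m \<Rightarrow> 'm tvec) \<Rightarrow> ('m \<Rightarrow> 'm covec) \<Rightarrow> ('m \<Rightarrow> 'm tvec) \<Rightarrow> 'm \<Rightarrow> real" where
  "cartan X \<eta> Z p = X p (contract Z \<eta>) - \<eta> p (field_bracket M X Z p)"

lemma cartan_smooth:
  assumes "X \<in> vector_fields M" "\<eta> \<in> one_forms M" "Z \<in> vector_fields M"
  shows "cartan X \<eta> Z \<in> smooth_functions M"
  unfolding cartan_def[abs_def]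
  by (rule smooth_functions_diff[OF vector_fields_smooth[OF assms(1) contract_smooth[OF assms(3,2)]]
        one_forms_smooth[OF assms(2) field_bracket_vector_field[OF assms(1,3)]]])

lemma cartan_add_right:
  assumes "X \<in> vector_fields M" "\<eta> \<in> one_forms M" "Y \<in> vector_fields M" "Z \<in> vector_fields M"
  shows "cartan X \<eta> (\<lambda>p. Y p + Z p) p = cartan X \<eta> Y p + cartan X \<eta> Z p"
proof -
  have "contract (\<lambda>p. Y p + Z p) \<eta> = (\<lambda>p. contract Y \<eta> p + contract Z \<eta> p)"
    using assms by (simp add: contract_def dual_add[OF one_forms_dual] vector_fields_tangent)
  then have "X p (contract (\<lambda>p. Y p + Z p) \<eta>) = X p (contract Y \<eta>) + X p (contract Z \<eta>)"
    using tangent_add[OF vector_fields_tangent[OF assms(1)] contract_smooth[OF assms(3,2)]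
        contract_smooth[OF assms(4,2)]] by simp
  moreover have "\<eta> p (field_bracket M X (\<lambda>p. Y p + Z p) p) =
      \<eta> p (field_bracket M X Y p) + \<eta> p (field_bracket M X Z p)"
    unfolding field_bracket_add_right[OF assms(1,3,4)]
    by (rule dual_add[OF one_forms_dual[OF assms(2)]])
      (intro vector_fields_tangent field_bracket_vector_field assms)+
  ultimately show ?thesis by (simp add: cartan_def)
qed

text \<open>The term X(f) \<eta>(Z) arises twice, from differentiating the pairing and from the
  bracket [X, fZ], and cancels.\<close>

lemma cartan_scaleR_right:
  assumes "X \<in> vector_fields M" "\<eta> \<in> one_forms M" "Z \<in> vector_fields M" "f \<in> smooth_functions M"
  shows "cartan X \<eta> (\<lambda>p. f p *\<^sub>R Z p) p = f p * cartan X \<eta> Z p"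
proof -
  note Zp = vector_fields_tangent[OF assms(3)]
  note b = vector_fields_tangent[OF field_bracket_vector_field[OF assms(1,3)]]
  have "contract (\<lambda>p. f p *\<^sub>R Z p) \<eta> = (\<lambda>p. f p * contract Z \<eta> p)"
    by (simp add: contract_def dual_scaleR[OF one_forms_dual[OF assms(2)] Zp])
  then have "X p (contract (\<lambda>p. f p *\<^sub>R Z p) \<eta>) = f p * X p (contract Z \<eta>) + \<eta> p (Z p) * X p f"
    using tangent_mult[OF vector_fields_tangent[OF assms(1)] assms(4) contract_smooth[OF assms(3,2)]]
    by (simp add: contract_def)
  moreover have "\<eta> p (field_bracket M X (\<lambda>p. f p *\<^sub>R Z p) p) =
      f p * \<eta> p (field_bracket M X Z p) + X p f * \<eta> p (Z p)"
    unfolding field_bracket_scaleR_right[OF assms(1,3,4)]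
    by (simp only: dual_add[OF one_forms_dual[OF assms(2)] subspace_scale[OF subspace_tangent_space b]
          subspace_scale[OF subspace_tangent_space Zp]] dual_scaleR[OF one_forms_dual[OF assms(2)] b]
        dual_scaleR[OF one_forms_dual[OF assms(2)] Zp])
  ultimately show ?thesis by (simp add: cartan_def algebra_simps)
qed

end

context lie_group
begin

lemma covector_eqI:
  assumes "\<alpha> \<in> dual (tangent_space M p)" "\<beta> \<in> dual (tangent_space M p)"
    and "\<And>Z. Z \<in> vector_fields M \<Longrightarrow> \<alpha> (Z p) = \<beta> (Z p)"
  shows "\<alpha> = \<beta>"
proof
  fix v
  show "\<alpha> v = \<beta> v"
  proof (cases "v \<in> tangent_space M p")
    case True
    then show ?thesis using tangent_extension assms(3) by metis
  qed (use assms in \<open>simp add: dual_off\<close>)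
qed

text \<open>The value on a tangent vector is defined through its left invariant extension. The
  formula then holds for left invariant fields by construction, and for all others because both
  sides are linear over the smooth functions.\<close>

lemma lie_deriv_exists:
  assumes X: "X \<in> vector_fields M" and \<eta>: "\<eta> \<in> one_forms M"
  shows "\<exists>\<zeta>\<in>one_forms M. \<forall>Z\<in>vector_fields M. \<forall>p. \<zeta> p (Z p) = cartan X \<eta> Z p"
proof -
  define ext where "ext = (\<lambda>p v. left_field G M (pushforward M (left_translation G (inv p)) v))"
  define \<zeta> where "\<zeta> = (\<lambda>p v. if v \<in> tangent_space M p then cartan X \<eta> (ext p v) p else 0)"
  have ext: "ext p v \<in> vector_fields M" if "v \<in> tangent_space M p" for p v
    unfolding ext_def by (intro left_field_vector_field pushforward_inv_tangent that)
  have ext_add: "ext p (v + w) = (\<lambda>q. ext p v q + ext p w q)"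
    and ext_scaleR: "ext p (c *\<^sub>R v) = (\<lambda>q. c *\<^sub>R ext p v q)" for p v w c
    by (simp_all add: ext_def fun_eq_iff[of "left_field G M _"] pushforward_add pushforward_scaleR
        left_field_add left_field_scaleR)
  have \<zeta>: "\<zeta> p \<in> dual (tangent_space M p)" for p
  proof (rule dualI)
    fix v w assume v: "v \<in> tangent_space M p" and w: "w \<in> tangent_space M p"
    show "\<zeta> p (v + w) = \<zeta> p v + \<zeta> p w"
      using v w subspace_add[OF subspace_tangent_space v w]
      by (simp add: \<zeta>_def ext_add cartan_add_right[OF X \<eta> ext[OF v] ext[OF w]])
  next
    fix c v assume v: "v \<in> tangent_space M p"
    show "\<zeta> p (c *\<^sub>R v) = c * \<zeta> p v"
      using v subspace_scale[OF subspace_tangent_space v]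
      by (simp add: \<zeta>_def ext_scaleR cartan_scaleR_right[OF X \<eta> ext[OF v] smooth_functions_const])
  qed (simp add: \<zeta>_def)
  have eval: "\<forall>p. \<zeta> p (Z p) = cartan X \<eta> Z p" if "Z \<in> vector_fields M" for Z
    using that
  proof (induction Z rule: vector_fields_induct)
    case (left x)
    show ?case
      using left vector_fields_tangent[OF left_field_vector_field[OF left]]
      by (simp add: \<zeta>_def ext_def pushforward_inv_left_field)
  next
    case (add Y Z)
    show ?case
    proof
      fix p
      show "\<zeta> p (Y p + Z p) = cartan X \<eta> (\<lambda>p. Y p + Z p) p"
        unfolding cartan_add_right[OF X \<eta> add(1,2)]
          dual_add[OF \<zeta> vector_fields_tangent[OF add(1)] vector_fields_tangent[OF add(2)]]
        using add(3,4) by simp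
    qed
  next
    case (scaleR f Z)
    then show ?case
      by (simp add: dual_scaleR[OF \<zeta>] vector_fields_tangent cartan_scaleR_right[OF X \<eta>])
  qed
  have "\<zeta> \<in> one_forms M"
    using \<zeta> eval cartan_smooth[OF X \<eta>] by (simp add: one_forms_def cotangent_space_def)
  then show ?thesis using eval by blast
qed

text \<open>Justifies the definite description in \<open>lie_deriv\<close>. Uniqueness holds because
  every tangent vector is the value of some vector field and covectors are 0 off the tangent
  space.\<close>

lemma
  assumes X: "X \<in> vector_fields M" and \<eta>: "\<eta> \<in> one_forms M"
  shows lie_deriv_one_form: "lie_deriv M X \<eta> \<in> one_forms M"
    and lie_deriv_apply: "Z \<in> vector_fields M \<Longrightarrow> lie_deriv M X \<eta> p (Z p) = cartan X \<eta> Z p"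
proof -
  have "\<exists>!\<zeta>. \<zeta> \<in> one_forms M \<and> (\<forall>Z \<in> vector_fields M. \<forall>p. \<zeta> p (Z p) = cartan X \<eta> Z p)"
  proof (rule ex_ex1I)
    fix \<zeta> \<zeta>'
    assume *: "\<zeta> \<in> one_forms M \<and> (\<forall>Z \<in> vector_fields M. \<forall>p. \<zeta> p (Z p) = cartan X \<eta> Z p)"
      "\<zeta>' \<in> one_forms M \<and> (\<forall>Z \<in> vector_fields M. \<forall>p. \<zeta>' p (Z p) = cartan X \<eta> Z p)"
    show "\<zeta> = \<zeta>'"
    proof
      show "\<zeta> p = \<zeta>' p" for p
        using * by (intro covector_eqI[of _ p]) (auto intro: one_forms_dual)
    qed
  qed (use lie_deriv_exists[OF X \<eta>] in blast)
  from theI'[OF this]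
  have *: "lie_deriv M X \<eta> \<in> one_forms M \<and>
      (\<forall>Z \<in> vector_fields M. \<forall>p. lie_deriv M X \<eta> p (Z p) = cartan X \<eta> Z p)"
    unfolding lie_deriv_def cartan_def .
  then show "lie_deriv M X \<eta> \<in> one_forms M" by blast
  show "lie_deriv M X \<eta> p (Z p) = cartan X \<eta> Z p" if "Z \<in> vector_fields M"
    using * that by blast
qed

section \<open>Components of the Courant bracket and its failure of the Leibniz rule\<close>

lemma fst_courant:
  "fst (courant M A B p) = field_bracket M (\<lambda>q. fst (A q)) (\<lambda>q. fst (B q)) p"
  by (simp add: courant_def Let_def o_def)

lemma
  assumes A: "A \<in> gen_sections M" and B: "B \<in> gen_sections M"
  shows courant_gen_space: "courant M A B p \<in> gen_space M p"
    and snd_courant_apply: "Z \<in> vector_fields M \<Longrightarrow> snd (courant M A B p) (Z p) =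
      cartan (\<lambda>q. fst (A q)) (\<lambda>q. snd (B q)) Z p - cartan (\<lambda>q. fst (B q)) (\<lambda>q. snd (A q)) Z p -
      (1/2) * (Z p (\<lambda>q. snd (B q) (fst (A q))) - Z p (\<lambda>q. snd (A q) (fst (B q))))"
proof -
  note X = gen_sections_fst[OF A] and \<xi> = gen_sections_snd[OF A]
  note Y = gen_sections_fst[OF B] and \<eta> = gen_sections_snd[OF B]
  let ?h = "contract (\<lambda>q. fst (A q)) (\<lambda>q. snd (B q)) - contract (\<lambda>q. fst (B q)) (\<lambda>q. snd (A q))"
  have h: "?h \<in> smooth_functions M"
    unfolding fun_diff_def by (intro smooth_functions_diff contract_smooth X \<xi> Y \<eta>)
  have snd_eq: "snd (courant M A B p) = lie_deriv M (\<lambda>q. fst (A q)) (\<lambda>q. snd (B q)) p -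
      lie_deriv M (\<lambda>q. fst (B q)) (\<lambda>q. snd (A q)) p - (1/2) *\<^sub>R exterior_deriv M ?h p"
    by (simp add: courant_def Let_def o_def)
  have "fst (courant M A B p) \<in> tangent_space M p"
    unfolding fst_courant by (intro vector_fields_tangent field_bracket_vector_field X Y)
  moreover have "snd (courant M A B p) \<in> cotangent_space M p"
    unfolding snd_eq
    by (intro subspace_diff[OF subspace_cotangent_space] subspace_scale[OF subspace_cotangent_space]
        one_forms_cotangent lie_deriv_one_form exterior_deriv_one_form X \<xi> Y \<eta> h)
  ultimately show "courant M A B p \<in> gen_space M p" by (simp add: gen_space_def mem_Times_iff)
  assume Z: "Z \<in> vector_fields M"
  have "Z p ?h = Z p (\<lambda>q. snd (B q) (fst (A q))) - Z p (\<lambda>q. snd (A q) (fst (B q)))"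
    using tangent_diff[OF vector_fields_tangent[OF Z] contract_smooth[OF X \<eta>] contract_smooth[OF Y \<xi>]]
    by (simp add: fun_diff_def contract_def)
  then show "snd (courant M A B p) (Z p) =
      cartan (\<lambda>q. fst (A q)) (\<lambda>q. snd (B q)) Z p - cartan (\<lambda>q. fst (B q)) (\<lambda>q. snd (A q)) Z p -
      (1/2) * (Z p (\<lambda>q. snd (B q) (fst (A q))) - Z p (\<lambda>q. snd (A q) (fst (B q))))"
    unfolding snd_eq
    by (simp add: lie_deriv_apply[OF X \<eta> Z] lie_deriv_apply[OF Y \<xi> Z] scaleR_fun_apply
        exterior_deriv_apply[OF vector_fields_tangent[OF Z]])
qed

lemma gen_space_eqI:
  assumes "u \<in> gen_space M p" "v \<in> gen_space M p" "fst u = fst v"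
    and "\<And>Z. Z \<in> vector_fields M \<Longrightarrow> snd u (Z p) = snd v (Z p)"
  shows "u = v"
proof (rule prod_eqI[OF assms(3)])
  show "snd u = snd v"
    using assms by (intro covector_eqI[of _ p]) (auto simp: gen_space_def cotangent_space_def)
qed

lemma courant_swap:
  assumes A: "A \<in> gen_sections M" and B: "B \<in> gen_sections M"
  shows "courant M A B p = - courant M B A p"
proof (rule gen_space_eqI[of _ p])
  show "courant M A B p \<in> gen_space M p" by (rule courant_gen_space[OF A B])
  show "- courant M B A p \<in> gen_space M p"
    using subspace_neg[OF subspace_gen_space courant_gen_space[OF B A]] .
  show "fst (courant M A B p) = fst (- courant M B A p)"
    by (simp add: fst_courant field_bracket_swap[of "\<lambda>q. fst (A q)"])
  show "snd (courant M A B p) (Z p) = snd (- courant M B A p) (Z p)" if "Z \<in> vector_fields M" for Z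
    by (simp add: snd_courant_apply[OF A B that] snd_courant_apply[OF B A that] field_simps)
qed

lemma cartan_add_left:
  assumes "X \<in> vector_fields M" "Y \<in> vector_fields M" "\<eta> \<in> one_forms M" "Z \<in> vector_fields M"
  shows "cartan (\<lambda>p. X p + Y p) \<eta> Z p = cartan X \<eta> Z p + cartan Y \<eta> Z p"
proof -
  have "field_bracket M (\<lambda>p. X p + Y p) Z p = field_bracket M X Z p + field_bracket M Y Z p"
    using field_bracket_add_right[OF assms(4,1,2)] by (simp add: field_bracket_swap[of _ Z])
  moreover have "\<eta> p (field_bracket M X Z p + field_bracket M Y Z p) =
      \<eta> p (field_bracket M X Z p) + \<eta> p (field_bracket M Y Z p)"
    by (rule dual_add[OF one_forms_dual[OF assms(3)]])
      (intro vector_fields_tangent field_bracket_vector_field assms)+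
  ultimately show ?thesis by (simp add: cartan_def)
qed

text \<open>The rule L_{fX} \<eta> = f L_X \<eta> + \<eta>(X) df, evaluated on Z. The extra term
  comes from [fX, Z] = f [X, Z] - Z(f) X.\<close>

lemma cartan_scaleR_left:
  assumes X: "X \<in> vector_fields M" and \<eta>: "\<eta> \<in> one_forms M" and Z: "Z \<in> vector_fields M"
    and f: "f \<in> smooth_functions M"
  shows "cartan (\<lambda>p. f p *\<^sub>R X p) \<eta> Z p = f p * cartan X \<eta> Z p + Z p f * \<eta> p (X p)"
proof -
  note b = vector_fields_tangent[OF field_bracket_vector_field[OF Z X]] and Xp = vector_fields_tangent[OF X]
  note d = one_forms_dual[OF \<eta>] and sc = subspace_scale[OF subspace_tangent_space]
  have "\<eta> p (field_bracket M (\<lambda>p. f p *\<^sub>R X p) Z p) =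
      - \<eta> p (f p *\<^sub>R field_bracket M Z X p + Z p f *\<^sub>R X p)"
    unfolding field_bracket_swap[of _ Z] field_bracket_scaleR_right[OF Z X f]
    by (rule dual_uminus[OF d]) (intro subspace_add[OF subspace_tangent_space] sc b Xp)
  also have "\<dots> = - (f p * \<eta> p (field_bracket M Z X p) + Z p f * \<eta> p (X p))"
    by (simp only: dual_add[OF d sc[OF b] sc[OF Xp]] dual_scaleR[OF d b] dual_scaleR[OF d Xp])
  also have "\<eta> p (field_bracket M Z X p) = - \<eta> p (field_bracket M X Z p)"
    unfolding field_bracket_swap[of Z X]
    by (rule dual_uminus[OF d vector_fields_tangent[OF field_bracket_vector_field[OF X Z]]])
  finally show ?thesis by (simp add: cartan_def scaleR_fun_apply[of _ _ "contract Z \<eta>"] algebra_simps)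
qed

lemma cartan_add_form:
  assumes "X \<in> vector_fields M" "\<eta> \<in> one_forms M" "\<zeta> \<in> one_forms M" "Z \<in> vector_fields M"
  shows "cartan X (\<lambda>p. \<eta> p + \<zeta> p) Z p = cartan X \<eta> Z p + cartan X \<zeta> Z p"
  using tangent_add[OF vector_fields_tangent[OF assms(1)] contract_smooth[OF assms(4,2)]
      contract_smooth[OF assms(4,3)]]
  by (simp add: cartan_def contract_def)

lemma cartan_scaleR_form:
  assumes "X \<in> vector_fields M" "\<eta> \<in> one_forms M" "Z \<in> vector_fields M" "f \<in> smooth_functions M"
  shows "cartan X (\<lambda>p. f p *\<^sub>R \<eta> p) Z p = f p * cartan X \<eta> Z p + X p f * \<eta> p (Z p)"
  using tangent_mult[OF vector_fields_tangent[OF assms(1)] assms(4) contract_smooth[OF assms(3,2)]]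
  by (simp add: cartan_def contract_def scaleR_fun_apply algebra_simps)

lemma courant_add_right:
  assumes A: "A \<in> gen_sections M" and B: "B \<in> gen_sections M" and C: "C \<in> gen_sections M"
  shows "courant M A (\<lambda>p. B p + C p) p = courant M A B p + courant M A C p"
proof (rule gen_space_eqI[of _ p])
  note sec = gen_sections_fst[OF A] gen_sections_snd[OF A] gen_sections_fst[OF B]
    gen_sections_snd[OF B] gen_sections_fst[OF C] gen_sections_snd[OF C]
  note BC = gen_sections_add[OF B C]
  show "courant M A (\<lambda>p. B p + C p) p \<in> gen_space M p" by (rule courant_gen_space[OF A BC])
  show "courant M A B p + courant M A C p \<in> gen_space M p"
    by (intro subspace_add[OF subspace_gen_space] courant_gen_space A B C)
  show "fst (courant M A (\<lambda>p. B p + C p) p) = fst (courant M A B p + courant M A C p)"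
    by (simp add: fst_courant field_bracket_add_right sec)
  fix Z assume Z: "Z \<in> vector_fields M"
  have "Z p (\<lambda>q. snd (B q) (fst (A q)) + snd (C q) (fst (A q))) =
      Z p (\<lambda>q. snd (B q) (fst (A q))) + Z p (\<lambda>q. snd (C q) (fst (A q)))"
    by (intro tangent_add[OF vector_fields_tangent[OF Z]] one_forms_smooth[OF sec(4) sec(1)]
        one_forms_smooth[OF sec(6) sec(1)])
  moreover have "Z p (\<lambda>q. snd (A q) (fst (B q) + fst (C q))) =
      Z p (\<lambda>q. snd (A q) (fst (B q))) + Z p (\<lambda>q. snd (A q) (fst (C q)))"
    using tangent_add[OF vector_fields_tangent[OF Z] one_forms_smooth[OF sec(2) sec(3)]
        one_forms_smooth[OF sec(2) sec(5)]]
    by (simp add: dual_add[OF one_forms_dual[OF sec(2)]] vector_fields_tangent[OF sec(3)]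
        vector_fields_tangent[OF sec(5)])
  ultimately show "snd (courant M A (\<lambda>p. B p + C p) p) (Z p) =
      snd (courant M A B p + courant M A C p) (Z p)"
    by (simp add: snd_courant_apply[OF A BC Z] snd_courant_apply[OF A B Z] snd_courant_apply[OF A C Z]
        cartan_add_left[OF sec(3,5,2) Z] cartan_add_form[OF sec(1,4,6) Z] algebra_simps)
qed

text \<open>With A = (X, \<xi>) and B = (Y, \<eta>), the term L_{fY} \<xi> contributes -\<xi>(Y) df
  and the exact term contributes -(\<eta>(X) - \<xi>(Y)) df / 2. Together these make -(\<eta>(X) +
  \<xi>(Y)) df / 2, the pairing of A and B times -df.\<close>

lemma courant_scaleR_right:
  assumes A: "A \<in> gen_sections M" and B: "B \<in> gen_sections M" and f: "f \<in> smooth_functions M"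
  shows "courant M A (\<lambda>p. f p *\<^sub>R B p) p = f p *\<^sub>R courant M A B p + fst (A p) f *\<^sub>R B p -
    neutral_pairing (A p) (B p) *\<^sub>R (0, exterior_deriv M f p)"
proof (rule gen_space_eqI[of _ p])
  note sec = gen_sections_fst[OF A] gen_sections_snd[OF A] gen_sections_fst[OF B] gen_sections_snd[OF B]
  note fB = gen_sections_scaleR[OF f B]
  show "courant M A (\<lambda>p. f p *\<^sub>R B p) p \<in> gen_space M p" by (rule courant_gen_space[OF A fB])
  have "(0, exterior_deriv M f p) \<in> gen_space M p"
    using subspace_0[OF subspace_tangent_space] one_forms_cotangent[OF exterior_deriv_one_form[OF f]]
    by (simp add: gen_space_def)
  then show "f p *\<^sub>R courant M A B p + fst (A p) f *\<^sub>R B p -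
      neutral_pairing (A p) (B p) *\<^sub>R (0, exterior_deriv M f p) \<in> gen_space M p"
    by (intro subspace_add subspace_diff subspace_scale subspace_gen_space courant_gen_space[OF A B]
        gen_sections_gen_space[OF B])
  show "fst (courant M A (\<lambda>p. f p *\<^sub>R B p) p) = fst (f p *\<^sub>R courant M A B p + fst (A p) f *\<^sub>R B p -
      neutral_pairing (A p) (B p) *\<^sub>R (0, exterior_deriv M f p))"
    by (simp add: fst_courant field_bracket_scaleR_right sec f)
  fix Z assume Z: "Z \<in> vector_fields M"
  have "Z p (\<lambda>q. f q * snd (B q) (fst (A q))) =
      f p * Z p (\<lambda>q. snd (B q) (fst (A q))) + snd (B p) (fst (A p)) * Z p f"
    by (intro tangent_mult[OF vector_fields_tangent[OF Z]] f one_forms_smooth[OF sec(4) sec(1)])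
  moreover have "Z p (\<lambda>q. snd (A q) (f q *\<^sub>R fst (B q))) =
      f p * Z p (\<lambda>q. snd (A q) (fst (B q))) + snd (A p) (fst (B p)) * Z p f"
    using tangent_mult[OF vector_fields_tangent[OF Z] f one_forms_smooth[OF sec(2) sec(3)]]
    by (simp add: dual_scaleR[OF one_forms_dual[OF sec(2)] vector_fields_tangent[OF sec(3)]])
  ultimately show "snd (courant M A (\<lambda>p. f p *\<^sub>R B p) p) (Z p) =
      snd (f p *\<^sub>R courant M A B p + fst (A p) f *\<^sub>R B p -
        neutral_pairing (A p) (B p) *\<^sub>R (0, exterior_deriv M f p)) (Z p)"
    by (simp add: snd_courant_apply[OF A fB Z] snd_courant_apply[OF A B Z] scaleR_fun_apply
        cartan_scaleR_left[OF sec(3,2) Z f] cartan_scaleR_form[OF sec(1,4) Z f]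
        exterior_deriv_apply[OF vector_fields_tangent[OF Z]] neutral_pairing_def case_prod_unfold
        field_simps)
qed

lemma courant_uminus_right:
  assumes "A \<in> gen_sections M" "B \<in> gen_sections M"
  shows "courant M A (\<lambda>p. - B p) p = - courant M A B p"
proof -
  have "exterior_deriv M (\<lambda>_. - 1) p = 0"
    by (auto simp: exterior_deriv_def tangent_const)
  then show ?thesis
    using courant_scaleR_right[OF assms smooth_functions_const[of "-1"], of p]
    by (simp add: tangent_const[OF vector_fields_tangent[OF gen_sections_fst[OF assms(1)]]] zero_prod_def[symmetric])
qed

lemma courant_uminus_left:
  assumes "A \<in> gen_sections M" "B \<in> gen_sections M"
  shows "courant M (\<lambda>p. - A p) B p = - courant M A B p"
  using courant_uminus_right[OF assms(2,1)] courant_swap[OF assms]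
    courant_swap[OF gen_sections_uminus[OF assms(1)] assms(2)] by simp

end

section \<open>Left invariant generalized complex structures\<close>

text \<open>\<open>generalized_complex\<close> stripped of involutivity, so that the Nijenhuis
  expression can be shown to be tensorial before integrability is known.\<close>

definition generalized_almost_complex ::
  "('m, 'e::euclidean_space) manifold \<Rightarrow> ('m \<Rightarrow> 'm gvec \<Rightarrow> 'm gvec) \<Rightarrow> bool" where
  "generalized_almost_complex M \<J> \<longleftrightarrow>
     (\<forall>p. \<J> p \<in> endos (gen_space M p)) \<and>
     (\<forall>A \<in> gen_sections M. (\<lambda>p. \<J> p (A p)) \<in> gen_sections M) \<and>
     (\<forall>p. \<forall>u \<in> gen_space M p. \<J> p (\<J> p u) = - u) \<and>
     (\<forall>p. \<forall>u \<in> gen_space M p. \<forall>v \<in> gen_space M p.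
        neutral_pairing (\<J> p u) (\<J> p v) = neutral_pairing u v)"

definition nijenhuis ::
  "('m, 'e::euclidean_space) manifold \<Rightarrow> ('m \<Rightarrow> 'm gvec \<Rightarrow> 'm gvec) \<Rightarrow>
    ('m \<Rightarrow> 'm gvec) \<Rightarrow> ('m \<Rightarrow> 'm gvec) \<Rightarrow> 'm \<Rightarrow> 'm gvec" where
  "nijenhuis M \<J> A B p = courant M A B p + \<J> p (courant M (\<lambda>q. \<J> q (A q)) B p) +
     \<J> p (courant M A (\<lambda>q. \<J> q (B q)) p) - courant M (\<lambda>q. \<J> q (A q)) (\<lambda>q. \<J> q (B q)) p"

context smooth_manifold
begin

lemma neutral_pairing_uminus_left:
  assumes "u \<in> gen_space M p" "v \<in> gen_space M p"
  shows "neutral_pairing (- u) v = - neutral_pairing u v"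
  using assms dual_uminus[of "snd v" "tangent_space M p" "fst u"]
  by (auto simp: neutral_pairing_def gen_space_def cotangent_space_def field_simps)

end

context lie_group
begin

context
  fixes \<J>
  assumes gac: "generalized_almost_complex M \<J>"
begin

lemma gac_endos: "\<J> p \<in> endos (gen_space M p)"
  and gac_section: "A \<in> gen_sections M \<Longrightarrow> (\<lambda>p. \<J> p (A p)) \<in> gen_sections M"
  and gac_square: "u \<in> gen_space M p \<Longrightarrow> \<J> p (\<J> p u) = - u"
  and gac_orthogonal: "u \<in> gen_space M p \<Longrightarrow> v \<in> gen_space M p \<Longrightarrow>
    neutral_pairing (\<J> p u) (\<J> p v) = neutral_pairing u v"
  using gac unfolding generalized_almost_complex_def by blast+

text \<open>Orthogonality for the pair \<open>\<J> p u\<close>, \<open>v\<close>, combined with the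
  square being -1.\<close>

lemma gac_skew:
  assumes u: "u \<in> gen_space M p" and v: "v \<in> gen_space M p"
  shows "neutral_pairing u (\<J> p v) = - neutral_pairing (\<J> p u) v"
proof -
  note Ju = endos_mem[OF gac_endos u]
  have "neutral_pairing (\<J> p u) v = neutral_pairing (- u) (\<J> p v)"
    using gac_orthogonal[OF Ju v] by (simp add: gac_square[OF u])
  then show ?thesis
    by (simp add: neutral_pairing_uminus_left[OF u endos_mem[OF gac_endos v]])
qed

text \<open>The bracket is skew and the two middle terms change places. Linearity thereby passes
  from the second argument to the first.\<close>

lemma nijenhuis_swap:
  assumes A: "A \<in> gen_sections M" and B: "B \<in> gen_sections M"
  shows "nijenhuis M \<J> A B p = - nijenhuis M \<J> B A p"
proof -
  note JA = gac_section[OF A] and JB = gac_section[OF B]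
  show ?thesis
    unfolding nijenhuis_def courant_swap[OF A B] courant_swap[OF JA B] courant_swap[OF A JB]
      courant_swap[OF JA JB] endos_uminus[OF gac_endos courant_gen_space[OF B JA]]
      endos_uminus[OF gac_endos courant_gen_space[OF JB A]]
    by (simp add: algebra_simps)
qed

lemma nijenhuis_add_right:
  assumes A: "A \<in> gen_sections M" and B: "B \<in> gen_sections M" and C: "C \<in> gen_sections M"
  shows "nijenhuis M \<J> A (\<lambda>p. B p + C p) p = nijenhuis M \<J> A B p + nijenhuis M \<J> A C p"
proof -
  note JA = gac_section[OF A] and JB = gac_section[OF B] and JC = gac_section[OF C]
  have "(\<lambda>q. \<J> q (B q + C q)) = (\<lambda>q. \<J> q (B q) + \<J> q (C q))"
    using endos_add[OF gac_endos gen_sections_gen_space[OF B] gen_sections_gen_space[OF C]] by (rule ext)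
  then show ?thesis
    by (simp add: nijenhuis_def courant_add_right[OF A B C] courant_add_right[OF JA B C]
        courant_add_right[OF A JB JC] courant_add_right[OF JA JB JC]
        endos_add[OF gac_endos courant_gen_space[OF JA B] courant_gen_space[OF JA C]]
        endos_add[OF gac_endos courant_gen_space[OF A JB] courant_gen_space[OF A JC]])
qed

text \<open>The failure of the Courant bracket to be a derivation in the second argument cancels because
  \<open>\<J>\<close> is orthogonal.\<close>

lemma nijenhuis_scaleR_right:
  assumes A: "A \<in> gen_sections M" and B: "B \<in> gen_sections M" and f: "f \<in> smooth_functions M"
  shows "nijenhuis M \<J> A (\<lambda>p. f p *\<^sub>R B p) p = f p *\<^sub>R nijenhuis M \<J> A B p"
proof -
  note JA = gac_section[OF A] and JB = gac_section[OF B]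
  note Ap = gen_sections_gen_space[OF A, of p] and Bp = gen_sections_gen_space[OF B, of p]
  note E = gac_endos[of p] and V = subspace_gen_space[of p]
  have JfB: "(\<lambda>q. \<J> q (f q *\<^sub>R B q)) = (\<lambda>q. f q *\<^sub>R \<J> q (B q))"
    using endos_scaleR[OF gac_endos gen_sections_gen_space[OF B]] by (rule ext)
  define df :: "'g gvec" where "df = (0, exterior_deriv M f p)"
  have df: "df \<in> gen_space M p"
    using subspace_0[OF subspace_tangent_space] one_forms_cotangent[OF exterior_deriv_one_form[OF f]]
    by (simp add: gen_space_def df_def)
  have J: "\<J> p (r *\<^sub>R u + s *\<^sub>R v - t *\<^sub>R df) = r *\<^sub>R \<J> p u + s *\<^sub>R \<J> p v - t *\<^sub>R \<J> p df"
    if u: "u \<in> gen_space M p" and v: "v \<in> gen_space M p" for r s t u v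
    using subspace_scale[OF V u, of r] subspace_scale[OF V v, of s] subspace_scale[OF V df, of t]
    by (simp add: endos_diff[OF E V] endos_add[OF E] endos_scaleR[OF E] u v df subspace_add[OF V])
  have c1: "courant M A (\<lambda>q. f q *\<^sub>R B q) p = f p *\<^sub>R courant M A B p + fst (A p) f *\<^sub>R B p -
      neutral_pairing (A p) (B p) *\<^sub>R df"
    unfolding df_def by (rule courant_scaleR_right[OF A B f])
  have c2: "\<J> p (courant M (\<lambda>q. \<J> q (A q)) (\<lambda>q. f q *\<^sub>R B q) p) =
      f p *\<^sub>R \<J> p (courant M (\<lambda>q. \<J> q (A q)) B p) + fst (\<J> p (A p)) f *\<^sub>R \<J> p (B p) -
      neutral_pairing (\<J> p (A p)) (B p) *\<^sub>R \<J> p df"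
    unfolding courant_scaleR_right[OF JA B f] df_def[symmetric]
    by (rule J[OF courant_gen_space[OF JA B] Bp])
  have c3: "\<J> p (courant M A (\<lambda>q. f q *\<^sub>R \<J> q (B q)) p) =
      f p *\<^sub>R \<J> p (courant M A (\<lambda>q. \<J> q (B q)) p) - fst (A p) f *\<^sub>R B p +
      neutral_pairing (\<J> p (A p)) (B p) *\<^sub>R \<J> p df"
    unfolding courant_scaleR_right[OF A JB f] df_def[symmetric]
      J[OF courant_gen_space[OF A JB] gen_sections_gen_space[OF JB]] gac_skew[OF Ap Bp] gac_square[OF Bp]
    by simp
  have c4: "courant M (\<lambda>q. \<J> q (A q)) (\<lambda>q. f q *\<^sub>R \<J> q (B q)) p =
      f p *\<^sub>R courant M (\<lambda>q. \<J> q (A q)) (\<lambda>q. \<J> q (B q)) p + fst (\<J> p (A p)) f *\<^sub>R \<J> p (B p) -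
      neutral_pairing (A p) (B p) *\<^sub>R df"
    unfolding courant_scaleR_right[OF JA JB f] df_def[symmetric] gac_orthogonal[OF Ap Bp] ..
  \<comment> \<open>The extra terms cancel in pairs: those with \<open>B p\<close> between c1 and
    c3, those with \<open>\<J> p (B p)\<close> between c2 and c4, those with
    \<open>\<J> p df\<close> between c2 and c3 by skewness, and those with \<open>df\<close> between
    c1 and c4 by orthogonality.\<close>
  show ?thesis
    unfolding nijenhuis_def JfB c1 c2 c3 c4 by (simp add: algebra_simps)
qed

text \<open>Sections of the \<open>i\<close>-eigenbundle have the form \<open>A - i \<J> A\<close>, and the bracket of two of them is
  of this form exactly if the Nijenhuis expression vanishes.\<close>

lemma integrable_iff_nijenhuis:
  "(\<forall>S \<in> cpx_sections M. \<forall>T \<in> cpx_sections M.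
      (\<forall>p. S p \<in> i_eigenspace (gen_space M p) (\<J> p)) \<longrightarrow>
      (\<forall>p. T p \<in> i_eigenspace (gen_space M p) (\<J> p)) \<longrightarrow>
      (\<forall>p. cpx_courant M S T p \<in> i_eigenspace (gen_space M p) (\<J> p))) \<longleftrightarrow>
   (\<forall>A \<in> gen_sections M. \<forall>B \<in> gen_sections M. \<forall>p. nijenhuis M \<J> A B p = 0)"
proof -
  \<comment> \<open>Membership of u + iv amounts to J u = -v and J v = u; the second equation
    follows from the first since J squares to -1.\<close>
  have eig: "(u, v) \<in> i_eigenspace (gen_space M p) (\<J> p) \<longleftrightarrow> u \<in> gen_space M p \<and> v = - \<J> p u"
    for u v p
  proof -
    have "- \<J> p u \<in> gen_space M p" "\<J> p (- \<J> p u) = u" if "u \<in> gen_space M p"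
      using that endos_mem[OF gac_endos that] subspace_neg[OF subspace_gen_space]
        endos_uminus[OF gac_endos endos_mem[OF gac_endos that]] gac_square[OF that]
      by auto
    then show ?thesis by (auto simp: i_eigenspace_def cpx_i_def minus_equation_iff)
  qed
  have key: "cpx_courant M (\<lambda>p. (A p, - \<J> p (A p))) (\<lambda>p. (B p, - \<J> p (B p))) p
        \<in> i_eigenspace (gen_space M p) (\<J> p) \<longleftrightarrow> nijenhuis M \<J> A B p = 0"
    if A: "A \<in> gen_sections M" and B: "B \<in> gen_sections M" for A B p
  proof -
    note JA = gac_section[OF A] and JB = gac_section[OF B]
    let ?a = "courant M A B p" and ?b = "courant M (\<lambda>q. \<J> q (A q)) B p"
      and ?c = "courant M A (\<lambda>q. \<J> q (B q)) p" and ?d = "courant M (\<lambda>q. \<J> q (A q)) (\<lambda>q. \<J> q (B q)) p"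
    note mem = courant_gen_space[OF A B, of p] courant_gen_space[OF JA B, of p]
      courant_gen_space[OF A JB, of p] courant_gen_space[OF JA JB, of p]
    note V = subspace_gen_space[of p] and E = gac_endos[of p]
    \<comment> \<open>Real and imaginary part of the bracket of A - i\<J>A and B - i\<J>B. By
      \<open>eig\<close>, only one real equation between the two parts remains to be compared with
      the Nijenhuis expression.\<close>
    have "cpx_courant M (\<lambda>p. (A p, - \<J> p (A p))) (\<lambda>p. (B p, - \<J> p (B p))) p = (?a - ?d, - (?b + ?c))"
      by (simp add: cpx_courant_def Let_def o_def courant_uminus_right[OF A JB]
          courant_uminus_left[OF JA B] courant_uminus_left[OF JA gen_sections_uminus[OF JB]]
          courant_uminus_right[OF JA JB])
    then have "cpx_courant M (\<lambda>p. (A p, - \<J> p (A p))) (\<lambda>p. (B p, - \<J> p (B p))) p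
        \<in> i_eigenspace (gen_space M p) (\<J> p) \<longleftrightarrow> ?b + ?c = \<J> p (?a - ?d)"
      using subspace_diff[OF V mem(1,4)] by (simp only: eig neg_equal_iff_equal simp_thms)
    \<comment> \<open>Applying \<J> to both sides is reversible, and it moves \<J> onto the mixed
      brackets, where the Nijenhuis expression has it.\<close>
    also have "\<dots> \<longleftrightarrow> \<J> p (?b + ?c) = - (?a - ?d)"
    proof
      assume "?b + ?c = \<J> p (?a - ?d)"
      then show "\<J> p (?b + ?c) = - (?a - ?d)"
        using gac_square[OF subspace_diff[OF V mem(1,4)]] by simp
    next
      assume "\<J> p (?b + ?c) = - (?a - ?d)"
      then have "\<J> p (\<J> p (?b + ?c)) = - \<J> p (?a - ?d)"
        using endos_uminus[OF E subspace_diff[OF V mem(1,4)]] by simp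
      then show "?b + ?c = \<J> p (?a - ?d)"
        by (simp only: gac_square[OF subspace_add[OF V mem(2,3)]] neg_equal_iff_equal)
    qed
    also have "\<dots> \<longleftrightarrow> nijenhuis M \<J> A B p = 0"
      unfolding nijenhuis_def endos_add[OF E mem(2,3)]
      by (simp add: eq_neg_iff_add_eq_0 algebra_simps)
    finally show ?thesis .
  qed
  show ?thesis
  proof (intro iffI ballI allI impI)
    fix A B p
    assume *: "\<forall>S \<in> cpx_sections M. \<forall>T \<in> cpx_sections M.
      (\<forall>p. S p \<in> i_eigenspace (gen_space M p) (\<J> p)) \<longrightarrow>
      (\<forall>p. T p \<in> i_eigenspace (gen_space M p) (\<J> p)) \<longrightarrow>
      (\<forall>p. cpx_courant M S T p \<in> i_eigenspace (gen_space M p) (\<J> p))"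
      and A: "A \<in> gen_sections M" and B: "B \<in> gen_sections M"
    have sec: "(\<lambda>p. (C p, - \<J> p (C p))) \<in> cpx_sections M" if "C \<in> gen_sections M" for C
      using that gen_sections_uminus[OF gac_section[OF that]] by (simp add: cpx_sections_def o_def)
    have "cpx_courant M (\<lambda>p. (A p, - \<J> p (A p))) (\<lambda>p. (B p, - \<J> p (B p))) p
        \<in> i_eigenspace (gen_space M p) (\<J> p)"
      using *[rule_format, OF sec[OF A] sec[OF B]] gen_sections_gen_space[OF A] gen_sections_gen_space[OF B]
      by (simp add: eig)
    then show "nijenhuis M \<J> A B p = 0" using key[OF A B] by blast
  next
    fix S T p
    assume *: "\<forall>A \<in> gen_sections M. \<forall>B \<in> gen_sections M. \<forall>p. nijenhuis M \<J> A B p = 0"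
      and S: "S \<in> cpx_sections M" "\<forall>p. S p \<in> i_eigenspace (gen_space M p) (\<J> p)"
      and T: "T \<in> cpx_sections M" "\<forall>p. T p \<in> i_eigenspace (gen_space M p) (\<J> p)"
    have form: "R = (\<lambda>p. (fst (R p), - \<J> p (fst (R p))))"
      if "\<forall>p. R p \<in> i_eigenspace (gen_space M p) (\<J> p)" for R
    proof
      show "R p = (fst (R p), - \<J> p (fst (R p)))" for p
        using that[rule_format, of p] eig[of "fst (R p)" "snd (R p)" p] by (simp add: prod_eq_iff)
    qed
    have ST: "(\<lambda>p. fst (S p)) \<in> gen_sections M" "(\<lambda>p. fst (T p)) \<in> gen_sections M"
      using S(1) T(1) by (auto simp: cpx_sections_def o_def)
    from key[OF ST, THEN iffD2, OF *[rule_format, OF ST]]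
    show "cpx_courant M S T p \<in> i_eigenspace (gen_space M p) (\<J> p)"
      unfolding form[OF S(2), symmetric] form[OF T(2), symmetric] .
  qed
qed

end

section \<open>Left invariant sections, which trivialize the bundle\<close>

definition left_section :: "'g gvec \<Rightarrow> 'g \<Rightarrow> 'g gvec" where
  "left_section u p = (left_field G M (fst u) p, left_form (snd u) p)"

lemma left_action_left_section: "left_action G M p \<one> u = left_section u p"
  by (simp add: left_action_def left_section_def left_field_def left_form_def case_prod_unfold)

lemma left_section_add: "left_section (u + v) p = left_section u p + left_section v p"
  by (simp add: left_section_def left_field_add left_form_def pullback_add)

lemma left_section_scaleR: "left_section (c *\<^sub>R u) p = c *\<^sub>R left_section u p"
  by (simp add: left_section_def left_field_scaleR left_form_def pullback_scaleR)

lemma left_section_uminus: "left_section (- u) p = - left_section u p"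
  using left_section_scaleR[of "-1" u p] by simp

lemma left_section_diff: "left_section (u - v) p = left_section u p - left_section v p"
  using left_section_add[of u "- v" p] by (simp add: left_section_uminus)

lemma gen_space_oneD:
  assumes "u \<in> gen_space M \<one>"
  shows "fst u \<in> tangent_space M \<one>" "snd u \<in> dual (tangent_space M \<one>)"
  using assms by (auto simp: gen_space_def cotangent_space_def)

lemma left_section_section:
  "u \<in> gen_space M \<one> \<Longrightarrow> left_section u \<in> gen_sections M"
  unfolding left_section_def[abs_def]
  by (intro gen_sectionsI left_field_vector_field left_form_one_form gen_space_oneD)

lemma left_section_gen_space: "u \<in> gen_space M \<one> \<Longrightarrow> left_section u p \<in> gen_space M p"
  by (rule gen_sections_gen_space[OF left_section_section])

lemma left_section_one:
  assumes "u \<in> gen_space M \<one>"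
  shows "left_section u \<one> = u"
proof (rule prod_eqI)
  show "fst (left_section u \<one>) = fst u"
    by (simp add: left_section_def left_field_one gen_space_oneD[OF assms])
  show "snd (left_section u \<one>) = snd u"
  proof
    show "snd (left_section u \<one>) v = snd u v" for v
      by (cases "v \<in> tangent_space M \<one>")
        (simp_all add: left_section_def left_form_def pullback_def pushforward_one
          dual_off[OF gen_space_oneD(2)[OF assms]])
  qed
qed

lemma left_section_pairing:
  assumes "u \<in> gen_space M \<one>" "v \<in> gen_space M \<one>"
  shows "neutral_pairing (left_section u p) (left_section v p) = neutral_pairing u v"
  by (simp add: left_section_def neutral_pairing_def case_prod_unfold left_form_left_field
      gen_space_oneD[OF assms(1)] gen_space_oneD[OF assms(2)])

lemma left_action_section:
  assumes "u \<in> gen_space M \<one>"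
  shows "left_action G M a b (left_section u b) = left_section u (a \<otimes> b)"
proof (rule prod_eqI)
  show "fst (left_action G M a b (left_section u b)) = fst (left_section u (a \<otimes> b))"
    by (simp add: left_action_def left_section_def left_field_def pushforward_pushforward)
  show "snd (left_action G M a b (left_section u b)) = snd (left_section u (a \<otimes> b))"
  proof
    fix v
    show "snd (left_action G M a b (left_section u b)) v = snd (left_section u (a \<otimes> b)) v"
    proof (cases "v \<in> tangent_space M (a \<otimes> b)")
      case True
      have "pushforward M (left_translation G (inv a)) v \<in> tangent_space M b"
        using pushforward_tangent[OF True, of "inv a"] by simp
      then show ?thesis
        using True by (simp add: left_action_def left_section_def pullback_def[of M _ "a \<otimes> b"]
            left_form_apply pushforward_pushforward inv_mult_eq)
    qed (simp add: left_action_def left_section_def pullback_def[of M _ "a \<otimes> b"] left_form_def)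
  qed
qed

text \<open>Reduces claims about the fibre at \<open>p\<close> to the fibre at the identity. The
  vector part is translated back; the covector part is pulled back along translation by
  \<open>p\<close> and set to 0 off the Lie algebra.\<close>

lemma left_section_surj:
  assumes "u \<in> gen_space M p"
  obtains w where "w \<in> gen_space M \<one>" "u = left_section w p"
proof -
  have u: "fst u \<in> tangent_space M p" "snd u \<in> dual (tangent_space M p)"
    using assms by (auto simp: gen_space_def cotangent_space_def)
  define x where "x = pushforward M (left_translation G (inv p)) (fst u)"
  define \<alpha> where "\<alpha> = (\<lambda>y. if y \<in> tangent_space M \<one> then snd u (left_field G M y p) else 0)"
  have x: "x \<in> tangent_space M \<one>" unfolding x_def by (rule pushforward_inv_tangent[OF u(1)])
  note lf = vector_fields_tangent[OF left_field_vector_field]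
  have \<alpha>: "\<alpha> \<in> dual (tangent_space M \<one>)"
    using subspace_add[OF subspace_tangent_space] subspace_scale[OF subspace_tangent_space]
    by (intro dualI) (auto simp: \<alpha>_def left_field_add left_field_scaleR dual_add[OF u(2) lf lf]
        dual_scaleR[OF u(2) lf])
  have "u = left_section (x, \<alpha>) p"
  proof (rule prod_eqI)
    show "fst u = fst (left_section (x, \<alpha>) p)"
      by (simp add: left_section_def x_def left_field_pushforward_inv[OF u(1)])
    show "snd u = snd (left_section (x, \<alpha>) p)"
    proof
      show "snd u v = snd (left_section (x, \<alpha>) p) v" for v
        by (cases "v \<in> tangent_space M p")
          (simp_all add: left_section_def left_form_def pullback_def \<alpha>_def pushforward_inv_tangent
            left_field_pushforward_inv dual_off[OF u(2)])
    qed
  qed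
  then show ?thesis using that[of "(x, \<alpha>)"] x \<alpha> by (simp add: gen_space_def cotangent_space_def)
qed

text \<open>A section is the sum of (X, 0) and (0, \<xi>), and the rules for fields and for forms
  apply to the summands, since (x, 0) and (0, \<beta>) generate left invariant sections of the same
  shape.\<close>

lemma gen_sections_induct [consumes 1, case_names left add scaleR]:
  assumes A: "A \<in> gen_sections M"
    and left: "\<And>u. u \<in> gen_space M \<one> \<Longrightarrow> P (left_section u)"
    and add: "\<And>A B. A \<in> gen_sections M \<Longrightarrow> B \<in> gen_sections M \<Longrightarrow> P A \<Longrightarrow> P B \<Longrightarrow> P (\<lambda>p. A p + B p)"
    and scaleR: "\<And>f A. f \<in> smooth_functions M \<Longrightarrow> A \<in> gen_sections M \<Longrightarrow> P A \<Longrightarrow> P (\<lambda>p. f p *\<^sub>R A p)"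
  shows "P A"
proof -
  have vf: "(\<lambda>p. (X p, 0)) \<in> gen_sections M" if "X \<in> vector_fields M" for X
    by (rule gen_sectionsI[OF that one_forms_zero])
  have form: "(\<lambda>p. (0, \<xi> p)) \<in> gen_sections M" if "\<xi> \<in> one_forms M" for \<xi>
    by (rule gen_sectionsI[OF vector_fields_zero that])
  have T0: "(x, 0) \<in> gen_space M \<one>" if "x \<in> tangent_space M \<one>" for x
    using that subspace_0[OF subspace_cotangent_space] by (simp add: gen_space_def)
  have C0: "(0, \<beta>) \<in> gen_space M \<one>" if "\<beta> \<in> dual (tangent_space M \<one>)" for \<beta>
    using that subspace_0[OF subspace_tangent_space] by (simp add: gen_space_def cotangent_space_def)
  have lf0: "left_form 0 p = 0" for p by (auto simp: left_form_def pullback_def)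
  have X: "P (\<lambda>p. (X p, 0))" if "X \<in> vector_fields M" for X
    using that
  proof (induction X rule: vector_fields_induct)
    case (left x)
    have eq: "left_section (x, 0) = (\<lambda>p. (left_field G M x p, 0))"
      by (rule ext) (simp only: left_section_def fst_conv snd_conv lf0)
    show ?case using assms(2)[OF T0[OF left]] unfolding eq .
  next
    case (add X Y)
    show ?case
      using assms(3)[OF vf[OF add(1)] vf[OF add(2)] add(3,4)] by (simp only: add_Pair add_0_right)
  next
    case (scaleR f X)
    show ?case
      using assms(4)[OF scaleR(1) vf[OF scaleR(2)] scaleR(3)] by (simp only: scaleR_Pair scaleR_zero_right)
  qed
  have \<xi>: "P (\<lambda>p. (0, \<xi> p))" if "\<xi> \<in> one_forms M" for \<xi>
    using that
  proof (induction \<xi> rule: one_forms_induct)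
    case (left \<beta>)
    have eq: "left_section (0, \<beta>) = (\<lambda>p. (0, left_form \<beta> p))"
      by (rule ext) (simp only: left_section_def fst_conv snd_conv left_field_def pushforward_zero)
    show ?case using assms(2)[OF C0[OF left]] unfolding eq .
  next
    case (add \<xi> \<eta>)
    show ?case
      using assms(3)[OF form[OF add(1)] form[OF add(2)] add(3,4)] by (simp only: add_Pair add_0_right)
  next
    case (scaleR f \<xi>)
    show ?case
      using assms(4)[OF scaleR(1) form[OF scaleR(2)] scaleR(3)] by (simp only: scaleR_Pair scaleR_zero_right)
  qed
  note X' = gen_sections_fst[OF A] and \<xi>' = gen_sections_snd[OF A]
  have "P (\<lambda>p. (fst (A p), 0) + (0, snd (A p)))"
    by (rule add[OF vf[OF X'] form[OF \<xi>'] X[OF X'] \<xi>[OF \<xi>']])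
  then show ?thesis by (simp only: add_Pair add_0_right add_0_left prod.collapse)
qed

text \<open>Left invariant derivations commute with translating the function by \<open>p\<close>.
  Evaluating the bracket at \<open>p\<close> on f is thus evaluating it at the identity on f(pb),
  viewed as a function of b.\<close>

lemma left_field_bracket:
  assumes x: "x \<in> tangent_space M \<one>" and y: "y \<in> tangent_space M \<one>"
  shows "field_bracket M (left_field G M x) (left_field G M y) p = left_field G M (lie_bracket G M x y) p"
proof
  fix f
  show "field_bracket M (left_field G M x) (left_field G M y) p f =
      left_field G M (lie_bracket G M x y) p f"
  proof (cases "f \<in> smooth_functions M")
    case f: True
    have smooth: "(\<lambda>q. left_field G M z q h) \<in> smooth_functions M"
      if "z \<in> tangent_space M \<one>" "h \<in> smooth_functions M" for z h
      by (rule vector_fields_smooth[OF left_field_vector_field[OF that(1)] that(2)])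
    note g = smooth_functions_translate[OF f, of p]
    have "left_field G M z p (\<lambda>q. left_field G M w q f) =
        left_field G M z \<one> (\<lambda>q. left_field G M w q (\<lambda>b. f (p \<otimes> b)))"
      if "z \<in> tangent_space M \<one>" "w \<in> tangent_space M \<one>" for z w
      using smooth[OF that(2) f] smooth[OF that(2) g] f g
      by (simp add: left_field_def pushforward_apply mult_assoc smooth_functions_translate)
    then show ?thesis
      using x y f g by (simp add: field_bracket_apply lie_bracket_def left_field_def[of G M "field_bracket M _ _ _"]
          pushforward_apply)
  qed (simp add: field_bracket_def left_field_def pushforward_def)
qed

lemma lie_bracket_tangent:
  "x \<in> tangent_space M \<one> \<Longrightarrow> y \<in> tangent_space M \<one> \<Longrightarrow> lie_bracket G M x y \<in> tangent_space M \<one>"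
  unfolding lie_bracket_def
  by (rule vector_fields_tangent[OF field_bracket_vector_field[OF left_field_vector_field
        left_field_vector_field]])

section \<open>The Lie algebra bracket and its extension to the cotangent algebra\<close>

lemma lie_bracket_add_right:
  "x \<in> tangent_space M \<one> \<Longrightarrow> y \<in> tangent_space M \<one> \<Longrightarrow> z \<in> tangent_space M \<one> \<Longrightarrow>
    lie_bracket G M x (y + z) = lie_bracket G M x y + lie_bracket G M x z"
  unfolding lie_bracket_def ext[of "left_field G M (y + z)", OF left_field_add]
  by (intro field_bracket_add_right left_field_vector_field)

lemma lie_bracket_scaleR_right:
  assumes "x \<in> tangent_space M \<one>" "y \<in> tangent_space M \<one>"
  shows "lie_bracket G M x (c *\<^sub>R y) = c *\<^sub>R lie_bracket G M x y"
  unfolding lie_bracket_def ext[of "left_field G M (c *\<^sub>R y)", OF left_field_scaleR]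
  using field_bracket_scaleR_right[OF left_field_vector_field[OF assms(1)]
      left_field_vector_field[OF assms(2)] smooth_functions_const[of c], of \<one>]
  by (simp only: tangent_const[OF vector_fields_tangent[OF left_field_vector_field[OF assms(1)]]]
      scaleR_zero_left add_0_right)

abbreviation bracket :: "'g gvec \<Rightarrow> 'g gvec \<Rightarrow> 'g gvec" where
  "bracket \<equiv> cotangent_bracket (lie_algebra G M) (lie_bracket G M)"

lemma cotangent_algebra_lie_algebra: "cotangent_algebra (lie_algebra G M) = gen_space M \<one>"
  by (simp add: cotangent_algebra_def lie_algebra_def gen_space_def cotangent_space_def)

lemma bracket_gen_space:
  assumes u: "u \<in> gen_space M \<one>" and v: "v \<in> gen_space M \<one>"
  shows "bracket u v \<in> gen_space M \<one>"
proof -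
  note T = gen_space_oneD[OF u] gen_space_oneD[OF v]
  have "snd (bracket u v) \<in> dual (tangent_space M \<one>)"
  proof (rule dualI)
    fix y z assume yz: "y \<in> tangent_space M \<one>" "z \<in> tangent_space M \<one>"
    show "snd (bracket u v) (y + z) = snd (bracket u v) y + snd (bracket u v) z"
      using yz subspace_add[OF subspace_tangent_space yz] T
      by (simp add: cotangent_bracket_def case_prod_unfold lie_algebra_def lie_bracket_add_right
          dual_add[OF T(2)] dual_add[OF T(4)] lie_bracket_tangent)
  next
    fix c z assume z: "z \<in> tangent_space M \<one>"
    show "snd (bracket u v) (c *\<^sub>R z) = c * snd (bracket u v) z"
      using z subspace_scale[OF subspace_tangent_space z] T
      by (simp add: cotangent_bracket_def case_prod_unfold lie_algebra_def lie_bracket_scaleR_right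
          dual_scaleR[OF T(2)] dual_scaleR[OF T(4)] lie_bracket_tangent algebra_simps)
  qed (simp add: cotangent_bracket_def case_prod_unfold lie_algebra_def)
  then show ?thesis
    using lie_bracket_tangent[OF T(1,3)]
    by (simp add: gen_space_def cotangent_space_def mem_Times_iff cotangent_bracket_def case_prod_unfold)
qed

lemma courant_left_section:
  assumes u: "u \<in> gen_space M \<one>" and v: "v \<in> gen_space M \<one>"
  shows "courant M (left_section u) (left_section v) p = left_section (bracket u v) p"
proof (rule prod_eqI)
  note T = gen_space_oneD[OF u] gen_space_oneD[OF v] gen_space_oneD[OF bracket_gen_space[OF u v]]
  note S = left_section_section[OF u] left_section_section[OF v]
  note vf = left_field_vector_field
  show "fst (courant M (left_section u) (left_section v) p) = fst (left_section (bracket u v) p)"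
    by (simp add: fst_courant left_section_def left_field_bracket[OF T(1,3)] cotangent_bracket_def
        case_prod_unfold)
  show "snd (courant M (left_section u) (left_section v) p) = snd (left_section (bracket u v) p)"
  proof (rule covector_eqI[of _ p])
    show 1: "snd (courant M (left_section u) (left_section v) p) \<in> dual (tangent_space M p)"
      using courant_gen_space[OF S, of p] by (auto simp: gen_space_def cotangent_space_def)
    show 2: "snd (left_section (bracket u v) p) \<in> dual (tangent_space M p)"
      using left_section_gen_space[OF bracket_gen_space[OF u v], of p]
      by (auto simp: gen_space_def cotangent_space_def)
    fix Z assume Z: "Z \<in> vector_fields M"
    \<comment> \<open>Covectors at \<open>p\<close> see only \<open>Z p\<close>, so \<open>Z\<close>
      may be replaced by the left invariant field through that vector. With it all pairings involved
      are constant.\<close>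
    define z where "z = pushforward M (left_translation G (inv p)) (Z p)"
    have z: "z \<in> tangent_space M \<one>"
      unfolding z_def by (rule pushforward_inv_tangent[OF vector_fields_tangent[OF Z]])
    have Zp: "Z p = left_field G M z p"
      by (simp add: z_def left_field_pushforward_inv[OF vector_fields_tangent[OF Z]])
    have const: "left_field G M x p (\<lambda>q. c) = 0" if "x \<in> tangent_space M \<one>" for x c
      by (rule tangent_const[OF vector_fields_tangent[OF vf[OF that]]])
    have ctr: "contract (left_field G M z) (left_form \<beta>) = (\<lambda>q. \<beta> z)" for \<beta>
      by (simp add: contract_def left_form_left_field[OF z])
    have "snd (courant M (left_section u) (left_section v) p) (left_field G M z p) =
        - snd v (lie_bracket G M (fst u) z) + snd u (lie_bracket G M (fst v) z)"
      using T z
      by (simp add: snd_courant_apply[OF S vf[OF z]] left_section_def cartan_def ctr const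
          left_form_left_field left_field_bracket lie_bracket_tangent)
    also have "\<dots> = snd (left_section (bracket u v) p) (left_field G M z p)"
      using z by (simp add: left_section_def left_form_left_field cotangent_bracket_def case_prod_unfold
          lie_algebra_def)
    finally show "snd (courant M (left_section u) (left_section v) p) (Z p) =
        snd (left_section (bracket u v) p) (Z p)"
      unfolding Zp .
  qed
qed

lemma nijenhuis_left_section:
  assumes J: "J \<in> endos (gen_space M \<one>)"
    and left: "\<And>w p. w \<in> gen_space M \<one> \<Longrightarrow> \<J> p (left_section w p) = left_section (J w) p"
    and u: "u \<in> gen_space M \<one>" and v: "v \<in> gen_space M \<one>"
  shows "nijenhuis M \<J> (left_section u) (left_section v) p =
    left_section (bracket u v + J (bracket (J u) v) + J (bracket u (J v)) - bracket (J u) (J v)) p"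
proof -
  note Ju = endos_mem[OF J u] and Jv = endos_mem[OF J v]
  have eq: "(\<lambda>q. \<J> q (left_section w q)) = left_section (J w)" if "w \<in> gen_space M \<one>" for w
    using left[OF that] by (rule ext)
  show ?thesis
    unfolding nijenhuis_def eq[OF u] eq[OF v] courant_left_section[OF u v] courant_left_section[OF Ju v]
      courant_left_section[OF u Jv] courant_left_section[OF Ju Jv]
      left[OF bracket_gen_space[OF Ju v]] left[OF bracket_gen_space[OF u Jv]]
      left_section_add left_section_diff ..
qed

text \<open>Generation by left invariant sections is used twice: once in the second argument with
  the first fixed, and once more after exchanging the arguments, since linearity over functions is
  at hand on the right only.\<close>

lemma nijenhuis_eq_0I:
  assumes gac: "generalized_almost_complex M \<J>"
    and left: "\<And>u v p. u \<in> gen_space M \<one> \<Longrightarrow> v \<in> gen_space M \<one> \<Longrightarrow>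
      nijenhuis M \<J> (left_section u) (left_section v) p = 0"
    and A: "A \<in> gen_sections M" and B: "B \<in> gen_sections M"
  shows "nijenhuis M \<J> A B p = 0"
proof -
  have ext: "nijenhuis M \<J> A B p = 0"
    if A: "A \<in> gen_sections M" and B: "B \<in> gen_sections M"
      and "\<And>v p. v \<in> gen_space M \<one> \<Longrightarrow> nijenhuis M \<J> A (left_section v) p = 0" for A B p
    using B
  proof (induction B arbitrary: p rule: gen_sections_induct)
    case (left v)
    then show ?case by (rule that(3))
  next
    case (add B C)
    then show ?case by (simp add: nijenhuis_add_right[OF gac A])
  next
    case (scaleR f B)
    then show ?case by (simp add: nijenhuis_scaleR_right[OF gac A])
  qed
  show ?thesis
  proof (rule ext[OF A B])
    fix v p assume v: "v \<in> gen_space M \<one>"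
    note S = left_section_section[OF v]
    have "nijenhuis M \<J> (left_section v) A p = 0" by (rule ext[OF S A left[OF v]])
    then show "nijenhuis M \<J> A (left_section v) p = 0" using nijenhuis_swap[OF gac A S] by simp
  qed
qed

lemma left_inv_metric_neutral_pairing:
  "left_inv_metric (gen_space M \<one>) neutral_pairing"
  unfolding left_inv_metric_def
proof (intro conjI ballI impI)
  fix u assume u: "u \<in> gen_space M \<one>"
  note T = gen_space_oneD
  show "linear_on (gen_space M \<one>) (neutral_pairing u)"
    unfolding linear_on_def neutral_pairing_def case_prod_unfold
    using T[OF u]
    by (auto simp: T dual_add[OF T(2)[OF u]] dual_scaleR[OF T(2)[OF u]] scaleR_fun_apply algebra_simps)
  show "neutral_pairing u v = neutral_pairing v u" for v :: "'g gvec"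
    by (simp add: neutral_pairing_def case_prod_unfold)
  assume z: "\<forall>v\<in>gen_space M \<one>. neutral_pairing u v = 0"
  show "u = 0"
  proof (rule prod_eqI)
    show "fst u = fst 0"
    proof
      fix f
      \<comment> \<open>Evaluation at \<open>f\<close> is itself a covector. Pairing with it
        recovers the value of the derivation \<open>fst u\<close> at \<open>f\<close>, so
        nondegeneracy is obtained one function at a time.\<close>
      define \<beta> :: "'g covec" where "\<beta> = (\<lambda>x. if x \<in> tangent_space M \<one> then x f else 0)"
      have "\<beta> \<in> dual (tangent_space M \<one>)"
        using subspace_add[OF subspace_tangent_space] subspace_scale[OF subspace_tangent_space]
        by (intro dualI) (auto simp: \<beta>_def scaleR_fun_apply)
      then have "(0, \<beta>) \<in> gen_space M \<one>"
        using subspace_0[OF subspace_tangent_space] by (simp add: gen_space_def cotangent_space_def)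
      moreover have "snd u 0 = 0"
        using dual_scaleR[OF T(2)[OF u] T(1)[OF u], of 0] by simp
      ultimately show "fst u f = fst 0 f"
        using z T(1)[OF u] by (force simp: neutral_pairing_def case_prod_unfold \<beta>_def)
    qed
    show "snd u = snd 0"
    proof
      fix x
      show "snd u x = snd 0 x"
      proof (cases "x \<in> tangent_space M \<one>")
        case True
        then have "(x, 0) \<in> gen_space M \<one>"
          using subspace_0[OF subspace_cotangent_space] by (simp add: gen_space_def)
        then show ?thesis using z by (force simp: neutral_pairing_def case_prod_unfold)
      qed (simp add: dual_off[OF T(2)[OF u]])
    qed
  qed
qed

section \<open>Passage between the group and the fibre at the identity\<close>

lemma generalized_complex_iff:
  "generalized_complex M \<J> \<longleftrightarrow> generalized_almost_complex M \<J> \<and>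
    (\<forall>A \<in> gen_sections M. \<forall>B \<in> gen_sections M. \<forall>p. nijenhuis M \<J> A B p = 0)"
proof -
  have "generalized_complex M \<J> \<longleftrightarrow> generalized_almost_complex M \<J> \<and>
    (\<forall>S \<in> cpx_sections M. \<forall>T \<in> cpx_sections M.
      (\<forall>p. S p \<in> i_eigenspace (gen_space M p) (\<J> p)) \<longrightarrow>
      (\<forall>p. T p \<in> i_eigenspace (gen_space M p) (\<J> p)) \<longrightarrow>
      (\<forall>p. cpx_courant M S T p \<in> i_eigenspace (gen_space M p) (\<J> p)))"
    unfolding generalized_complex_def generalized_almost_complex_def by (simp only: conj_assoc)
  then show ?thesis using integrable_iff_nijenhuis by blast
qed

lemma left_invariant_section:
  assumes "left_invariant G M \<J>" "u \<in> gen_space M \<one>"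
  shows "\<J> p (left_section u p) = left_section (\<J> \<one> u) p"
  using assms(1)[unfolded left_invariant_def, rule_format, OF assms(2), of p]
  by (simp add: left_action_left_section)

lemma hermitian_of_generalized_complex:
  assumes gc: "generalized_complex M \<J>" and inv: "left_invariant G M \<J>"
  shows "left_inv_hermitian (gen_space M \<one>) bracket (\<J> \<one>) neutral_pairing"
proof -
  have gac: "generalized_almost_complex M \<J>" using gc by (simp add: generalized_complex_iff)
  note E = gac_endos[OF gac, of \<one>]
  have "bracket u v + \<J> \<one> (bracket (\<J> \<one> u) v) + \<J> \<one> (bracket u (\<J> \<one> v)) -
      bracket (\<J> \<one> u) (\<J> \<one> v) = 0" (is "?N = 0")
    if u: "u \<in> gen_space M \<one>" and v: "v \<in> gen_space M \<one>" for u v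
  proof -
    note Ju = endos_mem[OF E u] and Jv = endos_mem[OF E v]
    have "?N \<in> gen_space M \<one>"
      by (intro subspace_add subspace_diff subspace_gen_space endos_mem[OF E] bracket_gen_space u v Ju Jv)
    \<comment> \<open>The expression is an element of the fibre at the identity, hence the value
      there of its own left invariant section, and that section is the Nijenhuis expression of
      \<J>.\<close>
    then have "?N = left_section ?N \<one>" by (rule left_section_one[symmetric])
    also have "\<dots> = nijenhuis M \<J> (left_section u) (left_section v) \<one>"
      by (rule nijenhuis_left_section[OF E left_invariant_section[OF inv] u v, symmetric])
    also have "\<dots> = 0"
      using gc left_section_section[OF u] left_section_section[OF v]
      unfolding generalized_complex_iff by blast
    finally show ?thesis .
  qed
  then show ?thesis
    using E gac_square[OF gac] gac_orthogonal[OF gac] left_inv_metric_neutral_pairing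
    by (simp add: left_inv_hermitian_def left_inv_complex_def)
qed

text \<open>The inverse of evaluation at the identity. The value 0 off the fibre is the convention
  of \<open>endos\<close>, so that structures agreeing on all fibres are equal as HOL
  functions.\<close>

definition left_extension :: "('g gvec \<Rightarrow> 'g gvec) \<Rightarrow> 'g \<Rightarrow> 'g gvec \<Rightarrow> 'g gvec" where
  "left_extension J p u =
     (if u \<in> gen_space M p then left_section (J (left_action G M (inv p) p u)) p else 0)"

lemma left_extension_section:
  assumes "u \<in> gen_space M \<one>"
  shows "left_extension J p (left_section u p) = left_section (J u) p"
  using left_section_gen_space[OF assms]
  by (simp add: left_extension_def left_action_section[OF assms] left_section_one[OF assms])

lemma left_extension_one:
  assumes "J \<in> endos (gen_space M \<one>)"
  shows "left_extension J \<one> = J"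
proof
  fix u
  show "left_extension J \<one> u = J u"
  proof (cases "u \<in> gen_space M \<one>")
    case True
    then show ?thesis
      using left_extension_section[OF True, of J \<one>]
      by (simp add: left_section_one endos_mem[OF assms])
  qed (simp add: left_extension_def endos_off[OF assms])
qed

lemma left_extension_left_invariant:
  assumes J: "J \<in> endos (gen_space M \<one>)"
  shows "left_invariant G M (left_extension J)"
  unfolding left_invariant_def
proof (intro allI ballI)
  fix a b u assume "u \<in> gen_space M b"
  then obtain w where w: "w \<in> gen_space M \<one>" "u = left_section w b" by (rule left_section_surj)
  show "left_extension J (a \<otimes> b) (left_action G M a b u) = left_action G M a b (left_extension J b u)"
    by (simp add: w left_action_section left_extension_section endos_mem[OF J])
qed

lemma left_extension_endos:
  assumes J: "J \<in> endos (gen_space M \<one>)"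
  shows "left_extension J p \<in> endos (gen_space M p)"
  unfolding endos_def linear_on_def
proof (intro CollectI conjI ballI allI impI)
  note ls = left_section_add[symmetric] left_section_scaleR[symmetric]
  fix u assume "u \<in> gen_space M p"
  then obtain w where w: "w \<in> gen_space M \<one>" "u = left_section w p" by (rule left_section_surj)
  show "left_extension J p (c *\<^sub>R u) = c *\<^sub>R left_extension J p u" for c
    using subspace_scale[OF subspace_gen_space w(1)] w(1)
    by (simp add: w(2) ls left_extension_section endos_scaleR[OF J])
  fix v assume "v \<in> gen_space M p"
  then obtain w' where w': "w' \<in> gen_space M \<one>" "v = left_section w' p" by (rule left_section_surj)
  show "left_extension J p (u + v) = left_extension J p u + left_extension J p v"
    using subspace_add[OF subspace_gen_space w(1) w'(1)] w(1) w'(1)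
    by (simp add: w(2) w'(2) ls left_extension_section endos_add[OF J])
next
  show "left_extension J p ` gen_space M p \<subseteq> gen_space M p"
  proof
    fix v assume "v \<in> left_extension J p ` gen_space M p"
    then obtain u where u: "u \<in> gen_space M p" "v = left_extension J p u" by blast
    obtain w where "w \<in> gen_space M \<one>" "u = left_section w p" using u(1) by (rule left_section_surj)
    then show "v \<in> gen_space M p"
      by (simp add: u(2) left_extension_section left_section_gen_space endos_mem[OF J])
  qed
qed (simp add: left_extension_def)

lemma generalized_complex_of_hermitian:
  assumes herm: "left_inv_hermitian (gen_space M \<one>) bracket J neutral_pairing"
  shows "generalized_complex M (left_extension J)"
proof -
  have J: "J \<in> endos (gen_space M \<one>)"
    and square: "\<And>u. u \<in> gen_space M \<one> \<Longrightarrow> J (J u) = - u"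
    and nij: "\<And>u v. u \<in> gen_space M \<one> \<Longrightarrow> v \<in> gen_space M \<one> \<Longrightarrow>
      bracket u v + J (bracket (J u) v) + J (bracket u (J v)) - bracket (J u) (J v) = 0"
    and orth: "\<And>u v. u \<in> gen_space M \<one> \<Longrightarrow> v \<in> gen_space M \<one> \<Longrightarrow>
      neutral_pairing (J u) (J v) = neutral_pairing u v"
    using herm by (auto simp: left_inv_hermitian_def left_inv_complex_def)
  note E = left_extension_endos[OF J]
  \<comment> \<open>Smoothness of the extension: it carries left invariant sections to left
    invariant sections and is linear on each fibre, so the induction rule covers every
    section.\<close>
  have sections: "(\<lambda>p. left_extension J p (A p)) \<in> gen_sections M" if "A \<in> gen_sections M" for A
    using that
  proof (induction A rule: gen_sections_induct)
    case (left u)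
    have "(\<lambda>p. left_extension J p (left_section u p)) = left_section (J u)"
      using left_extension_section[OF left] by (rule ext)
    then show ?case using left_section_section[OF endos_mem[OF J left]] by simp
  next
    case (add A B)
    have "(\<lambda>p. left_extension J p (A p + B p)) = (\<lambda>p. left_extension J p (A p) + left_extension J p (B p))"
      using endos_add[OF E gen_sections_gen_space[OF add(1)] gen_sections_gen_space[OF add(2)]] by (rule ext)
    then show ?case using gen_sections_add[OF add(3,4)] by simp
  next
    case (scaleR f A)
    have "(\<lambda>p. left_extension J p (f p *\<^sub>R A p)) = (\<lambda>p. f p *\<^sub>R left_extension J p (A p))"
      using endos_scaleR[OF E gen_sections_gen_space[OF scaleR(2)]] by (rule ext)
    then show ?case using gen_sections_scaleR[OF scaleR(1,3)] by simp
  qed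
  have gac: "generalized_almost_complex M (left_extension J)"
    unfolding generalized_almost_complex_def
  proof (intro conjI allI ballI)
    fix p u assume "u \<in> gen_space M p"
    then obtain w where w: "w \<in> gen_space M \<one>" "u = left_section w p" by (rule left_section_surj)
    show "left_extension J p (left_extension J p u) = - u"
      by (simp add: w left_extension_section endos_mem[OF J] square left_section_uminus)
    fix v assume "v \<in> gen_space M p"
    then obtain w' where w': "w' \<in> gen_space M \<one>" "v = left_section w' p" by (rule left_section_surj)
    show "neutral_pairing (left_extension J p u) (left_extension J p v) = neutral_pairing u v"
      by (simp add: w w' left_extension_section endos_mem[OF J] left_section_pairing orth)
  qed (use E sections in auto)
  have "left_section 0 p = 0" for p using left_section_scaleR[of 0 0 p] by simp
  then have "nijenhuis M (left_extension J) (left_section u) (left_section v) p = 0"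
    if "u \<in> gen_space M \<one>" "v \<in> gen_space M \<one>" for u v p
    using nijenhuis_left_section[OF J left_extension_section that] nij[OF that] by simp
  then show ?thesis
    using gac nijenhuis_eq_0I[OF gac] by (simp add: generalized_complex_iff)
qed

text \<open>Each vector of a fibre lies on a left invariant section, along which invariance
  prescribes the value; off the fibre both sides are 0. This yields injectivity of the
  correspondence.\<close>

lemma left_invariant_determined:
  assumes "\<And>p. \<J> p \<in> endos (gen_space M p)" "left_invariant G M \<J>"
  shows "\<J> = left_extension (\<J> \<one>)"
proof (intro ext)
  fix p u
  show "\<J> p u = left_extension (\<J> \<one>) p u"
  proof (cases "u \<in> gen_space M p")
    case True
    then obtain w where "w \<in> gen_space M \<one>" "u = left_section w p" by (rule left_section_surj)
    then show ?thesis by (simp add: left_invariant_section[OF assms(2)] left_extension_section)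
  qed (simp add: left_extension_def endos_off[OF assms(1)])
qed

end

theorem proposition3p1:
  fixes G :: "('g::{t2_space, second_countable_topology}, 'b) monoid_scheme"
    and M :: "('g, 'e::euclidean_space) manifold"
  assumes "lie_group G M"
  shows "bij_betw (\<lambda>\<J>. (\<J> \<one>\<^bsub>G\<^esub>, neutral_pairing))
           {\<J>. generalized_complex M \<J> \<and> left_invariant G M \<J>}
           {(J, g). left_inv_hermitian
                      (cotangent_algebra (lie_algebra G M))
                      (cotangent_bracket (lie_algebra G M) (lie_bracket G M)) J g
                    \<and> g = neutral_pairing}"
proof -
  interpret lie_group G M by fact
  show ?thesis
    unfolding cotangent_algebra_lie_algebra
  \<comment> \<open>The metric component is the constant \<open>neutral_pairing\<close> on both
    sides, so both injectivity and surjectivity concern the endomorphism alone, with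
    \<open>left_extension\<close> as inverse.\<close>
  proof (rule bij_betwI')
    fix \<J> \<J>' assume "\<J> \<in> {\<J>. generalized_complex M \<J> \<and> left_invariant G M \<J>}"
      "\<J>' \<in> {\<J>. generalized_complex M \<J> \<and> left_invariant G M \<J>}"
    then have "\<J> = left_extension (\<J> \<one>\<^bsub>G\<^esub>)" "\<J>' = left_extension (\<J>' \<one>\<^bsub>G\<^esub>)"
      by (auto intro!: left_invariant_determined simp: generalized_complex_def)
    then show "((\<J> \<one>\<^bsub>G\<^esub>, neutral_pairing) = (\<J>' \<one>\<^bsub>G\<^esub>, neutral_pairing)) = (\<J> = \<J>')"
      by (metis prod.inject)
  next
    fix \<J> assume "\<J> \<in> {\<J>. generalized_complex M \<J> \<and> left_invariant G M \<J>}"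
    then show "(\<J> \<one>\<^bsub>G\<^esub>, neutral_pairing) \<in>
        {(J, g). left_inv_hermitian (gen_space M \<one>\<^bsub>G\<^esub>) bracket J g \<and> g = neutral_pairing}"
      using hermitian_of_generalized_complex by simp
  next
    fix Jg assume "Jg \<in> {(J, g). left_inv_hermitian (gen_space M \<one>\<^bsub>G\<^esub>) bracket J g \<and> g = neutral_pairing}"
    then obtain J where J: "Jg = (J, neutral_pairing)"
      "left_inv_hermitian (gen_space M \<one>\<^bsub>G\<^esub>) bracket J neutral_pairing" by auto
    then have "J \<in> endos (gen_space M \<one>\<^bsub>G\<^esub>)" by (simp add: left_inv_hermitian_def left_inv_complex_def)
    then show "\<exists>\<J>\<in>{\<J>. generalized_complex M \<J> \<and> left_invariant G M \<J>}. Jg = (\<J> \<one>\<^bsub>G\<^esub>, neutral_pairing)"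
      using generalized_complex_of_hermitian[OF J(2)] J(1)
      by (intro bexI[of _ "left_extension J"]) (simp_all add: left_extension_left_invariant left_extension_one)
  qed
qed

end
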